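(* Let $\psi:\mathbb{N}\to\mathbb{R}^+$ be a monotonic function such that $$\sum_{q=3}^{\infty}\psi(q)\frac{\log q}{(\log\log q)^{1/2}}=\infty.$$ Let $\gamma,\beta$ be irrational real numbers such that $\sigma_{(\gamma,\beta)}(q)=O\big((\log\log q)^{1/2}\big)$. Let $\gamma'$ be a real number. Then $|W(\psi,\beta,\gamma,\gamma')|=1$.
   Context: $\mathbb{N}=\{1,2,3,\dots\}$ and $\mathbb{R}^+=(0,\infty)$. For real $x$, $\|x\|$ is the distance from $x$ to the nearest integer. $|A|$ denotes the Lebesgue measure of a measurable set $A\subset\mathbb{R}$. $\log$ is the base $2$ logarithm. The bound $f(q)=O(g(q))$ means that there is a constant $C>0$ with $f(q)\le Cg(q)$ for all $q$ for which $g(q)$ is defined and positive (here $q\ge3$). For $\psi:\mathbb{N}\to\mathbb{R}^+$ and real numbers $\beta,\gamma,\gamma'$, $$W(\psi,\beta,\gamma,\gamma')=\{x\in[0,1]:\ \|qx-\gamma\|\,\|q\beta-\gamma'\|<\psi(q)\text{ for infinitely many } q\in\mathbb{N}\}.$$ For real numbers $\gamma,\beta$ and an integer $N\ge2$, $\sigma_{(\gamma,\beta)}(N)\in[0,\infty]$ is the infimum of all $\sigma>0$ such that $$\|k_1\gamma+k_2\beta\|\ge\max\{|k_1|,|k_2|\}^{-\sigma}$$ for all integers $k_1,k_2$ with $2\le\max\{|k_1|,|k_2|\}\le N$ (the infimum of the empty set being $\infty$). *)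

theory Defs
  imports "HOL-Analysis.Analysis"
begin

definition dist_nearest_int :: "real \<Rightarrow> real" where
  "dist_nearest_int x = \<bar>x - of_int (round x)\<bar>"

definition W :: "(nat \<Rightarrow> real) \<Rightarrow> real \<Rightarrow> real \<Rightarrow> real \<Rightarrow> real set" where
  "W \<psi> \<beta> \<gamma> \<gamma>' =
    {x \<in> {0..1}. infinite {q::nat. 1 \<le> q \<and>
       dist_nearest_int (real q * x - \<gamma>) * dist_nearest_int (real q * \<beta> - \<gamma>') < \<psi> q}}"

(* The exponent takes values in [0, \<infinity>]; in ennreal the infimum of the empty set is \<infinity>. *)
definition sigma_exponent :: "real \<Rightarrow> real \<Rightarrow> nat \<Rightarrow> ennreal" where
  "sigma_exponent \<gamma> \<beta> N =
    Inf (ennreal ` {\<sigma>::real. \<sigma> > 0 \<and>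
      (\<forall>k1 k2 :: int. 2 \<le> max \<bar>k1\<bar> \<bar>k2\<bar> \<and> max \<bar>k1\<bar> \<bar>k2\<bar> \<le> int N \<longrightarrow>
         dist_nearest_int (of_int k1 * \<gamma> + of_int k2 * \<beta>) \<ge>
           of_int (max \<bar>k1\<bar> \<bar>k2\<bar>) powr (- \<sigma>))})"

end

theory Submission
  imports Defs "HOL-Analysis.Kronecker_Approximation_Theorem" "HOL-Real_Asymp.Real_Asymp"
begin

text \<open>
  Only \<open>q\<close> with \<open>\<parallel>q\<beta> - \<gamma>'\<parallel> \<approx> 2\<^sup>-\<^sup>j\<close>, \<open>1 \<le> j \<le> J n\<close>, in the dyadic block \<open>2\<^sup>n \<le> q < 2\<^sup>n\<^sup>+\<^sup>1\<close> are used, where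
  \<open>J n\<close> is of order \<open>n / sqrt (log n)\<close>: this is the range in which the hypothesis on \<open>\<sigma>\<close> still forces the
  orbits of \<open>(\<gamma>, g\<beta>)\<close> to be equidistributed, and it is where the factor \<open>log q / sqrt (log (log q))\<close>
  comes from. For such \<open>q\<close> the condition on \<open>x\<close> reads \<open>\<parallel>qx - \<gamma>\<parallel> < \<Delta>\<^sub>q\<close>. Two of these sets, for \<open>q\<close> and
  \<open>q' = q + kg\<close> with \<open>g = gcd q q'\<close>, are quasi-independent unless \<open>k\<gamma>\<close> is very close to an integer; the
  exceptional \<open>k\<close> are counted by a mean square estimate for exponential sums, and summing over \<open>g\<close>
  costs only a factor \<open>\<Sum> 1/g\<^sup>2\<close>. The Chung-Erdos inequality then bounds the measure of the limsup set
  below by an absolute constant \<open>c\<close>.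

  There is no zero-one law to conclude with. Instead, if \<open>q = Mr\<close> and \<open>x = (y + v)/M\<close>, then
  \<open>\<parallel>qx - \<gamma>\<parallel> = \<parallel>ry - \<gamma>\<parallel>\<close>, so the bound for the problem with \<open>\<beta>\<close>, \<open>\<psi>\<close> replaced by \<open>M\<beta>\<close>, \<open>\<psi>(M \<cdot>)\<close> shows that
  \<open>W\<close> fills at least the proportion \<open>c\<close> of every interval \<open>[v/M, (v+1)/M]\<close>; hence it has full measure.
\<close>

section \<open>Distance to the nearest integer\<close>


text \<open>The obstacle is the second moment: for every common divisor g the excess overlap needs a
  saving that survives the sums over g and over all pairs of blocks. All equidistribution comes from
  the single assumption \<open>indep\<close>. Its exponent 20 is 12 for the frequencies of an
  exponential sum plus 8 for the factor g; 2^(n/10) is the error of that sum, and J n <= n/1000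
  keeps it far below the main terms. At height 2^(20 J n) the exponent hypothesis reads sigma =
  O(sqrt (log n)), so a distance to the integers of at least 2^(- n/10) is guaranteed while J n sqrt
  (log n) is at most a small multiple of n. The requirement n^7 <= 2^(J n) makes the errors summable
  over pairs of blocks. What must be uniform is the final bound 10^(-10): the localisation uses it
  for every M, while J, the radii and the starting block may change with M. A nondecreasing \<psi>
  is treated at the end by comparison with a constant.\<close>

abbreviation nd :: "real \<Rightarrow> real" where "nd \<equiv> dist_nearest_int"

lemma nd_le: "nd x \<le> \<bar>x - of_int k\<bar>"
  unfolding dist_nearest_int_def by (rule round_diff_minimal)

lemma nd_nonneg [simp]: "0 \<le> nd x"
  by (simp add: dist_nearest_int_def)

lemma nd_le_half: "nd x \<le> 1/2"
  unfolding dist_nearest_int_def using of_int_round_abs_le[of x] by (simp add: abs_minus_commute)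

lemma nd_witness: obtains k where "nd x = \<bar>x - of_int k\<bar>"
  by (auto simp: dist_nearest_int_def)

lemma nd_minus [simp]: "nd (- x) = nd x"
proof (rule antisym)
  have "nd (- y) \<le> nd y" for y
  proof -
    obtain k where "nd y = \<bar>y - of_int k\<bar>" by (rule nd_witness)
    with nd_le[of "- y" "- k"] show ?thesis by simp
  qed
  from this[of x] this[of "- x"] show "nd (- x) \<le> nd x" "nd x \<le> nd (- x)" by simp_all
qed

lemma nd_add_le: "nd (x + y) \<le> nd x + nd y"
proof -
  obtain j where j: "nd x = \<bar>x - of_int j\<bar>" by (rule nd_witness)
  obtain k where k: "nd y = \<bar>y - of_int k\<bar>" by (rule nd_witness)
  show ?thesis using nd_le[of "x + y" "j + k"] j k by simp
qed

lemma nd_diff_le: "nd (x - y) \<le> nd x + nd y"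
  using nd_add_le[of x "- y"] by simp

lemma nd_add_int [simp]: "nd (x + of_int k) = nd x"
proof (rule antisym)
  have "nd (y + of_int i) \<le> nd y" for y i
  proof -
    obtain j where "nd y = \<bar>y - of_int j\<bar>" by (rule nd_witness)
    with nd_le[of "y + of_int i" "j + i"] show ?thesis by simp
  qed
  from this[of x k] this[of "x + of_int k" "- k"]
  show "nd (x + of_int k) \<le> nd x" "nd x \<le> nd (x + of_int k)" by simp_all
qed

lemma nd_mult_int_le: "nd (of_int k * x) \<le> \<bar>of_int k\<bar> * nd x"
proof -
  obtain j where j: "nd x = \<bar>x - of_int j\<bar>" by (rule nd_witness)
  have "nd (of_int k * x) \<le> \<bar>of_int k * x - of_int (k * j)\<bar>" by (rule nd_le)
  also have "\<dots> = \<bar>of_int k\<bar> * nd x" by (simp add: j abs_mult[symmetric] algebra_simps)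
  finally show ?thesis .
qed

lemma nd_lipschitz: "\<bar>nd x - nd y\<bar> \<le> \<bar>x - y\<bar>"
  using nd_add_le[of y "x - y"] nd_add_le[of x "y - x"] nd_le[of "x - y" 0] nd_le[of "y - x" 0]
  by simp

lemma continuous_on_nd [continuous_intros]:
  assumes "continuous_on S f" shows "continuous_on S (\<lambda>x. nd (f x))"
proof -
  have "continuous_on UNIV nd"
    by (rule continuous_onI) (metis dist_real_def nd_lipschitz le_less_trans less_imp_le)
  from continuous_on_compose2[OF this assms] show ?thesis by simp
qed

section \<open>Exponential sums and counting in Bohr sets\<close>

definition ee :: "real \<Rightarrow> complex" where "ee t = cis (2 * pi * t)"

lemma ee_add: "ee (s + t) = ee s * ee t"
  by (simp add: ee_def cis_mult algebra_simps)

lemma norm_ee [simp]: "norm (ee t) = 1" by (simp add: ee_def)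

lemma ee_cnj: "cnj (ee t) = ee (- t)" by (simp add: ee_def cis_cnj)

lemma ee_int [simp]: "ee (of_int k) = 1" by (simp add: ee_def)

lemma ee_power: "ee t ^ k = ee (of_nat k * t)"
  by (simp add: ee_def Complex.DeMoivre algebra_simps)

lemma ee_diff_int: "ee (t - of_int k) = ee t"
  using ee_add[of "t - of_int k" "of_int k"] by simp

lemma half_le_sin:
  assumes "0 \<le> y" "y \<le> pi / 2" shows "y / 2 \<le> sin y"
proof -
  have "\<bar>sin y - (\<Sum>m<3. sin_coeff m * y ^ m)\<bar> \<le> inverse (fact 3) * \<bar>y\<bar> ^ 3"
    by (rule Maclaurin_sin_bound)
  moreover have "(\<Sum>m<3. sin_coeff m * y ^ m) = y"
    by (simp add: numeral_3_eq_3 sin_coeff_def)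
  ultimately have *: "y - y ^ 3 / 6 \<le> sin y" using assms by (simp add: fact_numeral abs_if split: if_splits)
  have "y \<le> 1.6" using assms pi_approx by simp
  then have "y ^ 2 \<le> 1.6 ^ 2" using assms by (intro power_mono) auto
  then have "y ^ 2 \<le> 3" by (simp add: power2_eq_square)
  then have "y * y ^ 2 \<le> y * 3" using assms by (intro mult_left_mono) auto
  then show ?thesis using * by (simp add: power3_eq_cube power2_eq_square)
qed

text \<open>|1 - e(x)| = 2 |sin(pi x)|, and the weak Jordan inequality \<open>half_le_sin\<close>
  gives 2 sin(pi |x|) >= pi |x|. Constants are immaterial later, so pi is lowered to 1.\<close>

lemma norm_one_minus_ee: "nd t \<le> norm (1 - ee t)"
proof -
  obtain k where k: "nd t = \<bar>t - of_int k\<bar>" by (rule nd_witness)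
  define x where "x = t - of_int k"
  have x: "\<bar>x\<bar> \<le> 1/2" using nd_le_half[of t] k by (simp add: x_def)
  have "ee t = ee x" by (simp add: x_def ee_diff_int)
  have "norm (1 - ee x) ^ 2 = (1 - cos (2*pi*x))^2 + (sin (2*pi*x))^2"
    by (simp add: ee_def cmod_power2)
  also have "\<dots> = 2 - 2 * cos (2 * (pi * x))"
    using sin_cos_squared_add[of "2*pi*x"] by (simp add: power2_eq_square algebra_simps)
  also have "\<dots> = (2 * sin (pi * x))^2"
    by (simp only: cos_double_sin) (simp add: power2_eq_square)
  finally have "sqrt ((norm (1 - ee x))\<^sup>2) = sqrt ((2 * sin (pi * x))\<^sup>2)" by (rule arg_cong)
  then have e: "norm (1 - ee x) = \<bar>2 * sin (pi * x)\<bar>" by (simp only: real_sqrt_abs abs_norm_cancel)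
  have "pi * \<bar>x\<bar> / 2 \<le> sin (pi * \<bar>x\<bar>)"
    using x by (intro half_le_sin) (auto simp: field_simps)
  also have "\<dots> \<le> \<bar>sin (pi * x)\<bar>" by (cases "x \<ge> 0") (auto simp: abs_if)
  finally have "pi * \<bar>x\<bar> \<le> norm (1 - ee x)" using e by (simp add: abs_mult)
  moreover have "1 * \<bar>x\<bar> \<le> pi * \<bar>x\<bar>" using pi_gt3 by (intro mult_right_mono) auto
  ultimately show ?thesis using k \<open>ee t = ee x\<close> by (simp add: x_def)
qed

lemma norm_geometric_ee_le:
  assumes "nd t \<ge> \<eta>" "\<eta> > 0"
  shows "norm (\<Sum>k<K. ee (of_nat k * t)) \<le> 2 / \<eta>"
proof -
  have n1: "norm (1 - ee t) \<ge> \<eta>" using norm_one_minus_ee[of t] assms by simp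
  then have "ee t \<noteq> 1" using assms by auto
  have "(\<Sum>k<K. ee (of_nat k * t)) = (\<Sum>k<K. ee t ^ k)" by (simp add: ee_power)
  also have "\<dots> = (1 - ee t ^ K) / (1 - ee t)" using sum_gp_strict[of "ee t" K] \<open>ee t \<noteq> 1\<close> by simp
  finally have "norm (\<Sum>k<K. ee (of_nat k * t)) = norm (1 - ee t ^ K) / norm (1 - ee t)"
    by (simp add: norm_divide)
  also have "\<dots> \<le> 2 / \<eta>"
  proof (rule frac_le)
    have "norm (1 - ee t ^ K) \<le> norm (1::complex) + norm (ee t ^ K)" by (rule norm_triangle_ineq4)
    then show "norm (1 - ee t ^ K) \<le> 2" by (simp add: norm_power)
  qed (use n1 assms in auto)
  finally show ?thesis .
qed

lemma norm_window_ee_le: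
  assumes "nd t \<ge> \<eta>" "\<eta> > 0"
  shows "norm (\<Sum>k\<in>{s..<s + int K}. ee (of_int k * t + c)) \<le> 2 / \<eta>"
proof -
  have "(\<Sum>k\<in>{s..<s + int K}. ee (of_int k * t + c)) = (\<Sum>k<K. ee (of_int (s + int k) * t + c))"
    by (rule sum.reindex_bij_witness[of _ "\<lambda>k. s + int k" "\<lambda>k. nat (k - s)"]) auto
  also have "\<dots> = (\<Sum>k<K. ee (of_int s * t + c) * ee (of_nat k * t))"
    by (intro sum.cong refl) (simp add: ee_add[symmetric] algebra_simps)
  also have "\<dots> = ee (of_int s * t + c) * (\<Sum>k<K. ee (of_nat k * t))" by (simp add: sum_distrib_left)
  finally show ?thesis using norm_geometric_ee_le[OF assms, of K] by (simp add: norm_mult)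
qed

text \<open>Expanding the square and summing over \<open>k\<close> first leaves a geometric sum for
  each pair of frequencies: at most K on the diagonal, at most 2 / \<eta> off it. Bounding every
  pair by the same 2 / \<eta> is affordable because \<eta> will be about 2^(- m/10), far above
  1/K.\<close>

lemma mean_square_ee_le:
  fixes \<phi> \<alpha> :: "'i \<Rightarrow> real"
  assumes "finite F" "\<eta> > 0"
    and sep: "\<And>i j. i \<in> F \<Longrightarrow> j \<in> F \<Longrightarrow> i \<noteq> j \<Longrightarrow> nd (\<phi> i - \<phi> j) \<ge> \<eta>"
  shows "(\<Sum>k\<in>{s..<s + int K}. (norm (\<Sum>i\<in>F. ee (of_int k * \<phi> i - \<alpha> i)))\<^sup>2)
    \<le> card F * K + (card F)\<^sup>2 * (2 / \<eta>)"
proof -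
  let ?I = "{s..<s + int K}"
  define g where "g i j = (\<Sum>k\<in>?I. ee (of_int k * (\<phi> i - \<phi> j) + (\<alpha> j - \<alpha> i)))" for i j
  have "complex_of_real (\<Sum>k\<in>?I. (norm (\<Sum>i\<in>F. ee (of_int k * \<phi> i - \<alpha> i)))\<^sup>2)
      = (\<Sum>k\<in>?I. (\<Sum>i\<in>F. ee (of_int k * \<phi> i - \<alpha> i)) * cnj (\<Sum>i\<in>F. ee (of_int k * \<phi> i - \<alpha> i)))"
    by (simp only: of_real_sum complex_norm_square)
  also have "\<dots> = (\<Sum>k\<in>?I. \<Sum>i\<in>F. \<Sum>j\<in>F. ee (of_int k * (\<phi> i - \<phi> j) + (\<alpha> j - \<alpha> i)))"
    
  proof (rule sum.cong[OF refl])
    fix k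
    have e: "ee (of_int k * \<phi> i - \<alpha> i) * ee (- (of_int k * \<phi> j - \<alpha> j))
        = ee (of_int k * (\<phi> i - \<phi> j) + (\<alpha> j - \<alpha> i))" for i j
      unfolding ee_add[symmetric] by (simp add: algebra_simps)
    show "(\<Sum>i\<in>F. ee (of_int k * \<phi> i - \<alpha> i)) * cnj (\<Sum>i\<in>F. ee (of_int k * \<phi> i - \<alpha> i))
        = (\<Sum>i\<in>F. \<Sum>j\<in>F. ee (of_int k * (\<phi> i - \<phi> j) + (\<alpha> j - \<alpha> i)))"
      unfolding cnj_sum ee_cnj sum_product e ..
  qed
  also have "\<dots> = (\<Sum>i\<in>F. \<Sum>j\<in>F. g i j)"
    unfolding g_def by (subst sum.swap) (intro sum.cong refl sum.swap)
  finally have "norm (complex_of_real (\<Sum>k\<in>?I. (norm (\<Sum>i\<in>F. ee (of_int k * \<phi> i - \<alpha> i)))\<^sup>2))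
      = norm (\<Sum>i\<in>F. \<Sum>j\<in>F. g i j)" by (rule arg_cong)
  moreover have "0 \<le> (\<Sum>k\<in>?I. (norm (\<Sum>i\<in>F. ee (of_int k * \<phi> i - \<alpha> i)))\<^sup>2)"
    by (rule sum_nonneg) simp
  ultimately have "(\<Sum>k\<in>?I. (norm (\<Sum>i\<in>F. ee (of_int k * \<phi> i - \<alpha> i)))\<^sup>2) = norm (\<Sum>i\<in>F. \<Sum>j\<in>F. g i j)"
    by (simp only: norm_of_real abs_of_nonneg)
  also have "\<dots> \<le> (\<Sum>i\<in>F. \<Sum>j\<in>F. norm (g i j))"
    by (rule sum_norm_le) (rule norm_sum)
  also have "\<dots> \<le> (\<Sum>i\<in>F. \<Sum>j\<in>F. (if i = j then real K else 0) + 2 / \<eta>)"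
  proof (intro sum_mono)
    fix i j assume ij: "i \<in> F" "j \<in> F"
    show "norm (g i j) \<le> (if i = j then real K else 0) + 2 / \<eta>"
    proof (cases "i = j")
      case True
      have "norm (g i j) \<le> (\<Sum>k\<in>?I. 1)" unfolding g_def by (rule sum_norm_le) simp
      then show ?thesis using True \<open>\<eta> > 0\<close> by (simp add: add_increasing2)
    next
      case False
      then show ?thesis using norm_window_ee_le[OF sep[OF ij False] \<open>\<eta> > 0\<close>] by (simp add: g_def)
    qed
  qed
  also have "\<dots> = card F * K + (card F)\<^sup>2 * (2 / \<eta>)"
    using \<open>finite F\<close> by (simp add: sum.distrib sum.delta power2_eq_square algebra_simps)
  finally show ?thesis .
qed

lemma half_le_Re_ee:
  assumes "\<bar>t - of_int k\<bar> \<le> 1/6" shows "1/2 \<le> Re (ee t)"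
proof -
  have "Re (ee t) = Re (ee (t - of_int k))" by (simp add: ee_diff_int)
  also have "\<dots> = cos \<bar>2 * pi * (t - of_int k)\<bar>" by (simp add: ee_def)
  also have "\<dots> \<ge> cos (pi / 3)"
  proof (rule cos_monotone_0_pi_le)
    have "2 * pi * \<bar>t - of_int k\<bar> \<le> 2 * pi * (1/6)" using assms by (intro mult_left_mono) auto
    then show "\<bar>2 * pi * (t - real_of_int k)\<bar> \<le> pi / 3" by (simp add: abs_mult)
  qed auto
  finally show ?thesis by (simp add: cos_60)
qed

text \<open>Chebyshev's inequality for an exponential sum over an H1 by H2 box of frequencies. For
  \<open>k\<close> in the Bohr set every phase is within 1/12 + 1/12 of an integer, where the real
  part is at least cos(pi/3) = 1/2, so the sum reaches half its number of terms. With H1 of order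
  1/x1 and H2 of order 1/x2 the first term is the expected K x1 x2 up to a constant. The centres
  \<alpha>1, \<alpha>2 only shift phases, so the bound is uniform in them.\<close>

lemma card_bohr_le:
  fixes \<theta>1 \<theta>2 \<alpha>1 \<alpha>2 \<eta> x1 x2 :: real and H1 H2 K :: nat
  assumes H: "H1 \<ge> 1" "H2 \<ge> 1" and "\<eta> > 0"
    and x1: "(real H1 - 1) * x1 \<le> 1/12" and x2: "(real H2 - 1) * x2 \<le> 1/12"
    and sep: "\<And>h1 h2 :: int. (h1, h2) \<noteq> (0, 0) \<Longrightarrow> \<bar>h1\<bar> < int H1 \<Longrightarrow> \<bar>h2\<bar> < int H2 \<Longrightarrow>
       nd (of_int h1 * \<theta>1 + of_int h2 * \<theta>2) \<ge> \<eta>"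
    and S: "S \<subseteq> {s..<s + int K}"
      "\<And>k. k \<in> S \<Longrightarrow> nd (of_int k * \<theta>1 - \<alpha>1) \<le> x1" "\<And>k. k \<in> S \<Longrightarrow> nd (of_int k * \<theta>2 - \<alpha>2) \<le> x2"
  shows "real (card S) \<le> 4 * real K / (real H1 * real H2) + 8 / \<eta>"
proof -
  define F where "F = {..<H1} \<times> {..<H2}"
  define \<phi> where "\<phi> = (\<lambda>(a::nat, b::nat). real a * \<theta>1 + real b * \<theta>2)"
  define \<alpha> where "\<alpha> = (\<lambda>(a::nat, b::nat). real a * \<alpha>1 + real b * \<alpha>2)"
  let ?T = "\<lambda>k. \<Sum>i\<in>F. ee (of_int k * \<phi> i - \<alpha> i)"
  have F: "finite F" "card F = H1 * H2" by (auto simp: F_def)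
  have "nd (\<phi> i - \<phi> j) \<ge> \<eta>" if ij: "i \<in> F" "j \<in> F" "i \<noteq> j" for i j
  proof -
    obtain a b a' b' where e: "i = (a, b)" "j = (a', b')" by (cases i, cases j)
    have "\<phi> i - \<phi> j = of_int (int a - int a') * \<theta>1 + of_int (int b - int b') * \<theta>2"
      by (simp add: \<phi>_def e algebra_simps)
    moreover have "nd \<dots> \<ge> \<eta>" by (rule sep) (use ij e in \<open>auto simp: F_def\<close>)
    ultimately show ?thesis by simp
  qed
  note ms = mean_square_ee_le[OF F(1) \<open>\<eta> > 0\<close> this, where s = s and K = K and \<alpha> = \<alpha>]
  have low: "(H1 * H2 / 2)\<^sup>2 \<le> (norm (?T k))\<^sup>2" if k: "k \<in> S" for k
  proof -
    have "1/2 \<le> Re (ee (of_int k * \<phi> i - \<alpha> i))" if i: "i \<in> F" for i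
    proof -
      obtain a b where e: "i = (a, b)" by (cases i)
      have ab: "real a \<le> real H1 - 1" "real b \<le> real H2 - 1" using i e by (auto simp: F_def)
      obtain u where u: "nd (of_int k * \<theta>1 - \<alpha>1) = \<bar>of_int k * \<theta>1 - \<alpha>1 - of_int u\<bar>" by (rule nd_witness)
      obtain v where v: "nd (of_int k * \<theta>2 - \<alpha>2) = \<bar>of_int k * \<theta>2 - \<alpha>2 - of_int v\<bar>" by (rule nd_witness)
      have "\<bar>of_int k * \<phi> i - \<alpha> i - of_int (int a * u + int b * v)\<bar> =
        \<bar>real a * (of_int k * \<theta>1 - \<alpha>1 - of_int u) + real b * (of_int k * \<theta>2 - \<alpha>2 - of_int v)\<bar>"
        by (simp add: \<phi>_def \<alpha>_def e algebra_simps)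
      also have "\<dots> \<le> real a * \<bar>of_int k * \<theta>1 - \<alpha>1 - of_int u\<bar> + real b * \<bar>of_int k * \<theta>2 - \<alpha>2 - of_int v\<bar>"
        by (rule order_trans[OF abs_triangle_ineq]) (simp add: abs_mult)
      also have "\<dots> \<le> (real H1 - 1) * x1 + (real H2 - 1) * x2"
        using ab S(2,3)[OF k] u v by (intro add_mono mult_mono) auto
      also have "\<dots> \<le> 1/6" using x1 x2 by simp
      finally show ?thesis by (rule half_le_Re_ee)
    qed
    then have "(\<Sum>i\<in>F. 1/2) \<le> (\<Sum>i\<in>F. Re (ee (of_int k * \<phi> i - \<alpha> i)))" by (rule sum_mono)
    also have "\<dots> = Re (?T k)" by simp
    also have "\<dots> \<le> norm (?T k)" by (rule complex_Re_le_cmod)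
    finally have "H1 * H2 / 2 \<le> norm (?T k)" using F by simp
    then show ?thesis by (intro power_mono) auto
  qed
  have "card S * (H1 * H2 / 2)\<^sup>2 = (\<Sum>k\<in>S. (H1 * H2 / 2)\<^sup>2)" by simp
  also have "\<dots> \<le> (\<Sum>k\<in>S. (norm (?T k))\<^sup>2)" by (rule sum_mono) (rule low)
  also have "\<dots> \<le> (\<Sum>k\<in>{s..<s + int K}. (norm (?T k))\<^sup>2)" using S(1) by (intro sum_mono2) auto
  also have "\<dots> \<le> card F * K + (card F)\<^sup>2 * (2 / \<eta>)" by (rule ms)
  finally have *: "card S * (H1 * H2 / 2)\<^sup>2 \<le> H1 * H2 * K + (real (H1 * H2))\<^sup>2 * (2 / \<eta>)" using F by simp
  define P where "P = real H1 * real H2"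
  have P: "P > 0" using H by (simp add: P_def)
  have "real (card S) = card S * (P / 2)\<^sup>2 * (4 / P\<^sup>2)" using P by (simp add: power2_eq_square)
  also have "\<dots> \<le> (P * K + P\<^sup>2 * (2 / \<eta>)) * (4 / P\<^sup>2)"
    using * by (intro mult_right_mono) (simp_all add: P_def)
  also have "\<dots> = 4 * K / P + 8 / \<eta>" using P by (simp add: power2_eq_square field_simps)
  finally show ?thesis by (simp add: P_def)
qed

section \<open>Measure of overlaps\<close>


lemma card_separated_le:
  fixes T :: "int set" and a b L :: real
  assumes "L > 0" "a \<le> b" and T: "\<And>x. x \<in> T \<Longrightarrow> a \<le> of_int x \<and> of_int x \<le> b"
    and sep: "\<And>x y. x \<in> T \<Longrightarrow> y \<in> T \<Longrightarrow> x \<noteq> y \<Longrightarrow> L \<le> \<bar>of_int x - of_int y\<bar>"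
  shows "finite T" "card T \<le> (b - a) / L + 1"
proof -
  define f where "f x = \<lfloor>(of_int x - a) / L\<rfloor>" for x :: int
  have inj: "inj_on f T"
  proof (rule inj_onI, rule ccontr)
    fix x y assume xy: "x \<in> T" "y \<in> T" "f x = f y" "x \<noteq> y"
    have "\<bar>(of_int x - a) / L - (of_int y - a) / L\<bar> < 1"
      using xy(3) unfolding f_def by linarith
    moreover have "(of_int x - a) / L - (of_int y - a) / L = (of_int x - of_int y) / L"
      by (simp add: diff_divide_distrib)
    ultimately have "\<bar>of_int x - of_int y\<bar> < L" using \<open>L > 0\<close> by (simp add: divide_simps split: if_splits)
    with sep[OF xy(1,2,4)] show False by simp
  qed
  have sub: "f ` T \<subseteq> {0..\<lfloor>(b - a) / L\<rfloor>}"
  proof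
    fix z assume "z \<in> f ` T"
    then obtain x where x: "x \<in> T" "z = f x" by auto
    then show "z \<in> {0..\<lfloor>(b - a) / L\<rfloor>}" using T[OF x(1)] \<open>L > 0\<close>
      by (auto simp: f_def intro!: floor_mono divide_right_mono)
  qed
  show "finite T" using finite_imageD[OF finite_subset[OF sub] inj] by simp
  have "card T = card (f ` T)" using card_image[OF inj] by simp
  also have "\<dots> \<le> card {0..\<lfloor>(b - a) / L\<rfloor>}" using sub by (intro card_mono) auto
  also have "\<dots> = nat (\<lfloor>(b - a) / L\<rfloor> + 1)" by simp
  finally have "real (card T) \<le> real (nat (\<lfloor>(b - a) / L\<rfloor> + 1))" by simp
  also have "0 \<le> (b - a) / L" using assms by simp
  then have "real (nat (\<lfloor>(b - a) / L\<rfloor> + 1)) \<le> (b - a) / L + 1" by simp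
  finally show "card T \<le> (b - a) / L + 1" .
qed

definition hit :: "real \<Rightarrow> nat \<Rightarrow> real \<Rightarrow> real set" where
  "hit \<gamma> q \<Delta> = {x \<in> {0..1}. nd (real q * x - \<gamma>) < \<Delta>}"

lemma hit_lmeasurable [measurable, simp, intro]: "hit \<gamma> q \<Delta> \<in> lmeasurable"
proof -
  have "open {x. nd (real q * x - \<gamma>) < \<Delta>}" by (intro open_Collect_less continuous_intros)
  then have "{0..1} \<inter> {x. nd (real q * x - \<gamma>) < \<Delta>} \<in> lmeasurable"
    by (intro fmeasurable_Int_fmeasurable) auto
  moreover have "hit \<gamma> q \<Delta> = {0..1} \<inter> {x. nd (real q * x - \<gamma>) < \<Delta>}" by (auto simp: hit_def)
  ultimately show ?thesis by simp
qed

text \<open>A pair (p, p') in \<open>P\<close> stands for centres (\<gamma> + p)/q and (\<gamma> +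
  p')/q' at distance below D/(q q'). With q = g r and q' = g r', the integer q p' - q' p equals g
  \<nu>. At most 2D/g + 1 values \<nu> occur, and each fixes p modulo r, leaving at most 3g choices.
  For D >= g/2 this gives 12 D; for D < g/2 at most one \<nu> survives, and its existence says that
  \<gamma> (q' - q)/g is within D/g of an integer.\<close>

lemma card_lattice_points_le:
  fixes q q' :: nat and \<gamma> D :: real
  assumes q: "q \<ge> 1" "q' \<ge> 1" and "D > 0"
  defines "g \<equiv> gcd q q'"
  defines "P \<equiv> {(p::int, p'::int). - \<gamma> - 1/2 \<le> of_int p \<and> of_int p \<le> real q - \<gamma> + 1/2 \<and>
     \<bar>of_int (int q * p' - int q' * p) + \<gamma> * (real q - real q')\<bar> < D}"
  shows "finite P"
    and "D \<ge> real g / 2 \<Longrightarrow> real (card P) \<le> 12 * D"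
    and "D < real g / 2 \<Longrightarrow> real (card P) \<le> 3 * real g * of_bool (nd (\<gamma> * ((real q' - real q) / real g)) < D / real g)"
proof -
  define r where "r = q div g"
  define r' where "r' = q' div g"
  have g: "g \<ge> 1" using q by (simp add: g_def Suc_le_eq)
  have qr: "q = g * r" "q' = g * r'" by (simp_all add: r_def r'_def g_def)
  have r: "r \<ge> 1" using q qr by (cases r) auto
  have cop: "coprime (int r) (int r')"
    using q div_gcd_coprime[of q q'] by (simp add: r_def r'_def g_def)
  define V where "V = {\<nu>::int. \<bar>real g * of_int \<nu> + \<gamma> * (real q - real q')\<bar> < D}"
  define c where "c = - (\<gamma> * (real q - real q')) / real g"
  have V: "c - D / g \<le> of_int \<nu> \<and> of_int \<nu> \<le> c + D / g" if "\<nu> \<in> V" for \<nu>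
  proof -
    have "of_int \<nu> - c = (real g * of_int \<nu> + \<gamma> * (real q - real q')) / real g"
      using g by (simp add: c_def field_simps)
    moreover have "\<bar>(real g * of_int \<nu> + \<gamma> * (real q - real q')) / real g\<bar> < D / real g"
      using that g by (simp add: V_def abs_divide divide_strict_right_mono)
    ultimately have "\<bar>of_int \<nu> - c\<bar> < D / real g" by simp
    then show ?thesis by linarith
  qed
  have D: "D / g > 0" using g \<open>D > 0\<close> by simp
  have V1: "finite V" "real (card V) \<le> ((c + D / g) - (c - D / g)) / 1 + 1"
  proof -
    have s: "1 \<le> \<bar>of_int x - of_int y :: real\<bar>" if "x \<noteq> y" for x y :: int using that by linarith
    show "finite V" "real (card V) \<le> ((c + D / g) - (c - D / g)) / 1 + 1"
      by (rule card_separated_le[where T = V and L = 1]; use V D s in auto)+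
  qed
  define fib where "fib \<nu> = {pp \<in> P. int r * snd pp - int r' * fst pp = \<nu>}" for \<nu>
  have fib: "finite (fib \<nu>)" "real (card (fib \<nu>)) \<le> 3 * real g" for \<nu>
  proof -
    have inj: "inj_on fst (fib \<nu>)" using r by (auto simp: fib_def inj_on_def)
    let ?T = "fst ` fib \<nu>"
    have a: "(real q - \<gamma> + 1/2) - (- \<gamma> - 1/2) = real q + 1" by simp
    have sep: "real r \<le> \<bar>of_int x - of_int y\<bar>" if xy: "x \<in> ?T" "y \<in> ?T" "x \<noteq> y" for x y
    proof -
      obtain x' y' where "int r * x' - int r' * x = \<nu>" "int r * y' - int r' * y = \<nu>"
        using xy by (auto simp: fib_def)
      then have "int r' * (x - y) = int r * (x' - y')" by (simp add: algebra_simps)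
      then have "int r dvd int r' * (x - y)" by simp
      then have "int r dvd x - y" using cop by (simp add: coprime_dvd_mult_right_iff)
      then have "int r \<le> \<bar>x - y\<bar>" using \<open>x \<noteq> y\<close> by (simp add: zdvd_imp_le dvd_imp_le_int)
      then have "real_of_int (int r) \<le> real_of_int \<bar>x - y\<bar>" by (simp only: of_int_le_iff)
      then show ?thesis by simp
    qed
    have T: "finite ?T" "real (card ?T) \<le> ((real q - \<gamma> + 1/2) - (- \<gamma> - 1/2)) / real r + 1"
      by (rule card_separated_le[where T = ?T and L = "real r"];
          use r sep in \<open>auto simp: fib_def P_def\<close>)+
    show "finite (fib \<nu>)" using finite_imageD[OF T(1) inj] .
    have "real (card (fib \<nu>)) = real (card ?T)" using card_image[OF inj] by simp
    also have "\<dots> \<le> (real q + 1) / real r + 1" using T(2) by simp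
    also have "\<dots> = real g + 1 / real r + 1" using r qr by (simp add: field_simps)
    also have "\<dots> \<le> 3 * real g"
    proof -
      have "1 / real r \<le> 1" using r by simp
      then show ?thesis using g by linarith
    qed
    finally show "real (card (fib \<nu>)) \<le> 3 * real g" .
  qed
  have PV: "P \<subseteq> (\<Union>\<nu>\<in>V. fib \<nu>)"
  proof
    fix pp assume pp: "pp \<in> P"
    define \<nu> where "\<nu> = int r * snd pp - int r' * fst pp"
    have "int q * snd pp - int q' * fst pp = int g * \<nu>" by (simp add: \<nu>_def qr algebra_simps)
    then have "real_of_int (int q * snd pp - int q' * fst pp) = real g * of_int \<nu>"
      by (metis of_int_mult of_int_of_nat_eq)
    then have "\<nu> \<in> V" using pp by (auto simp: V_def P_def)
    moreover have "pp \<in> fib \<nu>" using pp by (simp add: fib_def \<nu>_def)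
    ultimately show "pp \<in> (\<Union>\<nu>\<in>V. fib \<nu>)" by blast
  qed
  show "finite P" using finite_subset[OF PV] V1(1) fib(1) by auto
  have "card P \<le> card (\<Union>\<nu>\<in>V. fib \<nu>)" using PV V1(1) fib(1) by (intro card_mono) auto
  also have "\<dots> \<le> (\<Sum>\<nu>\<in>V. card (fib \<nu>))" by (rule card_UN_le[OF V1(1)])
  finally have "real (card P) \<le> (\<Sum>\<nu>\<in>V. real (card (fib \<nu>)))" by (simp flip: of_nat_sum)
  also have "\<dots> \<le> (\<Sum>\<nu>\<in>V. 3 * real g)" by (rule sum_mono) (rule fib)
  finally have cP: "real (card P) \<le> real (card V) * (3 * real g)" by simp
  show "real (card P) \<le> 12 * D" if "D \<ge> real g / 2"
  proof -
    have "1 \<le> 2 * (D / g)" using that g by (simp add: field_simps)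
    then have "real (card V) \<le> 4 * (D / g)" using V1(2) by simp
    then have "real (card V) * (3 * real g) \<le> 4 * (D / g) * (3 * real g)" by (intro mult_right_mono) auto
    also have "\<dots> = 12 * D" using g by simp
    finally show ?thesis using cP by linarith
  qed
  show "real (card P) \<le> 3 * real g * of_bool (nd (\<gamma> * ((real q' - real q) / real g)) < D / real g)" if "D < real g / 2"
  proof (cases "V = {}")
    case True
    then show ?thesis using cP by simp
  next
    case False
    then obtain \<nu> where \<nu>: "\<nu> \<in> V" by blast
    have "2 * (D / g) < 1" using that g by (simp add: field_simps)
    then have "real (card V) < 2" using V1(2) by simp
    then have "real (card V) \<le> 1" by simp
    then have "real (card V) * (3 * real g) \<le> 1 * (3 * real g)" by (intro mult_right_mono) auto
    moreover have "nd (\<gamma> * ((real q' - real q) / real g)) < D / real g"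
    proof -
      have "nd (\<gamma> * ((real q' - real q) / real g)) \<le> \<bar>\<gamma> * ((real q' - real q) / real g) - of_int \<nu>\<bar>" by (rule nd_le)
      also have "\<dots> = \<bar>real g * of_int \<nu> + \<gamma> * (real q - real q')\<bar> / g"
      proof -
        have "\<gamma> * ((real q' - real q) / real g) - of_int \<nu> = - ((real g * of_int \<nu> + \<gamma> * (real q - real q')) / g)"
          using g by (simp add: field_simps)
        then show ?thesis by (simp only: abs_minus_cancel abs_divide abs_of_nat)
      qed
      also have "\<dots> < D / g" using \<nu> g by (intro divide_strict_right_mono) (auto simp: V_def)
      finally show ?thesis .
    qed
    ultimately show ?thesis using cP by simp
  qed
qed

text \<open>The intersection is covered by the intersections of interval pairs counted in
  \<open>card_lattice_points_le\<close>, each of length at most twice the minimum. For D >= g/2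
  there are O(D) pairs and the events are quasi-independent; otherwise up to 3g pairs may share one
  alignment, which is the extra term.\<close>

lemma measure_hit_Int_le:
  fixes q q' :: nat and \<gamma> \<Delta> \<Delta>' :: real
  assumes q: "q \<ge> 1" "q' \<ge> 1" and \<Delta>: "0 < \<Delta>" "\<Delta> \<le> 1/2" "0 < \<Delta>'" "\<Delta>' \<le> 1/2"
  defines "g \<equiv> gcd q q'" and "D \<equiv> q' * \<Delta> + q * \<Delta>'"
  shows "measure lebesgue (hit \<gamma> q \<Delta> \<inter> hit \<gamma> q' \<Delta>') \<le> 48 * \<Delta> * \<Delta>' +
     6 * g * min (\<Delta> / q) (\<Delta>' / q') * of_bool (nd (\<gamma> * ((real q' - real q) / real g)) < D / real g)"
proof -
  let ?min = "min (\<Delta> / q) (\<Delta>' / q')"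
  have D: "D > 0" unfolding D_def using q \<Delta> by (intro add_pos_pos mult_pos_pos) auto
  define P where "P = {(p::int, p'::int). - \<gamma> - 1/2 \<le> of_int p \<and> of_int p \<le> real q - \<gamma> + 1/2 \<and>
     \<bar>of_int (int q * p' - int q' * p) + \<gamma> * (real q - real q')\<bar> < D}"
  note cP = card_lattice_points_le[OF q D, of \<gamma>, folded P_def g_def]
  define I where "I q \<Delta> p = {(\<gamma> + of_int p - \<Delta>) / real q..(\<gamma> + of_int p + \<Delta>) / real q}" for q \<Delta> p
  have I: "measure lebesgue (I q \<Delta> p) = 2 * (\<Delta> / q)" "I q \<Delta> p \<in> lmeasurable" if "q \<ge> 1" "\<Delta> > 0" for q \<Delta> p
    using that by (auto simp: I_def field_simps divide_right_mono)
  have sub: "hit \<gamma> q \<Delta> \<inter> hit \<gamma> q' \<Delta>' \<subseteq> (\<Union>pp\<in>P. I q \<Delta> (fst pp) \<inter> I q' \<Delta>' (snd pp))"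
  proof
    fix x assume "x \<in> hit \<gamma> q \<Delta> \<inter> hit \<gamma> q' \<Delta>'"
    then have x: "0 \<le> x" "x \<le> 1" "nd (real q * x - \<gamma>) < \<Delta>" "nd (real q' * x - \<gamma>) < \<Delta>'" by (auto simp: hit_def)
    obtain p where p: "nd (real q * x - \<gamma>) = \<bar>real q * x - \<gamma> - of_int p\<bar>" by (rule nd_witness)
    obtain p' where p': "nd (real q' * x - \<gamma>) = \<bar>real q' * x - \<gamma> - of_int p'\<bar>" by (rule nd_witness)
    have qx: "0 \<le> real q * x" "real q * x \<le> real q"
      using x q by (auto simp: mult_left_le)
    have "\<bar>of_int (int q * p' - int q' * p) + \<gamma> * (real q - real q')\<bar>
       = \<bar>real q' * (real q * x - \<gamma> - of_int p) - real q * (real q' * x - \<gamma> - of_int p')\<bar>"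
      by (simp add: algebra_simps)
    also have "\<dots> \<le> real q' * \<bar>real q * x - \<gamma> - of_int p\<bar> + real q * \<bar>real q' * x - \<gamma> - of_int p'\<bar>"
      by (rule order_trans[OF abs_triangle_ineq4]) (simp add: abs_mult)
    also have "\<dots> < D" unfolding D_def using x(3,4) p p' q by (intro add_strict_mono mult_strict_left_mono) auto
    finally have "(p, p') \<in> P" using x(3) p qx \<Delta>(2) unfolding P_def by (simp add: abs_less_iff)
    moreover have "x \<in> I q \<Delta> p" "x \<in> I q' \<Delta>' p'" using x p p' q
      by (auto simp: I_def field_simps abs_less_iff)
    ultimately show "x \<in> (\<Union>pp\<in>P. I q \<Delta> (fst pp) \<inter> I q' \<Delta>' (snd pp))" by force
  qed
  have m: "I q \<Delta> p \<inter> I q' \<Delta>' p' \<in> lmeasurable" for p p' using I q \<Delta> by auto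
  have one: "measure lebesgue (I q \<Delta> p \<inter> I q' \<Delta>' p') \<le> 2 * ?min" for p p'
  proof -
    have "measure lebesgue (I q \<Delta> p \<inter> I q' \<Delta>' p') \<le> measure lebesgue (I q \<Delta> p)"
      using I q \<Delta> m by (intro measure_mono_fmeasurable) (auto simp: fmeasurableD)
    moreover have "measure lebesgue (I q \<Delta> p \<inter> I q' \<Delta>' p') \<le> measure lebesgue (I q' \<Delta>' p')"
      using I q \<Delta> m by (intro measure_mono_fmeasurable) (auto simp: fmeasurableD)
    ultimately show ?thesis using I q \<Delta> by simp
  qed
  have "measure lebesgue (hit \<gamma> q \<Delta> \<inter> hit \<gamma> q' \<Delta>') \<le> measure lebesgue (\<Union>pp\<in>P. I q \<Delta> (fst pp) \<inter> I q' \<Delta>' (snd pp))"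
    using cP(1) m by (intro measure_mono_fmeasurable sub fmeasurable.finite_UN) (auto intro!: fmeasurableD)
  also have "\<dots> \<le> (\<Sum>pp\<in>P. measure lebesgue (I q \<Delta> (fst pp) \<inter> I q' \<Delta>' (snd pp)))"
    using cP(1) m by (intro measure_UNION_le) (auto intro: fmeasurableD)
  also have "\<dots> \<le> (\<Sum>pp\<in>P. 2 * ?min)" by (rule sum_mono) (rule one)
  finally have main: "measure lebesgue (hit \<gamma> q \<Delta> \<inter> hit \<gamma> q' \<Delta>') \<le> card P * (2 * ?min)" by simp
  have min0: "0 \<le> ?min" using \<Delta> by simp
  show ?thesis
  proof (cases "D \<ge> real g / 2")
    case True
    have "card P * (2 * ?min) \<le> 12 * D * (2 * ?min)" using cP(2)[OF True] min0 by (intro mult_right_mono) auto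
    also have "\<dots> = 24 * (q' * (\<Delta> * ?min) + q * (\<Delta>' * ?min))" by (simp add: D_def algebra_simps)
    \<comment> \<open>In each summand of D the minimum is replaced by the entry whose denominator
      cancels the factor in front, so both become \<Delta> \<Delta>'.\<close>
    also have "\<dots> \<le> 24 * (q' * (\<Delta> * (\<Delta>' / q')) + q * (\<Delta>' * (\<Delta> / q)))"
      using \<Delta> q by (intro mult_left_mono add_mono) auto
    also have "\<dots> = 48 * \<Delta> * \<Delta>'" using q by (simp add: field_simps)
    finally have "measure lebesgue (hit \<gamma> q \<Delta> \<inter> hit \<gamma> q' \<Delta>') \<le> 48 * \<Delta> * \<Delta>'" using main by simp
    moreover have "0 \<le> 6 * g * ?min * of_bool (nd (\<gamma> * ((real q' - real q) / real g)) < D / real g)"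
      using min0 by (intro mult_nonneg_nonneg) auto
    ultimately show ?thesis by linarith
  next
    case False
    have "card P * (2 * ?min) \<le> (3 * real g * of_bool (nd (\<gamma> * ((real q' - real q) / real g)) < D / real g)) * (2 * ?min)"
      using cP(3) False min0 by (intro mult_right_mono) auto
    moreover have "0 \<le> 48 * \<Delta> * \<Delta>'" using \<Delta> by simp
    ultimately show ?thesis using main by (simp add: algebra_simps)
  qed
qed

section \<open>Chung-Erdos inequality and uniformly sparse sets\<close>


lemma chung_erdos:
  fixes A :: "'i \<Rightarrow> 'a set"
  assumes X: "finite X" and A: "\<And>i. i \<in> X \<Longrightarrow> A i \<in> fmeasurable M"
  shows "(\<Sum>i\<in>X. measure M (A i))\<^sup>2 \<le> measure M (\<Union>i\<in>X. A i) * (\<Sum>i\<in>X. \<Sum>j\<in>X. measure M (A i \<inter> A j))"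
proof -
  define U where "U = (\<Union>i\<in>X. A i)"
  define S where "S = (\<Sum>i\<in>X. measure M (A i))"
  define V where "V = (\<Sum>i\<in>X. \<Sum>j\<in>X. measure M (A i \<inter> A j))"
  define f where "f x = (\<Sum>i\<in>X. indicat_real (A i) x)" for x
  have U: "U \<in> fmeasurable M" unfolding U_def using X A by (rule fmeasurable.finite_UN)
  have ind: "integrable M (indicat_real B)" "integral\<^sup>L M (indicat_real B) = measure M B" if "B \<in> fmeasurable M" for B
    using that by (auto simp: fmeasurable_def integrable_indicator_iff)
  have fU: "f x * indicat_real U x = f x" for x
    unfolding f_def U_def sum_distrib_right by (rule sum.cong) (auto simp: indicator_def)
  have f2: "f x * f x = (\<Sum>i\<in>X. \<Sum>j\<in>X. indicat_real (A i \<inter> A j) x)" for x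
    unfolding f_def sum_product by (simp add: indicator_inter_arith)
  have Aij: "A i \<inter> A j \<in> fmeasurable M" if "i \<in> X" "j \<in> X" for i j
    using A that by (intro fmeasurable_Int_fmeasurable fmeasurableD) auto
  have if1: "integrable M f" "integral\<^sup>L M f = S"
    unfolding f_def S_def using A by (simp_all add: ind)
  have if2: "integrable M (\<lambda>x. f x * f x)" "integral\<^sup>L M (\<lambda>x. f x * f x) = V"
    unfolding f2 V_def using Aij by (simp_all add: ind)
  \<comment> \<open>Cauchy-Schwarz for f and the indicator of U in quadratic form: f vanishes off U,
    and t = S / measure M U minimises the right-hand side.\<close>
  have quad: "0 \<le> V - 2 * t * S + t\<^sup>2 * measure M U" for t
  proof -
    have "0 \<le> integral\<^sup>L M (\<lambda>x. (f x - t * indicat_real U x)\<^sup>2)" by (rule integral_nonneg_AE) simp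
    also have "(\<lambda>x. (f x - t * indicat_real U x)\<^sup>2) =
      (\<lambda>x. f x * f x - 2 * t * f x + t\<^sup>2 * indicat_real U x)"
    proof
      fix x
      have "indicat_real U x * indicat_real U x = indicat_real U x" by (simp add: indicator_def)
      have "(f x - t * indicat_real U x)\<^sup>2 = f x * f x - 2 * t * (f x * indicat_real U x)
         + t\<^sup>2 * (indicat_real U x * indicat_real U x)" by (simp add: power2_eq_square algebra_simps)
      also have "\<dots> = f x * f x - 2 * t * f x + t\<^sup>2 * indicat_real U x"
        by (simp only: fU \<open>indicat_real U x * indicat_real U x = indicat_real U x\<close>)
      finally show "(f x - t * indicat_real U x)\<^sup>2 = f x * f x - 2 * t * f x + t\<^sup>2 * indicat_real U x" .
    qed
    also have "integral\<^sup>L M \<dots> = V - 2 * t * S + t\<^sup>2 * measure M U"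
      using if1 if2 ind[OF U] by simp
    finally show ?thesis .
  qed
  have S0: "S \<le> card X * measure M U"
  proof -
    have "S \<le> (\<Sum>i\<in>X. measure M U)" unfolding S_def
      using A U by (intro sum_mono measure_mono_fmeasurable) (auto simp: U_def)
    then show ?thesis by simp
  qed
  have "S \<ge> 0" unfolding S_def by (simp add: sum_nonneg)
  have "S\<^sup>2 \<le> measure M U * V"
  proof (cases "measure M U = 0")
    case True
    then show ?thesis using S0 \<open>S \<ge> 0\<close> by simp
  next
    case False
    then have m: "measure M U > 0" by (simp add: zero_less_measure_iff)
    have "0 \<le> (V - 2 * (S / measure M U) * S + (S / measure M U)\<^sup>2 * measure M U) * measure M U"
      using quad[of "S / measure M U"] m by (intro mult_nonneg_nonneg) auto
    also have "\<dots> = V * measure M U - S\<^sup>2" using m by (simp add: power2_eq_square field_simps)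
    finally show ?thesis by (simp add: mult.commute)
  qed
  then show ?thesis by (simp add: S_def V_def U_def)
qed

text \<open>At most M (b - a) + 2 cells of the grid of mesh 1/M meet [a, b]. The two cells in excess
  contribute 2 \<kappa> / M, which the choice of M makes at most e.\<close>

lemma measure_Int_interval_le:
  fixes F :: "real set" and \<kappa> :: real
  assumes F: "F \<in> sets lebesgue" "F \<subseteq> {0..1}" and "\<kappa> \<ge> 0"
    and loc: "\<And>M v. M \<ge> (1::nat) \<Longrightarrow> v < M \<Longrightarrow> measure lebesgue (F \<inter> {real v / real M..(real v + 1) / real M}) \<le> \<kappa> / M"
    and ab: "0 \<le> a" "a \<le> b" "b \<le> 1"
  shows "measure lebesgue (F \<inter> {a..b}) \<le> \<kappa> * (b - a)"
proof (rule field_le_epsilon)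
  fix e :: real assume "e > 0"
  define M where "M = nat \<lceil>2 * (\<kappa> + 1) / e\<rceil> + 1"
  have M: "M \<ge> 1" by (simp add: M_def)
  have "2 * (\<kappa> + 1) / e \<le> M" unfolding M_def by linarith
  then have Me: "2 * \<kappa> / M \<le> e" using \<open>e > 0\<close> M by (simp add: field_simps)
  define T where "T = {v. v < M \<and> real v \<le> M * b \<and> M * a \<le> real v + 1}"
  have FT: "F \<inter> {x..y} \<in> lmeasurable" for x y
    using fmeasurable_Int_fmeasurable[OF fmeasurableI2[OF _ F(2,1)], of "{x..y}"] by simp
  have T: "finite T" "real (card T) \<le> (M * b - M * a + 1) + 1"
  proof -
    show "finite T" by (rule finite_subset[of _ "{..<M}"]) (auto simp: T_def)
    have sub: "T \<subseteq> {nat \<lceil>M * a - 1\<rceil>..nat \<lfloor>M * b\<rfloor>}"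
      by (auto simp: T_def) linarith+
    have "card T \<le> card {nat \<lceil>M * a - 1\<rceil>..nat \<lfloor>M * b\<rfloor>}" by (rule card_mono[OF _ sub]) simp
    also have "\<dots> = Suc (nat \<lfloor>M * b\<rfloor>) - nat \<lceil>M * a - 1\<rceil>" by simp
    finally have c: "card T \<le> Suc (nat \<lfloor>M * b\<rfloor>) - nat \<lceil>M * a - 1\<rceil>" .
    have "0 \<le> M * a" "M * a \<le> M * b" using ab M by (auto intro: mult_left_mono)
    then show "real (card T) \<le> (M * b - M * a + 1) + 1" using c by linarith
  qed
  have cover: "F \<inter> {a..b} \<subseteq> (\<Union>v\<in>T. F \<inter> {real v / real M..(real v + 1) / real M})"
  proof
    fix x assume x: "x \<in> F \<inter> {a..b}"
    then have x01: "0 \<le> x" "x \<le> 1" using F by auto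
    \<comment> \<open>The minimum with M - 1 puts the endpoint x = 1 into the last cell.\<close>
    define v where "v = min (M - 1) (nat \<lfloor>M * x\<rfloor>)"
    have Mx: "0 \<le> M * x" "M * x \<le> M" "M * a \<le> M * x" "M * x \<le> M * b"
      using x x01 by (auto intro: mult_left_mono mult_left_le)
    have v: "v < M" using M by (simp add: v_def)
    have v1: "real v \<le> M * x" using Mx(1) unfolding v_def by linarith
    have v2: "M * x \<le> real v + 1" using Mx(1,2) M unfolding v_def by (auto simp: min_def)
    have "v \<in> T" unfolding T_def using v order_trans[OF v1 Mx(4)] order_trans[OF Mx(3) v2] by blast
    moreover have "x \<in> {real v / real M..(real v + 1) / real M}" using v1 v2 M by (auto simp: field_simps)
    ultimately show "x \<in> (\<Union>v\<in>T. F \<inter> {real v / real M..(real v + 1) / real M})" using x by blast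
  qed
  have "measure lebesgue (F \<inter> {a..b}) \<le> measure lebesgue (\<Union>v\<in>T. F \<inter> {real v / real M..(real v + 1) / real M})"
    using FT T(1) by (intro measure_mono_fmeasurable cover fmeasurable.finite_UN) (auto intro: fmeasurableD)
  also have "\<dots> \<le> (\<Sum>v\<in>T. measure lebesgue (F \<inter> {real v / real M..(real v + 1) / real M}))"
    using FT T(1) by (intro measure_UNION_le) (auto intro: fmeasurableD)
  also have "\<dots> \<le> (\<Sum>v\<in>T. \<kappa> / M)" by (rule sum_mono, rule loc[OF M]) (simp add: T_def)
  also have "\<dots> = real (card T) * (\<kappa> / M)" by simp
  also have "\<dots> \<le> (M * b - M * a + 2) * (\<kappa> / M)" using T(2) \<open>\<kappa> \<ge> 0\<close> by (intro mult_right_mono) auto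
  also have "\<dots> = \<kappa> * (b - a) + 2 * \<kappa> / M" using M by (simp add: field_simps)
  also have "\<dots> \<le> \<kappa> * (b - a) + e" using Me by simp
  finally show "measure lebesgue (F \<inter> {a..b}) \<le> \<kappa> * (b - a) + e" .
qed

text \<open>Takes the place of the Lebesgue density theorem: F is covered by intervals with disjoint
  interiors and total length at most |F| + e, and it fills at most the proportion \<kappa> of each,
  so |F| <= \<kappa> (|F| + e). Letting e tend to 0 forces |F| = 0 because \<kappa> < 1.\<close>

lemma measure_zero_if_uniformly_sparse:
  fixes F :: "real set" and \<kappa> :: real
  assumes F: "F \<in> sets lebesgue" "F \<subseteq> {0..1}" and \<kappa>: "0 \<le> \<kappa>" "\<kappa> < 1"
    and loc: "\<And>M v. M \<ge> (1::nat) \<Longrightarrow> v < M \<Longrightarrow> measure lebesgue (F \<inter> {real v / real M..(real v + 1) / real M}) \<le> \<kappa> / M"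
  shows "measure lebesgue F = 0"
proof -
  have Fl: "F \<in> lmeasurable" by (rule fmeasurableI2[OF _ F(2,1)]) simp
  have Fi: "measure lebesgue (F \<inter> cbox a b) \<le> \<kappa> * measure lebesgue (cbox a b)" if "cbox a b \<subseteq> {0..1}" for a b
  proof (cases "a \<le> b")
    case True
    then show ?thesis using that measure_Int_interval_le[OF F \<kappa>(1) loc, of a b] by auto
  qed auto
  have sub: "F \<subseteq> cbox 0 1" using F(2) by simp
  have le: "measure lebesgue F \<le> \<kappa> * (measure lebesgue F + e)" if e: "e > 0" for e
  proof -
    obtain \<D> where D: "countable \<D>"
        "\<And>K. K \<in> \<D> \<Longrightarrow> K \<subseteq> cbox 0 1 \<and> K \<noteq> {} \<and> (\<exists>c d. K = cbox c d)"
        "pairwise (\<lambda>A B. interior A \<inter> interior B = {}) \<D>"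
        "F \<subseteq> \<Union>\<D>" "\<Union>\<D> \<in> lmeasurable" "measure lebesgue (\<Union>\<D>) \<le> measure lebesgue F + e"
      by (rule measurable_outer_intervals_bounded[OF Fl sub e]) blast
    have lm: "K \<in> lmeasurable" "F \<inter> K \<in> lmeasurable" "measure lebesgue (F \<inter> K) \<le> \<kappa> * measure lebesgue K" if K': "K \<in> \<D>" for K
    proof -
      obtain c d where K: "K = cbox c d" using D(2)[OF K'] by blast
      show "K \<in> lmeasurable" "F \<inter> K \<in> lmeasurable" using Fl K by auto
      show "measure lebesgue (F \<inter> K) \<le> \<kappa> * measure lebesgue K" using Fi[of c d] D(2)[OF K'] K by simp
    qed
    have fin: "(\<Sum>K\<in>\<C>. measure lebesgue K) \<le> measure lebesgue F + e" if C: "finite \<C>" "\<C> \<subseteq> \<D>" for \<C>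
    proof -
      have "(\<Sum>K\<in>\<C>. measure lebesgue K) = measure lebesgue (\<Union>\<C>)"
      proof (rule measure_negligible_finite_Union[symmetric])
        show "pairwise (\<lambda>S T. negligible (S \<inter> T)) \<C>"
        proof (rule pairwiseI)
          fix A B assume AB: "A \<in> \<C>" "B \<in> \<C>" "A \<noteq> B"
          obtain a b c d where e: "A = cbox a b" "B = cbox c d" using AB C D(2) by (meson subsetD)
          have "interior (A \<inter> B) = {}" using D(3) AB C by (auto simp: pairwise_def)
          then have "negligible (interior (A \<inter> B))" by simp
          moreover have "convex (A \<inter> B)" unfolding e by (intro convex_Int convex_box)
          ultimately show "negligible (A \<inter> B)"
            using \<open>interior (A \<inter> B) = {}\<close> negligible_convex_interior by blast
        qed
      qed (use C lm in auto)
      also have "\<dots> \<le> measure lebesgue (\<Union>\<D>)"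
        using C lm D(5) by (intro measure_mono_fmeasurable Union_mono) (auto intro!: fmeasurableD sets.finite_Union)
      finally show ?thesis using D(6) by simp
    qed
    have "F = (\<Union>K\<in>\<D>. F \<inter> K)" using D(4) by blast
    also have "measure lebesgue \<dots> \<le> \<kappa> * (measure lebesgue F + e)"
    proof (rule measure_UN_bound)
      fix \<C> assume C: "\<C> \<subseteq> \<D>" "finite \<C>"
      have "measure lebesgue (\<Union>K\<in>\<C>. F \<inter> K) \<le> (\<Sum>K\<in>\<C>. measure lebesgue (F \<inter> K))"
        using C lm by (intro measure_UNION_le) (auto intro: fmeasurableD)
      also have "\<dots> \<le> (\<Sum>K\<in>\<C>. \<kappa> * measure lebesgue K)" using C lm by (intro sum_mono) auto
      also have "\<dots> \<le> \<kappa> * (measure lebesgue F + e)"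
        unfolding sum_distrib_left[symmetric] using fin[OF C(2,1)] \<kappa> by (intro mult_left_mono)
      finally show "measure lebesgue (\<Union>K\<in>\<C>. F \<inter> K) \<le> \<kappa> * (measure lebesgue F + e)" .
    qed (use D(1) lm in auto)
    finally show ?thesis .
  qed
  have "measure lebesgue F \<le> \<kappa> * measure lebesgue F"
  proof (rule field_le_epsilon)
    fix e :: real assume "e > 0"
    have "\<kappa> * (measure lebesgue F + e) \<le> \<kappa> * measure lebesgue F + e"
      using \<kappa> \<open>e > 0\<close> by (simp add: algebra_simps mult_left_le_one_le)
    then show "measure lebesgue F \<le> \<kappa> * measure lebesgue F + e" using le[OF \<open>e > 0\<close>] by simp
  qed
  then have "(1 - \<kappa>) * measure lebesgue F \<le> 0" by (simp add: algebra_simps)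
  then show ?thesis using \<kappa> measure_nonneg[of lebesgue F] by (simp add: mult_le_0_iff)
qed

section \<open>Counting in dyadic blocks\<close>


lemma int_window:
  fixes g :: nat and b L :: real
  assumes "g \<ge> 1" "L \<ge> 0"
  obtains s where "\<And>k::int. b \<le> of_int k * real g \<Longrightarrow> of_int k * real g < b + L \<Longrightarrow> k \<in> {s..<s + int (nat \<lceil>L / g\<rceil>)}"
proof
  fix k :: int assume k: "b \<le> of_int k * real g" "of_int k * real g < b + L"
  have "b / g \<le> of_int k" using k(1) assms by (simp add: field_simps)
  moreover have "of_int k < b / g + L / g" using k(2) assms by (simp add: field_simps)
  moreover have "0 \<le> L / g" using assms by simp
  ultimately show "k \<in> {\<lceil>b / g\<rceil>..<\<lceil>b / g\<rceil> + int (nat \<lceil>L / g\<rceil>)}" by simp linarith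
qed

lemma real_nat_ceiling_le: "0 \<le> x \<Longrightarrow> real (nat \<lceil>x\<rceil>) \<le> x + 1"
  by linarith

text \<open>\<open>a n\<close> stands for \<open>2\<^sup>n \<psi>(2\<^sup>n\<^sup>+\<^sup>1)\<close> truncated at 1, so that \<open>rad n j\<close> below divided by \<open>2\<^sup>j\<close> is at most
  \<open>\<psi> q\<close> throughout the block.\<close>

locale bohr_blocks =
  fixes \<beta> \<gamma> \<gamma>' :: real and J :: "nat \<Rightarrow> nat" and a :: "nat \<Rightarrow> real" and n0 :: nat
  assumes J_mono: "mono J" and J_le: "1000 * J n \<le> n"
    and a_pos: "0 < a n" and a_le: "a n \<le> 1"
    and n0: "n0 \<ge> 2" and J_ge: "n \<ge> n0 \<Longrightarrow> n ^ 7 \<le> 2 ^ J n"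
    and indep: "n \<ge> n0 \<Longrightarrow> (k1, k2) \<noteq> (0, 0) \<Longrightarrow> \<bar>k1\<bar> \<le> 2 ^ (20 * J n) \<Longrightarrow> \<bar>k2\<bar> \<le> 2 ^ (20 * J n) \<Longrightarrow>
      1 / 2 ^ (n div 10) \<le> nd (of_int k1 * \<gamma> + of_int k2 * \<beta>)"
begin

definition Q :: "nat \<Rightarrow> nat \<Rightarrow> nat set" where
  "Q n j = {q. 2 ^ n \<le> q \<and> q < 2 ^ (n + 1) \<and> 1 / 2 ^ (j + 1) < nd (real q * \<beta> - \<gamma>') \<and> nd (real q * \<beta> - \<gamma>') \<le> 1 / 2 ^ j}"

definition rad :: "nat \<Rightarrow> nat \<Rightarrow> real" where
  "rad n j = a n * 2 ^ j / 2 ^ n"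

lemma J_ge_6: "n \<ge> n0 \<Longrightarrow> 6 \<le> J n"
proof -
  assume "n \<ge> n0"
  then have "2 ^ 7 \<le> n ^ 7" using n0 by (intro power_mono) auto
  also have "\<dots> \<le> 2 ^ J n" using J_ge \<open>n \<ge> n0\<close> .
  finally have "7 \<le> J n" by (simp only: power_increasing_iff one_less_numeral_iff semiring_norm)
  then show ?thesis by simp
qed

lemma finite_Q [simp, intro]: "finite (Q n j)"
  by (rule finite_subset[of _ "{..<2^(n+1)}"]) (auto simp: Q_def)

text \<open>\<open>card_bohr_le\<close> for the pair \<gamma>, g\<beta>. A second frequency up to
  2^(12 J m) times g up to 2^(8 J m) exhausts the range 2^(20 J m) of \<open>indep\<close>, and 8 *
  2^(m div 10) is the term 8 / \<eta>.\<close>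

lemma card_bohr_scale_le:
  fixes \<alpha>1 \<alpha>2 x1 x2 :: real and H1 H2 K :: nat
  assumes "m \<ge> n0" and g: "1 \<le> g" "g \<le> 2 ^ (8 * J m)"
    and H: "1 \<le> H1" "H1 \<le> 2 ^ (20 * J m)" "1 \<le> H2" "H2 \<le> 2 ^ (12 * J m)"
    and x: "(real H1 - 1) * x1 \<le> 1/12" "(real H2 - 1) * x2 \<le> 1/12"
    and S: "S \<subseteq> {s..<s + int K}"
      "\<And>k. k \<in> S \<Longrightarrow> nd (of_int k * \<gamma> - \<alpha>1) \<le> x1"
      "\<And>k. k \<in> S \<Longrightarrow> nd (of_int k * (real g * \<beta>) - \<alpha>2) \<le> x2"
  shows "real (card S) \<le> 4 * real K / (real H1 * real H2) + 8 * 2 ^ (m div 10)"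
proof -
  have "real (card S) \<le> 4 * real K / (real H1 * real H2) + 8 / (1 / 2 ^ (m div 10))"
  proof (rule card_bohr_le[OF H(1,3) _ x _ S])
    fix h1 h2 :: int
    assume h: "(h1, h2) \<noteq> (0, 0)" "\<bar>h1\<bar> < int H1" "\<bar>h2\<bar> < int H2"
    have "\<bar>h2 * int g\<bar> \<le> int H2 * int g" using h by (simp add: abs_mult mult_right_mono)
    also have "\<dots> = int (H2 * g)" by simp
    also have "\<dots> \<le> int (2 ^ (12 * J m) * 2 ^ (8 * J m))"
      using H(4) g(2) by (intro of_nat_mono mult_le_mono)
    also have "\<dots> = 2 ^ (20 * J m)" by (simp flip: power_add)
    finally have b2: "\<bar>h2 * int g\<bar> \<le> 2 ^ (20 * J m)" .
    have "\<bar>h1\<bar> \<le> int H1" using h by simp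
    also have "\<dots> \<le> int (2 ^ (20 * J m))" using H(2) by (intro of_nat_mono)
    finally have b1: "\<bar>h1\<bar> \<le> 2 ^ (20 * J m)" by simp
    have "(h1, h2 * int g) \<noteq> (0, 0)" using h(1) g(1) by auto
    from indep[OF \<open>m \<ge> n0\<close> this b1 b2]
    show "1 / 2 ^ (m div 10) \<le> nd (of_int h1 * \<gamma> + of_int h2 * (real g * \<beta>))"
      by (simp add: mult.assoc)
  qed auto
  then show ?thesis by simp
qed

text \<open>H - 1 is the integer part of the ideal frequency y, so (H - 1) x still respects the 1/12
  of \<open>card_bohr_le\<close>, while H >= y lets 1/H be estimated by 1/y.\<close>

lemma nat_floor_frequency:
  fixes y x :: real
  assumes "0 < y" "y * x \<le> 1/12" "0 \<le> x"
  defines "H \<equiv> nat \<lfloor>y\<rfloor> + 1"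
  shows "1 \<le> H" "(real H - 1) * x \<le> 1/12" "y \<le> real H" "y + 1 \<le> 2 ^ N \<Longrightarrow> H \<le> 2 ^ N"
proof -
  show "1 \<le> H" by (simp add: H_def)
  have "real H - 1 \<le> y" using assms unfolding H_def by simp
  then have "(real H - 1) * x \<le> y * x" using assms by (intro mult_right_mono) auto
  then show "(real H - 1) * x \<le> 1/12" using assms by simp
  show "y \<le> real H" using assms unfolding H_def by linarith
  assume "y + 1 \<le> 2 ^ N"
  then have "real H \<le> real (2 ^ N)"
    using \<open>real H - 1 \<le> y\<close> unfolding of_nat_power of_nat_numeral by linarith
  then show "H \<le> 2 ^ N" by (simp only: of_nat_le_iff)
qed

text \<open>Absorbs errors of exponential sums: an error 2^N is below a main term 2^n / (g 2^c) as
  soon as the exponents add up to at most n.\<close>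

lemma two_power_bound:
  fixes N c :: nat
  assumes "real g \<le> 2 ^ b" "b + c + N \<le> n" "g \<ge> 1"
  shows "2 ^ N \<le> 2 ^ n / (real g * 2 ^ c)"
proof -
  have "2 ^ N * (real g * 2 ^ c) \<le> 2 ^ N * (2 ^ b * 2 ^ c)" using assms by (intro mult_left_mono mult_right_mono) auto
  also have "\<dots> = 2 ^ (b + c + N)" by (simp add: power_add)
  also have "\<dots> \<le> 2 ^ n" using assms by (intro power_increasing) auto
  finally show ?thesis using assms by (simp add: le_divide_eq)
qed

lemma class_frequency:
  assumes "m \<ge> n0" "j \<le> J m"
  defines "H \<equiv> nat \<lfloor>2 ^ j / 12 :: real\<rfloor> + 1"
  shows "1 \<le> H" "(real H - 1) * (1 / 2 ^ j) \<le> 1/12" "2 ^ j / 12 \<le> real H" "H \<le> 2 ^ (12 * J m)"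
proof -
  note H = nat_floor_frequency[of "2 ^ j / 12" "1 / 2 ^ j", folded H_def]
  have "(2::real) ^ j \<le> 2 ^ (J m)" using assms by (intro power_increasing) auto
  also have "\<dots> \<le> 2 ^ (12 * J m)" by (intro power_increasing) auto
  finally have 1: "(2::real) ^ j \<le> 2 ^ (12 * J m)" .
  have "(2::real) ^ 1 \<le> 2 ^ (12 * J m)" using J_ge_6[OF assms(1)] by (intro power_increasing) auto
  then have "2 ^ j / 12 + 1 \<le> (2::real) ^ (12 * J m)" using 1 unfolding power_one_right by linarith
  then show "1 \<le> H" "(real H - 1) * (1 / 2 ^ j) \<le> 1/12" "2 ^ j / 12 \<le> real H" "H \<le> 2 ^ (12 * J m)"
    using H by auto
qed

text \<open>Write q = k g: then k runs through a window of length 2^n / g, and the condition on k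
  g\<beta> has density of order 2^(-j). Taking H1 = 1 reduces the condition on k\<gamma> to the
  trivial nd <= 1/2. The scale m may exceed n by 2 J m because g will be shared with a later block
  m. The constant is 96 from the main term plus 8 from the absorbed error.\<close>

lemma card_Q_multiples_le:
  assumes m: "m \<ge> n0" "m \<le> n + 2 * J m" and g: "1 \<le> g" "g \<le> 2 ^ (8 * J m)" and j: "j \<le> J m"
  shows "real (card {q \<in> Q n j. g dvd q}) \<le> 104 * (2 ^ n / (real g * 2 ^ j))"
proof -
  obtain s where s: "\<And>k::int. 2 ^ n \<le> of_int k * real g \<Longrightarrow> of_int k * real g < 2 ^ n + 2 ^ n \<Longrightarrow>
      k \<in> {s..<s + int (nat \<lceil>2 ^ n / real g\<rceil>)}"
    by (rule int_window[of g "2 ^ n" "2 ^ n"]) (use g in auto)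
  define S where "S = (\<lambda>q. int (q div g)) ` {q \<in> Q n j. g dvd q}"
  have S: "of_int k * real g = real q" if "k = int (q div g)" "g dvd q" for k q
    using that by (simp flip: of_nat_mult)
  have "inj_on (\<lambda>q. int (q div g)) {q \<in> Q n j. g dvd q}"
    by (rule inj_onI) (metis (no_types, lifting) S mem_Collect_eq of_nat_eq_iff)
  then have card: "card {q \<in> Q n j. g dvd q} = card S" unfolding S_def by (simp add: card_image)
  define H where "H = nat \<lfloor>2 ^ j / 12 :: real\<rfloor> + 1"
  note H = class_frequency[OF m(1) j, folded H_def]
  have g': "real g \<le> 2 ^ (8 * J m)" using g(2) by (metis of_nat_le_iff of_nat_numeral of_nat_power)
  have "real (card S) \<le> 4 * real (nat \<lceil>2 ^ n / real g\<rceil>) / (real 1 * real H) + 8 * 2 ^ (m div 10)"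
  proof (rule card_bohr_scale_le[OF m(1) g])
    show "S \<subseteq> {s..<s + int (nat \<lceil>2 ^ n / real g\<rceil>)}"
    proof
      fix k assume "k \<in> S"
      then obtain q where q: "k = int (q div g)" "q \<in> Q n j" "g dvd q" by (auto simp: S_def)
      have "real q \<ge> real (2 ^ n)" "real q < real (2 ^ (n + 1))"
        using q(2) unfolding Q_def by (auto simp only: mem_Collect_eq of_nat_le_iff of_nat_less_iff)
      then show "k \<in> {s..<s + int (nat \<lceil>2 ^ n / real g\<rceil>)}" using S[OF q(1,3)] by (intro s) auto
    qed
    fix k assume "k \<in> S"
    then obtain q where q: "k = int (q div g)" "q \<in> Q n j" "g dvd q" by (auto simp: S_def)
    show "nd (of_int k * \<gamma> - 0) \<le> 1/2" by (rule nd_le_half)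
    have "of_int k * (real g * \<beta>) = real q * \<beta>" using S[OF q(1,3)] by (simp only: mult.assoc[symmetric])
    then show "nd (of_int k * (real g * \<beta>) - \<gamma>') \<le> 1 / 2 ^ j" using q(2) by (simp only:) (simp add: Q_def)
  qed (use H in auto)
  also have "\<dots> \<le> 4 * (2 * (2 ^ n / real g)) / (2 ^ j / 12) + 8 * (2 ^ n / (real g * 2 ^ j))"
  proof (intro add_mono frac_le mult_left_mono)
    have "2 ^ 0 \<le> 2 ^ n / (real g * 2 ^ 0)"
      using m J_le[of m] g' g by (intro two_power_bound[where b = "8 * J m"]) auto
    then have "1 \<le> 2 ^ n / real g" by simp
    then show "real (nat \<lceil>2 ^ n / real g\<rceil>) \<le> 2 * (2 ^ n / real g)"
      using real_nat_ceiling_le[of "2 ^ n / real g"] by linarith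
    show "2 ^ (m div 10) \<le> 2 ^ n / (real g * 2 ^ j)"
      using m J_le[of m] g' g j by (intro two_power_bound[where b = "8 * J m"]) auto
  qed (use H in auto)
  also have "\<dots> = 104 * (2 ^ n / (real g * 2 ^ j))" by simp
  finally show ?thesis using card by simp
qed

lemma card_Q_le:
  assumes "n \<ge> n0" "j \<le> J n"
  shows "real (card (Q n j)) \<le> 104 * (2 ^ n / 2 ^ j)"
  using card_Q_multiples_le[of n n 1 j] assms by simp

text \<open>The quotients k = (q' - q)/g for which the extra term of
  \<open>measure_hit_Int_le\<close> can be nonzero; k = 0 would be the diagonal. That g is the gcd
  is forgotten: this only enlarges the set, and it leaves a Bohr set in a window.\<close>

definition shifts :: "nat \<Rightarrow> nat \<Rightarrow> nat \<Rightarrow> nat \<Rightarrow> real \<Rightarrow> int set" where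
  "shifts q g m l \<delta> = {k. k \<noteq> 0 \<and> nd (of_int k * \<gamma>) \<le> \<delta> \<and> (\<exists>q'\<in>Q m l. int q' = int q + k * int g)}"

lemma shifts_window:
  assumes "g \<ge> 1"
  obtains s where "shifts q g m l \<delta> \<subseteq> {s..<s + int (nat \<lceil>2 ^ m / real g\<rceil>)}"
proof -
  obtain s where s: "\<And>k::int. 2 ^ m - real q \<le> of_int k * real g \<Longrightarrow> of_int k * real g < 2 ^ m - real q + 2 ^ m \<Longrightarrow>
      k \<in> {s..<s + int (nat \<lceil>2 ^ m / real g\<rceil>)}"
    by (rule int_window[of g "2 ^ m" "2 ^ m - real q"]) (use assms in auto)
  have "shifts q g m l \<delta> \<subseteq> {s..<s + int (nat \<lceil>2 ^ m / real g\<rceil>)}"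
  proof
    fix k assume "k \<in> shifts q g m l \<delta>"
    then obtain q' where q': "q' \<in> Q m l" "int q' = int q + k * int g" by (auto simp: shifts_def)
    have e: "real q' = real q + of_int k * real g" using arg_cong[OF q'(2), of real_of_int] by simp
    have "real q' \<ge> real (2 ^ m)" "real q' < real (2 ^ (m + 1))"
      using q'(1) unfolding Q_def by (auto simp only: mem_Collect_eq of_nat_le_iff of_nat_less_iff)
    then show "k \<in> {s..<s + int (nat \<lceil>2 ^ m / real g\<rceil>)}" using e by (intro s) auto
  qed
  then show thesis by (rule that)
qed

lemma finite_shifts: "g \<ge> 1 \<Longrightarrow> finite (shifts q g m l \<delta>)"
  by (meson finite_atLeastLessThan_int finite_subset shifts_window)

lemma card_shifts_trivial:
  assumes g: "1 \<le> g" "g \<le> 2 ^ (m + 1)"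
  shows "real (card (shifts q g m l \<delta>)) \<le> 3 * (2 ^ m / real g)"
proof -
  obtain s where s: "shifts q g m l \<delta> \<subseteq> {s..<s + int (nat \<lceil>2 ^ m / real g\<rceil>)}"
    by (rule shifts_window[OF g(1)])
  have "card (shifts q g m l \<delta>) \<le> card {s..<s + int (nat \<lceil>2 ^ m / real g\<rceil>)}" using s by (intro card_mono) auto
  also have "\<dots> = nat \<lceil>2 ^ m / real g\<rceil>" by (simp only: card_atLeastLessThan_int add_diff_cancel_left' nat_int)
  finally have "real (card (shifts q g m l \<delta>)) \<le> real (nat \<lceil>2 ^ m / real g\<rceil>)" by (simp only: of_nat_le_iff)
  also have "\<dots> \<le> 2 ^ m / real g + 1" by (rule real_nat_ceiling_le) simp
  finally have "real (card (shifts q g m l \<delta>)) \<le> 2 ^ m / real g + 1" .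
  moreover have "real g \<le> 2 ^ (m + 1)" using g(2) by (metis of_nat_le_iff of_nat_numeral of_nat_power)
  then have "1 \<le> 2 * (2 ^ m / real g)" using g(1) by (simp add: le_divide_eq)
  ultimately show ?thesis by simp
qed

text \<open>The ideal frequency for \<gamma> is g / (12 D), capped by 2^(12 J m) to stay within
  \<open>indep\<close>. The cap costs one term 1 / 2^(12 J m), and the error of the exponential sum
  is absorbed in a second one.\<close>

lemma card_shifts_small:
  assumes m: "m \<ge> n0" and g: "1 \<le> g" "g \<le> 2 ^ (8 * J m)" and l: "l \<le> J m" and D: "D > 0"
  shows "real (card (shifts q g m l (D / g))) \<le> 96 * (2 ^ m / (real g * 2 ^ l)) * (12 * D / g + 2 / 2 ^ (12 * J m))"
proof -
  obtain s where s: "shifts q g m l (D / g) \<subseteq> {s..<s + int (nat \<lceil>2 ^ m / real g\<rceil>)}"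
    by (rule shifts_window[OF g(1)])
  define y where "y = min (real g / (12 * D)) (2 ^ (12 * J m))"
  define H1 where "H1 = nat \<lfloor>y\<rfloor> + 1"
  have y: "y > 0" using g D by (simp add: y_def)
  have "y * (D / g) \<le> real g / (12 * D) * (D / g)" using D by (intro mult_right_mono) (auto simp: y_def)
  also have "\<dots> = 1/12" using D g by simp
  finally have yx: "y * (D / g) \<le> 1/12" .
  note H1 = nat_floor_frequency[OF y yx, folded H1_def]
  have "y + 1 \<le> 2 ^ (12 * J m) + 2 ^ (12 * J m)" by (intro add_mono) (auto simp: y_def)
  also have "\<dots> = 2 ^ (12 * J m + 1)" by simp
  also have "\<dots> \<le> 2 ^ (20 * J m)" using J_ge_6[OF m] by (intro power_increasing) auto
  finally have H1': "H1 \<le> 2 ^ (20 * J m)" using H1(4)[of "20 * J m"] D by auto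
  define H2 where "H2 = nat \<lfloor>2 ^ l / 12 :: real\<rfloor> + 1"
  note H2 = class_frequency[OF m l, folded H2_def]
  have g': "real g \<le> 2 ^ (8 * J m)" using g(2) by (metis of_nat_le_iff of_nat_numeral of_nat_power)
  let ?G = "2 ^ m / (real g * 2 ^ l)"
  have inv: "1 / real H1 \<le> 12 * D / g + 1 / 2 ^ (12 * J m)"
  proof -
    have "1 / real H1 \<le> 1 / y" using H1(3) y D by (intro frac_le) auto
    also have "\<dots> \<le> 12 * D / g + 1 / 2 ^ (12 * J m)" using D g by (auto simp: y_def min_def)
    finally show ?thesis .
  qed
  have "real (card (shifts q g m l (D / g))) \<le> 4 * real (nat \<lceil>2 ^ m / real g\<rceil>) / (real H1 * real H2) + 8 * 2 ^ (m div 10)"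
  proof (rule card_bohr_scale_le[OF m g _ H1' H2(1,4) _ H2(2) s])
    fix k assume k: "k \<in> shifts q g m l (D / g)"
    then show "nd (of_int k * \<gamma> - 0) \<le> D / g" by (simp add: shifts_def)
    obtain q' where q': "q' \<in> Q m l" "int q' = int q + k * int g" using k by (auto simp: shifts_def)
    have e: "real q' = real q + of_int k * real g" using arg_cong[OF q'(2), of real_of_int] by simp
    have "of_int k * (real g * \<beta>) - (\<gamma>' - real q * \<beta>) = real q' * \<beta> - \<gamma>'" by (simp add: e algebra_simps)
    then show "nd (of_int k * (real g * \<beta>) - (\<gamma>' - real q * \<beta>)) \<le> 1 / 2 ^ l" using q'(1) by (simp only:) (simp add: Q_def)
  qed (use H1 D in auto)
  also have "4 * real (nat \<lceil>2 ^ m / real g\<rceil>) / (real H1 * real H2)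
      = 4 * real (nat \<lceil>2 ^ m / real g\<rceil>) * (1 / real H1) * (1 / real H2)" by simp
  also have "\<dots> \<le> 4 * (2 * (2 ^ m / real g)) * (12 * D / g + 1 / 2 ^ (12 * J m)) * (12 / 2 ^ l)"
  proof (intro mult_mono inv)
    have "2 ^ 0 \<le> 2 ^ m / (real g * 2 ^ 0)"
      using m J_le[of m] g' g by (intro two_power_bound[where b = "8 * J m"]) auto
    then have "1 \<le> 2 ^ m / real g" by simp
    then show "real (nat \<lceil>2 ^ m / real g\<rceil>) \<le> 2 * (2 ^ m / real g)"
      using real_nat_ceiling_le[of "2 ^ m / real g"] by linarith
    have "1 / real H2 \<le> 1 / (2 ^ l / 12)" using H2 by (intro frac_le) auto
    then show "1 / real H2 \<le> 12 / 2 ^ l" by simp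
    show "0 \<le> real (nat \<lceil>2 ^ m / real g\<rceil>)" by (rule of_nat_0_le_iff)
  qed (use D in auto)
  also have "\<dots> = 96 * ?G * (12 * D / g + 1 / 2 ^ (12 * J m))" by (simp add: field_simps)
  also have "8 * 2 ^ (m div 10) \<le> 96 * ?G * (1 / 2 ^ (12 * J m))"
  proof -
    have "2 ^ (m div 10) \<le> 2 ^ m / (real g * 2 ^ (l + 12 * J m))"
      using m J_le[of m] g' g l by (intro two_power_bound[where b = "8 * J m"]) auto
    also have "\<dots> = ?G * (1 / 2 ^ (12 * J m))" by (simp add: power_add)
    finally have "8 * 2 ^ (m div 10) \<le> 8 * (?G * (1 / 2 ^ (12 * J m)))" by simp
    also have "\<dots> \<le> 96 * (?G * (1 / 2 ^ (12 * J m)))" by (intro mult_right_mono) auto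
    finally show ?thesis by simp
  qed
  finally show ?thesis by (simp add: algebra_simps)
qed

text \<open>The exponential sum estimate needs windows of length at least \<open>2 ^ (m div 10)\<close>. When \<open>g\<close> is too large for
  that, the admissible \<open>k\<close> are separated instead: \<open>D / g\<close> is then smaller than the bound in \<open>indep\<close>.\<close>

lemma card_shifts_large:
  assumes m: "m \<ge> n0" and g: "2 ^ (8 * J m) < g" "g \<le> 2 ^ (m + 1)" and q: "q < 2 ^ (m + 1)"
    and D: "D > 0" "D \<le> 4 * 2 ^ (3 * J m)"
  shows "real (card (shifts q g m l (D / g))) \<le> 400 * (2 ^ m / (real g * 2 ^ (4 * J m)))"
proof (cases "g \<ge> 2 ^ (m div 5)")
  case True
  let ?S = "shifts q g m l (D / g)"
  let ?L = "2 ^ (20 * J m) :: real"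
  have g1: "1 \<le> g" using g(1) by (rule order_trans[OF _ less_imp_le, rotated]) simp
  have J6: "6 \<le> J m" by (rule J_ge_6[OF m])
  have small: "2 * (D / g) < 1 / 2 ^ (m div 10)"
  proof -
    have "2 ^ (m div 5) \<le> real g" using True by (metis of_nat_le_iff of_nat_numeral of_nat_power)
    have "2 * D * 2 ^ (m div 10) \<le> 2 * (4 * 2 ^ (3 * J m)) * 2 ^ (m div 10)"
      using D by (intro mult_right_mono) auto
    also have "\<dots> = 2 ^ (3 + 3 * J m + m div 10)" by (simp add: power_add)
    also have "\<dots> < 2 ^ (m div 5)" using J6 J_le[of m] by (intro power_strict_increasing) auto
    also have "\<dots> \<le> real g" by fact
    finally show ?thesis using g1 by (simp add: field_simps)
  qed
  \<comment> \<open>Twice the radius D / g is below 2^(- (m div 10)), so a difference of two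
    elements shorter than ?L would contradict \<open>indep\<close> with second coefficient
    0.\<close>
  have gap: "?L \<le> \<bar>of_int d\<bar>" if "d \<noteq> 0" "nd (of_int d * \<gamma>) \<le> 2 * (D / g)" for d :: int
  proof (rule ccontr)
    assume "\<not> ?L \<le> \<bar>of_int d\<bar>"
    then have "real_of_int \<bar>d\<bar> \<le> real_of_int (2 ^ (20 * J m))" by simp
    then have "\<bar>d\<bar> \<le> 2 ^ (20 * J m)" by (simp only: of_int_le_iff)
    then have "1 / 2 ^ (m div 10) \<le> nd (of_int d * \<gamma> + of_int 0 * \<beta>)" using that by (intro indep[OF m]) auto
    then show False using that small by simp
  qed
  have k: "nd (of_int k * \<gamma>) \<le> D / g \<and> \<bar>of_int k\<bar> \<le> 2 ^ (m + 1) / real g" if "k \<in> insert 0 ?S" for k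
  proof (cases "k \<in> ?S")
    case True
    then obtain q' where q': "q' \<in> Q m l" "int q' = int q + k * int g" by (auto simp: shifts_def)
    have e: "of_int k * real g = real q' - real q" using arg_cong[OF q'(2), of real_of_int] by simp
    have "real q' < real (2 ^ (m + 1))" "real q < real (2 ^ (m + 1))"
      using q'(1) q unfolding Q_def by (auto simp only: mem_Collect_eq of_nat_le_iff of_nat_less_iff)
    then have "\<bar>real q' - real q\<bar> \<le> 2 ^ (m + 1)" by simp
    then have "\<bar>of_int k\<bar> * real g \<le> 2 ^ (m + 1)" unfolding e[symmetric] by (simp add: abs_mult)
    then show ?thesis using True g1 by (simp add: shifts_def le_divide_eq)
  next
    case False
    then have "k = 0" using that by auto
    moreover have "nd 0 \<le> D / g" using D by (simp add: dist_nearest_int_def)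
    ultimately show ?thesis by simp
  qed
  let ?R = "2 ^ (m + 1) / real g"
  have fin: "finite (insert 0 ?S)" using finite_shifts[OF g1] by simp
  \<comment> \<open>Inserting 0 raises the cardinality by one and so cancels the + 1 of
    \<open>card_separated_le\<close>. The bound aimed at can be below 1, hence the + 1 could not be
    hidden in the constant.\<close>
  have "card (insert 0 ?S) \<le> (?R - - ?R) / ?L + 1"
  proof (rule card_separated_le(2))
    fix x y assume xy: "x \<in> insert 0 ?S" "y \<in> insert 0 ?S" "x \<noteq> y"
    have "nd (of_int (x - y) * \<gamma>) \<le> nd (of_int x * \<gamma>) + nd (of_int y * \<gamma>)"
      using nd_diff_le[of "of_int x * \<gamma>" "of_int y * \<gamma>"] by (simp add: algebra_simps)
    also have "\<dots> \<le> 2 * (D / g)" using k[OF xy(1)] k[OF xy(2)] by simp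
    finally show "?L \<le> \<bar>of_int x - of_int y\<bar>" using gap[of "x - y"] xy(3) by simp
  next
    fix x assume "x \<in> insert 0 ?S"
    from k[OF this] show "- ?R \<le> of_int x \<and> of_int x \<le> ?R" by (auto simp: abs_le_iff)
  qed auto
  moreover have "card (insert 0 ?S) = card ?S + 1"
    using finite_shifts[OF g1] by (subst card_insert_disjoint) (auto simp: shifts_def)
  ultimately have "real (card ?S) \<le> 4 * (2 ^ m / real g) / ?L" by simp
  also have "\<dots> \<le> 400 * (2 ^ m / real g) / 2 ^ (4 * J m)"
    by (intro frac_le mult_right_mono power_increasing) auto
  finally show ?thesis by simp
next
  case False
  let ?S = "shifts q g m l (D / g)"
  have g1: "1 \<le> g" using g(1) by (rule order_trans[OF _ less_imp_le, rotated]) simp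
  have J6: "6 \<le> J m" by (rule J_ge_6[OF m])
  obtain s where s: "?S \<subseteq> {s..<s + int (nat \<lceil>2 ^ m / real g\<rceil>)}"
    by (rule shifts_window[OF g1])
  \<comment> \<open>The largest frequency that the worst case allows: for D = 4 * 2^(3 J m) and g =
    2^(8 J m) the product y D / g is exactly 1/12.\<close>
  define y where "y = 2 ^ (5 * J m) / (48::real)"
  define H where "H = nat \<lfloor>y\<rfloor> + 1"
  have g8: "2 ^ (8 * J m) \<le> real g"
  proof -
    have "real (2 ^ (8 * J m)) \<le> real g" using g(1) by (simp only: of_nat_le_iff)
    then show ?thesis by simp
  qed
  have yx: "y * (D / g) \<le> 1/12"
  proof -
    have "y * D \<le> y * (4 * 2 ^ (3 * J m))" using D by (intro mult_left_mono) (auto simp: y_def)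
    also have "\<dots> = 2 ^ (8 * J m) / 12" by (simp add: y_def flip: power_add)
    also have "\<dots> \<le> real g / 12" using g8 by simp
    finally show ?thesis using g1 by (simp add: field_simps)
  qed
  have y: "y > 0" by (simp add: y_def)
  note H = nat_floor_frequency[OF y yx, folded H_def]
  have "y + 1 \<le> 2 ^ (5 * J m) + 2 ^ (5 * J m)" by (intro add_mono) (auto simp: y_def)
  also have "\<dots> = 2 ^ (5 * J m + 1)" by simp
  also have "\<dots> \<le> 2 ^ (20 * J m)" using J6 by (intro power_increasing) auto
  finally have H': "H \<le> 2 ^ (20 * J m)" using H(4)[of "20 * J m"] D by auto
  have "real (card ?S) \<le> 4 * real (nat \<lceil>2 ^ m / real g\<rceil>) / (real H * real 1) + 8 * 2 ^ (m div 10)"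
  \<comment> \<open>The actual g lies beyond 2^(8 J m), so only k\<gamma> is tested: the lemma is
    applied with g = 1 and H2 = 1, whose second condition is the trivial nd <= 1/2.\<close>
  proof (rule card_bohr_scale_le[OF m, where g = 1])
    fix k assume k: "k \<in> ?S"
    then show "nd (of_int k * \<gamma> - 0) \<le> D / g" by (simp add: shifts_def)
    show "nd (of_int k * (real 1 * \<beta>) - 0) \<le> 1/2" by (rule nd_le_half)
  qed (use H H' D s in auto)
  also have "\<dots> \<le> 4 * (2 * (2 ^ m / real g)) / y + 8 * (2 ^ m / (real g * 2 ^ (4 * J m)))"
  proof (intro add_mono frac_le mult_left_mono)
    have g5: "real g \<le> 2 ^ (m div 5)" using False by (metis nat_le_linear of_nat_le_iff of_nat_numeral of_nat_power)
    have "2 ^ 0 \<le> 2 ^ m / (real g * 2 ^ 0)"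
      using g5 g1 by (intro two_power_bound[where b = "m div 5"]) auto
    then have "1 \<le> 2 ^ m / real g" by simp
    then show "real (nat \<lceil>2 ^ m / real g\<rceil>) \<le> 2 * (2 ^ m / real g)"
      using real_nat_ceiling_le[of "2 ^ m / real g"] by linarith
    show "2 ^ (m div 10) \<le> 2 ^ m / (real g * 2 ^ (4 * J m))"
      using g5 g1 J_le[of m] by (intro two_power_bound[where b = "m div 5"]) auto
  qed (use H y D in auto)
  also have "4 * (2 * (2 ^ m / real g)) / y = 384 * (2 ^ m / real g) / 2 ^ (5 * J m)" by (simp add: y_def)
  also have "\<dots> \<le> 384 * (2 ^ m / real g) / 2 ^ (4 * J m)"
    by (intro frac_le power_increasing) auto
  finally have "real (card ?S) \<le> 392 * (2 ^ m / (real g * 2 ^ (4 * J m)))" by simp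
  also have "\<dots> \<le> 400 * (2 ^ m / (real g * 2 ^ (4 * J m)))" by (intro mult_right_mono) auto
  finally show ?thesis .
qed

end


text \<open>For t consecutive q the points q\<beta> stay within 1/N of q0 \<beta> + i h/t, and i h
  runs through all residues modulo t. Counting the u for which u/t falls into the interval shrunk by
  1/N at both ends gives at least t (d - c) - 2t/N - 1, and t <= N. The length d - c < 1 keeps
  distinct u incongruent.\<close>

lemma card_rotation_window_ge:
  fixes \<beta> \<delta> c d :: real and q0 t N :: nat and h :: int
  assumes cop: "coprime h (int t)" and t: "t \<ge> 1" "t \<le> N" and app: "\<bar>real t * \<beta> - of_int h\<bar> < 1 / N"
    and cd: "d - c < 1"
  shows "real t * (d - c) - 3 \<le> card {q \<in> {q0..<q0 + t}. \<exists>z::int. c < q * \<beta> - \<delta> - of_int z \<and> q * \<beta> - \<delta> - of_int z < d}"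
    (is "_ \<le> real (card ?A)")
proof -
  obtain h' v where hv: "h' * h + v * int t = 1"
    using bezout_int[of h "int t"] cop by (auto simp: coprime_iff_gcd_eq_1)
  define y where "y = q0 * \<beta> - \<delta>"
  define U where "U = {\<lceil>t * (c + 1 / N - y)\<rceil>..\<lfloor>t * (d - 1 / N - y)\<rfloor>}"
  \<comment> \<open>h' inverts h modulo t, so i = u h' mod t is the index with i h congruent to
    u.\<close>
  define f where "f u = q0 + nat ((u * h') mod int t)" for u
  have U: "c + 1 / N \<le> y + u / t \<and> y + u / t \<le> d - 1 / N" if "u \<in> U" for u
  proof -
    have "t * (c + 1 / N - y) \<le> u" "u \<le> t * (d - 1 / N - y)" using that by (auto simp: U_def ceiling_le_iff le_floor_iff)
    then have "c + 1 / N - y \<le> u / t" "u / t \<le> d - 1 / N - y" using t by (simp_all add: field_simps)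
    then show ?thesis by simp
  qed
  have inj: "inj_on f U"
  proof (rule inj_onI)
    fix u w assume uw: "u \<in> U" "w \<in> U" "f u = f w"
    have "(u * h') mod int t = (w * h') mod int t" using uw(3) t unfolding f_def by (simp add: eq_nat_nat_iff)
    then have "int t dvd (u - w) * h'" by (simp add: mod_eq_dvd_iff algebra_simps)
    then have "int t dvd (u - w) * h' * h + (u - w) * v * int t" by simp
    also have "(u - w) * h' * h + (u - w) * v * int t = (u - w) * (h' * h + v * int t)" by (simp add: algebra_simps)
    finally have dvd: "int t dvd u - w" by (simp add: hv)
    have "\<bar>u / t - w / t\<bar> \<le> d - c - 2 / N" using U[OF uw(1)] U[OF uw(2)] by (simp add: abs_le_iff)
    also have "\<dots> < 1"
    proof -
      have "0 \<le> 2 / real N" by simp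
      then show ?thesis using cd by linarith
    qed
    finally have "\<bar>(u - w) / t\<bar> < 1" by (simp add: diff_divide_distrib)
    then have "\<bar>real_of_int (u - w)\<bar> < t" using t by (simp add: abs_divide)
    then have "\<bar>u - w\<bar> < int t" by linarith
    with dvd show "u = w" using dvd_imp_le_int[of "u - w" "int t"] by auto
  qed
  have sub: "f ` U \<subseteq> ?A"
  proof
    fix q assume "q \<in> f ` U"
    then obtain u where u: "u \<in> U" "q = f u" by blast
    define i where "i = (u * h') mod int t"
    have i: "0 \<le> i" "i < int t" using t by (simp_all add: i_def)
    have q: "q = q0 + nat i" "q \<in> {q0..<q0 + t}" using u(2) i by (auto simp: f_def i_def)
    define z where "z = - (u * v) - (u * h') div int t * h"
    have "i = u * h' - (u * h') div int t * int t" by (simp add: i_def minus_div_mult_eq_mod)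
    then have "i * h = (u * h' - (u * h') div int t * int t) * h" by (rule arg_cong)
    also have "\<dots> = u * (h' * h) - (u * h') div int t * h * int t" by (simp only: left_diff_distrib right_diff_distrib mult.assoc mult.commute mult.left_commute)
    also have "h' * h = 1 - v * int t" using hv by simp
    finally have "i * h = u + z * int t" by (simp add: z_def algebra_simps)
    then have "real_of_int i * of_int h = of_int u + of_int z * real t"
      by (metis of_int_add of_int_mult of_int_of_nat_eq)
    then have ih: "of_int i * (of_int h / real t) = u / t + z" using t by (simp add: field_simps)
    have err: "\<bar>of_int i * (\<beta> - of_int h / t)\<bar> < 1 / N"
    proof -
      have "\<bar>\<beta> - of_int h / t\<bar> = \<bar>real t * \<beta> - of_int h\<bar> / t"
      proof -
        have "\<beta> - of_int h / t = (real t * \<beta> - of_int h) / t" using t by (simp add: field_simps)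
        then show ?thesis by (simp only: abs_divide abs_of_nat)
      qed
      then have "\<bar>of_int i * (\<beta> - of_int h / t)\<bar> = of_int i / t * \<bar>real t * \<beta> - of_int h\<bar>" using i by (simp add: abs_mult)
      also have "\<dots> \<le> 1 * \<bar>real t * \<beta> - of_int h\<bar>" using i t by (intro mult_right_mono) auto
      also have "\<dots> < 1 / N" using app by simp
      finally show ?thesis .
    qed
    have "real q = q0 + of_int i" using q(1) i(1) by simp
    then have "q * \<beta> - \<delta> - of_int z = y + of_int i * (of_int h / t) + of_int i * (\<beta> - of_int h / t) - z"
      by (simp add: y_def algebra_simps)
    also have "\<dots> = (y + u / t) + of_int i * (\<beta> - of_int h / t)" using ih by simp
    finally have "c < q * \<beta> - \<delta> - of_int z \<and> q * \<beta> - \<delta> - of_int z < d"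
      using U[OF u(1)] err by (simp add: abs_less_iff)
    then show "q \<in> ?A" using q by blast
  qed
  have "real t * (d - c) - 3 \<le> t * (d - 1 / N - y) - t * (c + 1 / N - y) - 1"
  proof -
    have "real t / N \<le> 1" using t by simp
    moreover have "t * (d - 1 / N - y) - t * (c + 1 / N - y) = real t * (d - c) - 2 * (real t / N)"
      by (simp add: algebra_simps)
    ultimately show ?thesis by linarith
  qed
  also have "\<dots> \<le> real (nat (\<lfloor>t * (d - 1 / N - y)\<rfloor> + 1 - \<lceil>t * (c + 1 / N - y)\<rceil>))" by linarith
  also have "\<dots> = card U" by (simp add: U_def)
  also have "card U = card (f ` U)" using card_image[OF inj] by simp
  also have "real \<dots> \<le> real (card ?A)" using sub by (intro of_nat_mono card_mono) auto
  finally show ?thesis .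
qed

lemma nd_eq_self: "0 \<le> x \<Longrightarrow> x < 1/2 \<Longrightarrow> nd x = x"
  using round_unique'[of x 0] by (simp add: dist_nearest_int_def)

lemma sum_inverse_squares_le: "(\<Sum>g=1..N. 1 / (real g)\<^sup>2) \<le> 2"
proof -
  have "(\<Sum>g=1..Suc N. 1 / (real g)\<^sup>2) \<le> 2 - 1 / Suc N" for N
  proof (induction N)
    case (Suc N)
    have "1 / (real (Suc (Suc N)))\<^sup>2 \<le> 1 / Suc N - 1 / Suc (Suc N)"
    proof -
      have "1 / real (Suc N) - 1 / real (Suc (Suc N)) = 1 / (real (Suc N) * real (Suc (Suc N)))"
        by (simp add: field_simps)
      also have "\<dots> \<ge> 1 / (real (Suc (Suc N)))\<^sup>2"
        unfolding power2_eq_square by (intro frac_le mult_right_mono) auto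
      finally show ?thesis .
    qed
    with Suc show ?case by simp
  qed simp
  moreover have "2 - 1 / real (Suc N) \<le> 2" for N by simp
  ultimately have "(\<Sum>g=1..Suc N. 1 / (real g)\<^sup>2) \<le> 2" for N using order_trans by blast
  then show ?thesis by (cases N) auto
qed

lemma harmonic_dyadic_le: "(\<Sum>g=1..2 ^ k. 1 / real g) \<le> k + 1"
proof (induction k)
  case (Suc k)
  have "{1..2 ^ Suc k} = {1..2 ^ k} \<union> {2 ^ k<..2 ^ Suc k :: nat}" by auto
  then have "(\<Sum>g=1..2 ^ Suc k. 1 / real g) = (\<Sum>g=1..2 ^ k. 1 / real g) + (\<Sum>g\<in>{2 ^ k<..2 ^ Suc k}. 1 / real g)"
    by (simp add: sum.union_disjoint[symmetric] ivl_disj_int)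
  also have "(\<Sum>g\<in>{2 ^ k<..2 ^ Suc k}. 1 / real g) \<le> (\<Sum>g\<in>{2 ^ k<..2 ^ Suc k :: nat}. 1 / 2 ^ k)"
  proof (rule sum_mono)
    fix g :: nat assume "g \<in> {2 ^ k<..2 ^ Suc k}"
    then have "2 ^ k \<le> g" by simp
    then have "real (2 ^ k) \<le> real g" by (simp only: of_nat_le_iff)
    then show "1 / real g \<le> 1 / 2 ^ k" by (intro frac_le) auto
  qed
  also have "\<dots> = 1" by simp
  finally show ?case using Suc by simp
qed simp

context bohr_blocks begin

text \<open>Dirichlet yields t <= 2^n with t\<beta> within 2^(-n) of an integer, and
  \<open>indep\<close> with first coefficient 0 pushes t above 2^(20 J n). Windows of t consecutive
  q then resolve intervals of length 2^(-j-1): the loss 3 is at most half the main term. Disjoint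
  windows fill at least half the block, whence 8 = 4 * 2.\<close>

lemma card_Q_ge:
  assumes n: "n \<ge> n0" and j: "1 \<le> j" "j \<le> J n"
  shows "2 ^ n / 2 ^ j / 8 \<le> real (card (Q n j))"
proof -
  obtain h k where hk: "coprime h k" "0 < k" "k \<le> int (2 ^ n)" "\<bar>of_int k * \<beta> - of_int h\<bar> < 1 / real (2 ^ n)"
    by (rule Dirichlet_approx_coprime[of "2 ^ n" \<beta>]) auto
  define t where "t = nat k"
  have t: "t \<ge> 1" "t \<le> 2 ^ n" "k = int t" using hk by (auto simp: t_def nat_le_iff)
  have tb: "\<bar>real t * \<beta> - of_int h\<bar> < 1 / real (2 ^ n)" using hk(4) t(3) by simp
  have J6: "6 \<le> J n" by (rule J_ge_6[OF n])
  have t_large: "2 ^ (20 * J n) < t"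
  proof (rule ccontr)
    assume "\<not> 2 ^ (20 * J n) < t"
    then have "\<bar>int t\<bar> \<le> int (2 ^ (20 * J n))" by (simp only: of_nat_le_iff abs_of_nat not_less)
    then have "1 / 2 ^ (n div 10) \<le> nd (of_int 0 * \<gamma> + of_int (int t) * \<beta>)" using t by (intro indep[OF n]) auto
    also have "\<dots> \<le> \<bar>real t * \<beta> - of_int h\<bar>" using nd_le[of "real t * \<beta>" h] by simp
    also have "\<dots> < 1 / 2 ^ n" using tb by simp
    finally have "(2::real) ^ n < 2 ^ (n div 10)" by (simp add: field_simps)
    moreover have "(2::real) ^ (n div 10) \<le> 2 ^ n" by (intro power_increasing) auto
    ultimately show False by simp
  qed
  have per: "real t / 2 ^ (j + 2) \<le> real (card (Q n j \<inter> {q0..<q0 + t}))" if q0: "2 ^ n \<le> q0" "q0 + t \<le> 2 ^ (n + 1)" for q0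
  proof -
    let ?A = "{q \<in> {q0..<q0 + t}. \<exists>z::int. 1 / 2 ^ (j + 1) < q * \<beta> - \<gamma>' - of_int z \<and> q * \<beta> - \<gamma>' - of_int z < 1 / 2 ^ j}"
    \<comment> \<open>j >= 1 keeps the one-sided interval below 1/2, where nd is the
      identity.\<close>
    have half: "1 / 2 ^ j \<le> (1/2 :: real)" using j(1) power_increasing[of 1 j "2::real"] by (simp add: field_simps)
    have diff: "1 / 2 ^ j - 1 / 2 ^ (j + 1) = 1 / (2 ^ (j + 1) :: real)" by (simp add: field_simps)
    have "?A \<subseteq> Q n j \<inter> {q0..<q0 + t}"
    proof
      fix q assume "q \<in> ?A"
      then obtain z :: int where q: "q \<in> {q0..<q0 + t}" and z: "1 / 2 ^ (j + 1) < q * \<beta> - \<gamma>' - of_int z" "q * \<beta> - \<gamma>' - of_int z < 1 / 2 ^ j" by blast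
      have "nd (real q * \<beta> - \<gamma>') = nd (real q * \<beta> - \<gamma>' - of_int z)" using nd_add_int[of "q * \<beta> - \<gamma>' - of_int z" z] by simp
      also have "\<dots> = q * \<beta> - \<gamma>' - of_int z"
      proof (rule nd_eq_self)
        have "0 < (1::real) / 2 ^ (j + 1)" by simp
        then show "0 \<le> q * \<beta> - \<gamma>' - of_int z" using z(1) by linarith
        show "q * \<beta> - \<gamma>' - of_int z < 1/2" using z(2) half by linarith
      qed
      finally show "q \<in> Q n j \<inter> {q0..<q0 + t}" using q z q0 by (simp add: Q_def)
    qed
    then have "real (card ?A) \<le> real (card (Q n j \<inter> {q0..<q0 + t}))" by (intro of_nat_mono card_mono) auto
    moreover have "real t * (1 / 2 ^ j - 1 / 2 ^ (j + 1)) - 3 \<le> real (card ?A)"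
    proof (rule card_rotation_window_ge[where h = h, OF _ t(1,2) tb])
      show "coprime h (int t)" using hk t by simp
      show "1 / 2 ^ j - 1 / 2 ^ (j + 1) < (1::real)" 
      proof -
        have "1 / 2 ^ (j + 1) \<le> (1 / 2 ^ 1 :: real)" by (intro divide_left_mono power_increasing) auto
        then show ?thesis unfolding diff power_one_right by linarith
      qed
    qed
    moreover have "3 \<le> real t / 2 ^ (j + 2)"
    proof -
      have "3 * 2 ^ (j + 2) \<le> (2::real) ^ 2 * 2 ^ (j + 2)" by simp
      also have "\<dots> = 2 ^ (j + 4)" by (simp add: power_add)
      also have "\<dots> \<le> 2 ^ (20 * J n)" using j J6 by (intro power_increasing) auto
      also have "\<dots> \<le> real t"
      proof -
        have "real (2 ^ (20 * J n)) \<le> real t" using t_large by (simp only: of_nat_le_iff)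
        then show ?thesis by simp
      qed
      finally show ?thesis by (simp add: le_divide_eq)
    qed
    moreover have "real t * (1 / 2 ^ j - 1 / 2 ^ (j + 1)) = 2 * (real t / 2 ^ (j + 2))" unfolding diff by simp
    ultimately show ?thesis by linarith
  qed
  define w where "w = 2 ^ n div t"
  have wt: "w * t \<le> 2 ^ n" by (simp add: w_def)
  have w: "2 ^ n \<le> 2 * (w * t)"
  proof -
    have "1 \<le> w" using t by (simp add: w_def div_greater_zero_iff Suc_le_eq)
    then have "t \<le> w * t" by simp
    moreover have "2 ^ n = w * t + 2 ^ n mod t" by (simp add: w_def)
    moreover have "2 ^ n mod t < t" using t by simp
    ultimately show ?thesis by linarith
  qed
  define B where "B i = Q n j \<inter> {2 ^ n + i * t..<2 ^ n + i * t + t}" for i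
  have disj: "B i \<inter> B i' = {}" if "i < i'" for i i'
  proof -
    have "i * t + t \<le> i' * t" using that by (metis Suc_leI add.commute mult_Suc mult_le_mono1)
    then show ?thesis by (auto simp: B_def)
  qed
  have "2 ^ n / 2 ^ j / 8 = (2 ^ n / 2) / (2 ^ (j + 2) :: real)" by simp
  also have "\<dots> \<le> real (w * t) / 2 ^ (j + 2)"
  proof (rule divide_right_mono)
    have "real (2 ^ n) \<le> real (2 * (w * t))" using w by (simp only: of_nat_le_iff)
    then show "2 ^ n / 2 \<le> real (w * t)" by simp
  qed simp
  also have "\<dots> = (\<Sum>i<w. real t / 2 ^ (j + 2))" by simp
  also have "\<dots> \<le> (\<Sum>i<w. real (card (B i)))"
  proof (rule sum_mono)
    fix i assume "i \<in> {..<w}"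
    then have "i * t + t \<le> w * t" by (metis Suc_leI add.commute lessThan_iff mult_Suc mult_le_mono1)
    then show "real t / 2 ^ (j + 2) \<le> real (card (B i))" unfolding B_def using wt by (intro per) auto
  qed
  also have "\<dots> = real (card (\<Union>i<w. B i))"
  proof -
    have "card (\<Union>i<w. B i) = (\<Sum>i<w. card (B i))"
    proof (rule card_UN_disjoint)
      show "\<forall>i\<in>{..<w}. \<forall>i'\<in>{..<w}. i \<noteq> i' \<longrightarrow> B i \<inter> B i' = {}"
        using disj by (metis inf_commute linorder_neqE_nat)
    qed (auto simp: B_def)
    then show ?thesis by simp
  qed
  also have "\<dots> \<le> real (card (Q n j))" by (intro of_nat_mono card_mono) (auto simp: B_def)
  finally show ?thesis .
qed

end

section \<open>The second moment\<close>


context bohr_blocks begin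

lemma rad_pos: "0 < rad n j" using a_pos by (simp add: rad_def)

lemma rad_nonneg [simp]: "0 \<le> rad n j" using rad_pos by (rule less_imp_le)

lemma rad_le_half: "n \<ge> n0 \<Longrightarrow> j \<le> J n \<Longrightarrow> rad n j \<le> 1/2"
proof -
  assume n: "n \<ge> n0" and j: "j \<le> J n"
  have "a n * 2 ^ j * 2 \<le> 1 * 2 ^ j * 2" using a_le[of n] by (intro mult_right_mono) auto
  also have "\<dots> = 2 ^ (j + 1)" by simp
  also have "\<dots> \<le> (2::real) ^ n" using j J_le[of n] n n0 by (intro power_increasing) auto
  finally show ?thesis by (simp add: rad_def field_simps)
qed

text \<open>Block-uniform forms of the minimum and of D in \<open>measure_hit_Int_le\<close>: the
  lower bounds 2^n, 2^m for q, q' go into the denominators, the upper bounds 2^(n+1), 2^(m+1) into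
  the width.\<close>

definition bad_min where "bad_min n j m l = min (rad n j / 2 ^ n) (rad m l / 2 ^ m)"
definition bad_width where "bad_width n j m l = 2 * (2 ^ m * rad n j + 2 ^ n * rad m l)"

lemma bad_min_nonneg: "0 \<le> bad_min n j m l" by (simp add: bad_min_def)
lemma bad_width_pos: "0 < bad_width n j m l" using rad_pos by (simp add: bad_width_def add_pos_pos)

lemma overlap_le:
  assumes nm: "n0 \<le> n" "n0 \<le> m" and jl: "j \<le> J n" "l \<le> J m"
    and q: "q \<in> Q n j" "q' \<in> Q m l" "q \<noteq> q'"
  shows "measure lebesgue (hit \<gamma> q (rad n j) \<inter> hit \<gamma> q' (rad m l)) \<le> 48 * rad n j * rad m l +
    6 * real (gcd q q') * bad_min n j m l *
      of_bool ((int q' - int q) div int (gcd q q') \<in> shifts q (gcd q q') m l (bad_width n j m l / gcd q q'))"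
proof -
  define g where "g = gcd q q'"
  define k where "k = (int q' - int q) div int g"
  have q1: "q \<ge> 1" "q' \<ge> 1"
    using q(1,2) unfolding Q_def by (auto intro: order_trans[OF _ conjunct1] simp: Suc_le_eq intro!: gr0I)
  have g: "g \<ge> 1" using q1 by (simp add: g_def Suc_le_eq)
  have "int g dvd int q' - int q" by (intro dvd_diff) (auto simp: g_def)
  then have kg: "k * int g = int q' - int q" by (simp add: k_def)
  have k: "of_int k * real g = real q' - real q" using arg_cong[OF kg, of real_of_int] by simp
  have kd: "\<gamma> * ((real q' - real q) / real g) = of_int k * \<gamma>" unfolding k[symmetric] using g by simp
  have qr: "real (2 ^ n) \<le> real q" "real q \<le> real (2 ^ (n + 1))" "real (2 ^ m) \<le> real q'" "real q' \<le> real (2 ^ (m + 1))"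
    using q(1,2) unfolding Q_def of_nat_le_iff by auto
  have D: "q' * rad n j + q * rad m l \<le> bad_width n j m l"
  proof -
    have "q' * rad n j + q * rad m l \<le> real (2 ^ (m + 1)) * rad n j + real (2 ^ (n + 1)) * rad m l"
      using qr rad_pos by (intro add_mono mult_right_mono) (auto intro: less_imp_le)
    then show ?thesis by (simp add: bad_width_def algebra_simps)
  qed
  have min: "min (rad n j / q) (rad m l / q') \<le> bad_min n j m l"
    unfolding bad_min_def using qr rad_pos by (intro min.mono frac_le) (auto intro: less_imp_le)
  have bool: "(of_bool (nd (\<gamma> * ((real q' - real q) / real g)) < (q' * rad n j + q * rad m l) / g) :: real)
     \<le> of_bool (k \<in> shifts q g m l (bad_width n j m l / g))"
  proof (cases "nd (\<gamma> * ((real q' - real q) / real g)) < (q' * rad n j + q * rad m l) / g")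
    case True
    have "(q' * rad n j + q * rad m l) / g \<le> bad_width n j m l / g" using D by (intro divide_right_mono) auto
    then have "nd (of_int k * \<gamma>) \<le> bad_width n j m l / g" using True kd by simp
    moreover have "k \<noteq> 0" using kg q(3) by auto
    moreover have "int q' = int q + k * int g" using kg by simp
    ultimately have "k \<in> shifts q g m l (bad_width n j m l / g)" using q(2) by (auto simp: shifts_def)
    then show ?thesis by simp
  qed simp
  have "measure lebesgue (hit \<gamma> q (rad n j) \<inter> hit \<gamma> q' (rad m l)) \<le> 48 * rad n j * rad m l +
     6 * real g * min (rad n j / q) (rad m l / q') * of_bool (nd (\<gamma> * ((real q' - real q) / real g)) < (q' * rad n j + q * rad m l) / real g)"
    unfolding g_def using nm jl by (intro measure_hit_Int_le q1 rad_pos rad_le_half)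
  also have "\<dots> \<le> 48 * rad n j * rad m l + 6 * real g * bad_min n j m l * of_bool (k \<in> shifts q g m l (bad_width n j m l / g))"
    using bool min bad_min_nonneg by (intro add_left_mono mult_mono) auto
  finally show ?thesis by (simp add: g_def k_def)
qed

text \<open>For fixed q the map from q' to (gcd q q', k) is injective because q' = q + k gcd q q'.
  So the sum over q' is dominated by one over divisors g of q and over k in
  \<open>shifts\<close>.\<close>

lemma sum_bad_le:
  assumes q: "q \<in> Q n j" and F: "\<And>g. 0 \<le> F g"
  shows "(\<Sum>q'\<in>Q m l. if q = q' then 0 else F (gcd q q') *
      of_bool ((int q' - int q) div int (gcd q q') \<in> shifts q (gcd q q') m l (D / gcd q q')))
    \<le> (\<Sum>g | g \<in> {1..2 ^ (n + 1)} \<and> g dvd q. F g * real (card (shifts q g m l (D / g))))"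
proof -
  define k where "k q' = (int q' - int q) div int (gcd q q')" for q'
  define G where "G = {g \<in> {1..2 ^ (n + 1)}. g dvd q}"
  define B where "B = {q' \<in> Q m l. q \<noteq> q' \<and> k q' \<in> shifts q (gcd q q') m l (D / gcd q q')}"
  define \<phi> where "\<phi> q' = (gcd q q', k q')" for q'
  have q1: "q \<ge> 1" "q \<le> 2 ^ (n + 1)" using q unfolding Q_def by (auto simp: Suc_le_eq intro!: gr0I)
  have kg: "int q' = int q + k q' * int (gcd q q')" for q'
  proof -
    have "int (gcd q q') dvd int q' - int q" by (intro dvd_diff) auto
    then have "(int q' - int q) div int (gcd q q') * int (gcd q q') = int q' - int q" by (rule dvd_div_mult_self)
    then show ?thesis unfolding k_def by linarith
  qed
  have inj: "inj_on \<phi> B"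
    by (rule inj_onI) (metis Pair_inject \<phi>_def kg of_nat_eq_iff)
  have "(\<Sum>q'\<in>Q m l. if q = q' then 0 else F (gcd q q') * of_bool (k q' \<in> shifts q (gcd q q') m l (D / gcd q q')))
     = (\<Sum>q'\<in>B. F (gcd q q'))"
    by (rule sum.mono_neutral_cong_right) (auto simp: B_def)
  also have "\<dots> = (\<Sum>p\<in>\<phi> ` B. F (fst p))"
    by (subst sum.reindex[OF inj]) (simp add: \<phi>_def o_def)
  also have "\<dots> \<le> (\<Sum>p\<in>Sigma G (\<lambda>g. shifts q g m l (D / g)). F (fst p))"
  proof (rule sum_mono2)
    show "finite (Sigma G (\<lambda>g. shifts q g m l (D / g)))"
      by (intro finite_SigmaI finite_shifts) (auto simp: G_def)
    show "\<phi> ` B \<subseteq> Sigma G (\<lambda>g. shifts q g m l (D / g))"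
    proof
      fix p assume "p \<in> \<phi> ` B"
      then obtain q' where q': "q' \<in> B" "p = (gcd q q', k q')" by (auto simp: \<phi>_def)
      have "gcd q q' \<ge> 1" "gcd q q' \<le> q" using q1 by (auto simp: Suc_le_eq intro: gcd_le1_nat)
      then have "gcd q q' \<in> G" using order_trans[OF _ q1(2)] by (simp add: G_def del: power_Suc)
      then show "p \<in> Sigma G (\<lambda>g. shifts q g m l (D / g))" using q' by (simp add: B_def)
    qed
  qed (rule F)
  also have "\<dots> = (\<Sum>g\<in>G. \<Sum>k\<in>shifts q g m l (D / g). F g)"
    by (subst sum.Sigma) (auto simp: G_def intro!: finite_shifts sum.cong)
  also have "\<dots> = (\<Sum>g\<in>G. F g * real (card (shifts q g m l (D / g))))" by (simp add: mult.commute)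
  finally show ?thesis unfolding k_def G_def .
qed

text \<open>The three values of \<open>E\<close>: for small \<open>g\<close> the conditions on both \<open>k\<gamma>\<close> and \<open>kg\<beta>\<close> are exploited, for large
  \<open>g\<close> only the one on \<open>k\<gamma>\<close>, and for distant blocks none, the factor \<open>2 ^ n / 2 ^ m\<close> being enough.\<close>

lemma bad_term_le:
  assumes nm: "n0 \<le> n" "n \<le> m" and jl: "j \<le> J n" "l \<le> J m" and g: "1 \<le> g" "g \<le> 2 ^ (n + 1)"
    and E: "\<And>q. q \<in> Q n j \<Longrightarrow> real (card (shifts q g m l (bad_width n j m l / g))) \<le> E"
      "E = (if m \<le> n + 2 * J m then if g \<le> 2 ^ (8 * J m) then
              96 * (2 ^ m / (real g * 2 ^ l)) * (12 * bad_width n j m l / g + 2 / 2 ^ (12 * J m))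
            else 400 * (2 ^ m / (real g * 2 ^ (4 * J m))) else 3 * (2 ^ m / real g))"
  shows "real g * bad_min n j m l * (real (card {q \<in> Q n j. g dvd q}) * E) \<le> 
     500000 * (a n * a m) / (real g)\<^sup>2 + of_bool (g \<le> 2 ^ (8 * J m)) * (20000 / 2 ^ (12 * J m)) + 800 / 2 ^ J m * (1 / g)"
proof -
  let ?\<mu> = "bad_min n j m l" and ?D = "bad_width n j m l"
  let ?c = "real (card {q \<in> Q n j. g dvd q})"
  have J6: "6 \<le> J m" using J_ge_6[of m] nm by simp
  have jm: "j \<le> J m" using jl(1) monoD[OF J_mono nm(2)] by simp
  have g0: "real g > 0" using g by simp
  have \<mu>0: "0 \<le> ?\<mu>" by (rule bad_min_nonneg)
  have D0: "0 < ?D" by (rule bad_width_pos)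
  have \<mu>m: "?\<mu> \<le> a m * 2 ^ l / 2 ^ m / 2 ^ m" by (simp add: bad_min_def rad_def)
  have \<mu>l: "?\<mu> * (2 ^ n * 2 ^ m) / (2 ^ j * 2 ^ l) \<le> 1"
  proof -
    have "?\<mu> * (2 ^ n * 2 ^ m) / (2 ^ j * 2 ^ l) \<le> (a m * 2 ^ l / 2 ^ m / 2 ^ m) * (2 ^ n * 2 ^ m) / (2 ^ j * 2 ^ l)"
      by (intro divide_right_mono mult_right_mono \<mu>m) auto
    also have "\<dots> = a m * (2 ^ n / 2 ^ m) * (1 / 2 ^ j)" by simp
    also have "\<dots> \<le> 1 * 1 * 1"
      using a_le[of m] a_pos[of m] nm(2) by (intro mult_mono) (auto intro: power_increasing less_imp_le)
    finally show ?thesis by simp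
  qed
  have \<mu>J: "?\<mu> * (2 ^ n * 2 ^ m) \<le> 2 ^ J m * (2 ^ n / 2 ^ m)"
  proof -
    have "?\<mu> * (2 ^ n * 2 ^ m) \<le> (a m * 2 ^ l / 2 ^ m / 2 ^ m) * (2 ^ n * 2 ^ m)"
      by (intro mult_right_mono \<mu>m) auto
    also have "\<dots> = a m * 2 ^ l * (2 ^ n / 2 ^ m)" by simp
    also have "\<dots> \<le> 1 * 2 ^ J m * (2 ^ n / 2 ^ m)"
      using a_le[of m] a_pos[of m] jl(2) by (intro mult_mono) (auto intro: power_increasing less_imp_le)
    finally show ?thesis by simp
  qed
  have \<mu>D: "?\<mu> * ?D * (2 ^ n * 2 ^ m) / (2 ^ j * 2 ^ l) \<le> 4 * (a n * a m)"
  proof -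
    define x where "x = rad n j / 2 ^ n"
    define y where "y = rad m l / 2 ^ m"
    have xy: "0 \<le> x" "0 \<le> y" by (simp_all add: x_def y_def)
    have D: "?D = 2 * (2 ^ n * 2 ^ m) * (x + y)" by (simp add: bad_width_def x_def y_def field_simps)
    \<comment> \<open>The product a n * a m arises here: the interval length carries min x y and the
      alignment width x + y, so the very different scales of two blocks cost nothing beyond a factor
      2.\<close>
    have "min x y * (x + y) \<le> 2 * (x * y)"
      using xy by (cases "x \<le> y") (auto simp: min_def algebra_simps mult_left_mono mult_right_mono)
    then have "(2 * (2 ^ n * 2 ^ m)) * (min x y * (x + y)) \<le> (2 * (2 ^ n * 2 ^ m)) * (2 * (x * y))"
      by (intro mult_left_mono) auto
    then have "?\<mu> * ?D * (2 ^ n * 2 ^ m) / (2 ^ j * 2 ^ l) \<le> (2 * (2 ^ n * 2 ^ m)) * (2 * (x * y)) * (2 ^ n * 2 ^ m) / (2 ^ j * 2 ^ l)"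
      unfolding D bad_min_def x_def[symmetric] y_def[symmetric]
      by (intro divide_right_mono mult_right_mono) (auto simp: algebra_simps)
    also have "\<dots> = 4 * (a n * a m)" by (simp add: x_def y_def rad_def)
    finally show ?thesis .
  qed
  have ctriv: "?c \<le> 2 * 2 ^ n / g"
  proof -
    have "{q \<in> Q n j. g dvd q} \<subseteq> (\<lambda>r. g * r) ` {1..2 ^ (n + 1) div g}"
    proof
      fix q assume "q \<in> {q \<in> Q n j. g dvd q}"
      then have q: "q \<in> Q n j" "g dvd q" by auto
      then obtain r where r: "q = g * r" by blast
      have "0 < q" "q \<le> 2 ^ (n + 1)" using q(1) unfolding Q_def by (auto intro!: gr0I)
      then have "r \<in> {1..2 ^ (n + 1) div g}" using r g by (auto simp: less_eq_div_iff_mult_less_eq Suc_le_eq mult.commute)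
      then show "q \<in> (\<lambda>r. g * r) ` {1..2 ^ (n + 1) div g}" using r by blast
    qed
    then have "card {q \<in> Q n j. g dvd q} \<le> card {1..2 ^ (n + 1) div g}" using surj_card_le by (metis finite_atLeastAtMost)
    then have "?c \<le> real (2 ^ (n + 1) div g)" by simp
    also have "\<dots> \<le> real (2 ^ (n + 1)) / g" by (rule of_nat_div_le_of_nat)
    finally show ?thesis by simp
  qed
  have r0: "0 \<le> 500000 * (a n * a m) / (real g)\<^sup>2" using a_pos[of n] a_pos[of m] by simp
  have r1: "0 \<le> of_bool (g \<le> 2 ^ (8 * J m)) * (20000 / 2 ^ (12 * J m) :: real)" by simp
  have r2: "0 \<le> 800 / 2 ^ J m * (1 / real g)" by simp
  consider (small) "m \<le> n + 2 * J m" "g \<le> 2 ^ (8 * J m)" | (large) "m \<le> n + 2 * J m" "\<not> g \<le> 2 ^ (8 * J m)" | (far) "\<not> m \<le> n + 2 * J m"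
    by blast
  then show ?thesis
  proof cases
    case small
    have E': "E = 96 * (2 ^ m / (real g * 2 ^ l)) * (12 * ?D / g + 2 / 2 ^ (12 * J m))" using E(2) small by simp
    have "?c \<le> 104 * (2 ^ n / (real g * 2 ^ j))"
      using nm small g jm by (intro card_Q_multiples_le[where m = m]) auto
    then have "real g * ?\<mu> * (?c * E) \<le> real g * ?\<mu> * (104 * (2 ^ n / (real g * 2 ^ j)) * E)"
      using \<mu>0 D0 unfolding E' by (intro mult_left_mono mult_right_mono) auto
    also have "\<dots> = 119808 * (?\<mu> * ?D * (2 ^ n * 2 ^ m) / (2 ^ j * 2 ^ l)) / (real g)\<^sup>2
        + (?\<mu> * (2 ^ n * 2 ^ m) / (2 ^ j * 2 ^ l)) * (19968 / 2 ^ (12 * J m)) * (1 / real g)"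
      unfolding E' using g0 by (simp add: power2_eq_square field_simps)
    also have "\<dots> \<le> 119808 * (4 * (a n * a m)) / (real g)\<^sup>2 + 1 * (20000 / 2 ^ (12 * J m)) * 1"
      using g by (intro add_mono divide_right_mono mult_left_mono mult_mono \<mu>D \<mu>l) (auto intro!: divide_right_mono)
    also have "119808 * (4 * (a n * a m)) / (real g)\<^sup>2 \<le> 500000 * (a n * a m) / (real g)\<^sup>2"
      using a_pos[of n] a_pos[of m] by (intro divide_right_mono) auto
    finally have "real g * ?\<mu> * (?c * E) \<le> 500000 * (a n * a m) / (real g)\<^sup>2 + 20000 / 2 ^ (12 * J m)" by simp
    moreover have "(of_bool (g \<le> 2 ^ (8 * J m)) :: real) = 1" using small by simp
    ultimately show ?thesis using r2 by (simp only: mult_1)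
  next
    case large
    have E': "E = 400 * (2 ^ m / (real g * 2 ^ (4 * J m)))" using E(2) large by simp
    have "real g * ?\<mu> * (?c * E) \<le> real g * ?\<mu> * (2 * 2 ^ n / g * E)"
      using \<mu>0 ctriv unfolding E' by (intro mult_left_mono mult_right_mono) auto
    also have "\<dots> = ?\<mu> * (2 ^ n * 2 ^ m) * (800 / 2 ^ (4 * J m) * (1 / g))" unfolding E' using g0 by (simp add: field_simps)
    also have "\<dots> \<le> (2 ^ J m * (2 ^ n / 2 ^ m)) * (800 / 2 ^ (4 * J m) * (1 / g))"
      by (intro mult_right_mono \<mu>J) auto
    \<comment> \<open>The saving 2^(4 J m) is weakened to 2^(2 J m), the saving of the distant case,
      so that both cases end in the same bound.\<close>
    also have "\<dots> \<le> (2 ^ J m * 1) * (800 / 2 ^ (2 * J m) * (1 / g))"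
      using nm g0 by (intro mult_mono frac_le) (auto intro!: power_increasing)
    also have "\<dots> = 800 / 2 ^ J m * (1 / g)" by (simp add: mult_2 power_add)
    finally show ?thesis using r0 r1 by linarith
  next
    case far
    have E': "E = 3 * (2 ^ m / real g)" using E(2) far by simp
    have "real g * ?\<mu> * (?c * E) \<le> real g * ?\<mu> * (2 * 2 ^ n / g * E)"
      using \<mu>0 ctriv unfolding E' by (intro mult_left_mono mult_right_mono) auto
    also have "\<dots> = ?\<mu> * (2 ^ n * 2 ^ m) * (6 * (1 / g))" unfolding E' using g0 by simp
    also have "\<dots> \<le> (2 ^ J m * (2 ^ n / 2 ^ m)) * (6 * (1 / g))"
      by (intro mult_right_mono \<mu>J) auto
    also have "\<dots> \<le> (2 ^ J m * (1 / 2 ^ (2 * J m))) * (800 * (1 / g))"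
    proof (intro mult_mono)
      have "(2::real) ^ n * 2 ^ (2 * J m) = 2 ^ (n + 2 * J m)" by (simp add: power_add)
      also have "\<dots> \<le> 2 ^ m" using far by (intro power_increasing) auto
      finally show "2 ^ n / 2 ^ m \<le> 1 / (2::real) ^ (2 * J m)" by (simp add: field_simps)
    qed auto
    also have "\<dots> = 800 / 2 ^ J m * (1 / g)" by (simp add: mult_2 power_add)
    finally show ?thesis using r0 r1 by linarith
  qed
qed

lemma bad_width_le:
  assumes "n0 \<le> n" "n \<le> m" "m \<le> n + 2 * J m" "j \<le> J n" "l \<le> J m"
  shows "bad_width n j m l \<le> 4 * 2 ^ (3 * J m)"
proof -
  have jm: "j \<le> J m" using assms monoD[OF J_mono assms(2)] by simp
  have "2 ^ m * rad n j \<le> 2 ^ (3 * J m)"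
  proof -
    have "2 ^ m * (a n * 2 ^ j) \<le> 2 ^ m * (1 * 2 ^ j)" using a_le[of n] by (intro mult_left_mono mult_right_mono) auto
    also have "\<dots> = 2 ^ (m + j)" by (simp add: power_add)
    also have "\<dots> \<le> 2 ^ (3 * J m + n)" using assms jm by (intro power_increasing) auto
    finally show ?thesis by (simp add: rad_def field_simps power_add)
  qed
  moreover have "2 ^ n * rad m l \<le> 2 ^ (3 * J m)"
  proof -
    have "2 ^ n * (a m * 2 ^ l) \<le> 2 ^ n * (1 * 2 ^ l)" using a_le[of m] by (intro mult_left_mono mult_right_mono) auto
    also have "\<dots> = 2 ^ (n + l)" by (simp add: power_add)
    also have "\<dots> \<le> 2 ^ (3 * J m + m)" using assms jm by (intro power_increasing) auto
    finally show ?thesis by (simp add: rad_def field_simps power_add)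
  qed
  ultimately show ?thesis by (simp add: bad_width_def)
qed

text \<open>The sums over q and over its divisors g are exchanged, so each g is weighted by its
  number of multiples in \<open>Q n j\<close>. The three terms of \<open>bad_term_le\<close> then
  give a constant through the sum of 1/g^2, at most 2^(8 J m) terms of order 2^(-12 J m), and a
  harmonic sum of order n. The quasi-independent part has the constant 519168 = 48 * 104^2, one 104
  from each \<open>card_Q_le\<close>.\<close>

lemma pair_sum_le:
  assumes nm: "n0 \<le> n" "n \<le> m" and jl: "j \<le> J n" "l \<le> J m"
  shows "(\<Sum>q\<in>Q n j. \<Sum>q'\<in>Q m l. if q = q' then 0 else measure lebesgue (hit \<gamma> q (rad n j) \<inter> hit \<gamma> q' (rad m l)))
    \<le> 10^7 * (a n * a m) + 10^6 * (real m + 2) / 2 ^ J m"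
proof -
  let ?\<mu> = "bad_min n j m l" and ?D = "bad_width n j m l"
  define E where "E g = (if m \<le> n + 2 * J m then if g \<le> 2 ^ (8 * J m) then
              96 * (2 ^ m / (real g * 2 ^ l)) * (12 * bad_width n j m l / g + 2 / 2 ^ (12 * J m))
            else 400 * (2 ^ m / (real g * 2 ^ (4 * J m))) else 3 * (2 ^ m / real g))" for g :: nat
  have m: "n0 \<le> m" using nm by simp
  have E: "real (card (shifts q g m l (?D / g))) \<le> E g" if q: "q \<in> Q n j" and g: "1 \<le> g" "g \<le> 2 ^ (n + 1)" for q g
  proof -
    have le: "(2::nat) ^ (n + 1) \<le> 2 ^ (m + 1)" using nm by (intro power_increasing) auto
    have "q < 2 ^ (n + 1)" using q by (simp add: Q_def)
    then have "q < 2 ^ (m + 1)" using le by (rule less_le_trans)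
    moreover have "g \<le> 2 ^ (m + 1)" using g(2) le by (rule order_trans)
    ultimately show ?thesis unfolding E_def
      using card_shifts_small[OF m g(1) _ jl(2) bad_width_pos] card_shifts_trivial[OF g(1)]
        card_shifts_large[OF m _ _ _ bad_width_pos bad_width_le[OF nm _ jl]] by auto
  qed
  have E0: "0 \<le> E g" for g unfolding E_def using bad_width_pos[of n j m l] by (auto intro: less_imp_le)
  have main: "(\<Sum>q\<in>Q n j. \<Sum>q'\<in>Q m l. 48 * rad n j * rad m l) \<le> 519168 * (a n * a m)"
  proof -
    have "(\<Sum>q\<in>Q n j. \<Sum>q'\<in>Q m l. 48 * rad n j * rad m l) = 48 * (card (Q n j) * rad n j) * (card (Q m l) * rad m l)" by simp
    also have "\<dots> \<le> 48 * (104 * (2 ^ n / 2 ^ j) * rad n j) * (104 * (2 ^ m / 2 ^ l) * rad m l)"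
      using nm m jl rad_pos by (intro mult_mono mult_left_mono mult_right_mono card_Q_le mult_nonneg_nonneg) (auto intro: less_imp_le)
    also have "\<dots> = 519168 * (a n * a m)" by (simp add: rad_def)
    finally show ?thesis .
  qed
  let ?G = "{1..2 ^ (n + 1)} :: nat set"
  let ?T = "\<lambda>g. 500000 * (a n * a m) / (real g)\<^sup>2 + of_bool (g \<le> 2 ^ (8 * J m)) * (20000 / 2 ^ (12 * J m)) + 800 / 2 ^ J m * (1 / g)"
  have "(\<Sum>q\<in>Q n j. \<Sum>q'\<in>Q m l. if q = q' then 0 else 6 * real (gcd q q') * ?\<mu> *
      of_bool ((int q' - int q) div int (gcd q q') \<in> shifts q (gcd q q') m l (?D / gcd q q')))
    \<le> (\<Sum>q\<in>Q n j. \<Sum>g | g \<in> ?G \<and> g dvd q. 6 * real g * ?\<mu> * real (card (shifts q g m l (?D / g))))"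
    using bad_min_nonneg by (intro sum_mono sum_bad_le) auto
  also have "\<dots> \<le> (\<Sum>q\<in>Q n j. \<Sum>g | g \<in> ?G \<and> g dvd q. 6 * real g * ?\<mu> * E g)"
    using bad_min_nonneg by (intro sum_mono mult_left_mono E) auto
  also have "\<dots> = (\<Sum>q\<in>Q n j. \<Sum>g\<in>?G. of_bool (g dvd q) * (6 * real g * ?\<mu> * E g))"
    by (intro sum.cong refl sum.mono_neutral_cong_left) auto
  also have "\<dots> = (\<Sum>g\<in>?G. \<Sum>q\<in>Q n j. of_bool (g dvd q) * (6 * real g * ?\<mu> * E g))" by (rule sum.swap)
  also have "\<dots> = (\<Sum>g\<in>?G. 6 * (real g * ?\<mu> * (real (card {q \<in> Q n j. g dvd q}) * E g)))"
  proof (rule sum.cong[OF refl])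
    fix g
    have "(\<Sum>q\<in>Q n j. of_bool (g dvd q) :: real) = real (card {q \<in> Q n j. g dvd q})"
      by (simp add: of_bool_def sum.If_cases Int_def)
    then show "(\<Sum>q\<in>Q n j. of_bool (g dvd q) * (6 * real g * ?\<mu> * E g)) = 6 * (real g * ?\<mu> * (real (card {q \<in> Q n j. g dvd q}) * E g))"
      unfolding sum_distrib_right[symmetric] by simp
  qed
  also have "\<dots> \<le> (\<Sum>g\<in>?G. 6 * ?T g)"
  proof (intro sum_mono mult_left_mono)
    fix g assume g: "g \<in> ?G"
    show "real g * ?\<mu> * (real (card {q \<in> Q n j. g dvd q}) * E g) \<le> ?T g"
      using g E by (intro bad_term_le[OF nm jl]) (auto simp: E_def)
  qed auto
  also have "\<dots> = 3000000 * (a n * a m) * (\<Sum>g\<in>?G. 1 / (real g)\<^sup>2)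
     + 120000 / 2 ^ (12 * J m) * (\<Sum>g\<in>?G. of_bool (g \<le> 2 ^ (8 * J m))) + 4800 / 2 ^ J m * (\<Sum>g\<in>?G. 1 / g)"
  proof -
    have "6 * ?T g = 3000000 * (a n * a m) * (1 / (real g)\<^sup>2)
       + 120000 / 2 ^ (12 * J m) * of_bool (g \<le> 2 ^ (8 * J m)) + 4800 / 2 ^ J m * (1 / g)" for g :: nat
      by (simp add: algebra_simps)
    then show ?thesis by (simp only: sum.distrib sum_distrib_left)
  qed
  also have "\<dots> \<le> 3000000 * (a n * a m) * 2 + 120000 / 2 ^ (12 * J m) * 2 ^ (8 * J m) + 4800 / 2 ^ J m * (real (n + 1) + 1)"
  proof (intro add_mono mult_left_mono sum_inverse_squares_le)
    show "(\<Sum>g\<in>?G. 1 / real g) \<le> real (n + 1) + 1" using harmonic_dyadic_le[of "n + 1"] by simp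
    have "(\<Sum>g\<in>?G. of_bool (g \<le> 2 ^ (8 * J m)) :: real) = real (card (?G \<inter> {g. g \<le> 2 ^ (8 * J m)}))"
      by (simp add: of_bool_def sum.If_cases)
    also have "\<dots> \<le> real (card {1..2 ^ (8 * J m) :: nat})" by (intro of_nat_mono card_mono) auto
    finally show "(\<Sum>g\<in>?G. of_bool (g \<le> 2 ^ (8 * J m)) :: real) \<le> 2 ^ (8 * J m)" by simp
  qed (use a_pos[of n] a_pos[of m] in auto)
  also have "\<dots> \<le> 6000000 * (a n * a m) + 120000 / 2 ^ J m + 4800 / 2 ^ J m * (real m + 2)"
  proof (rule add_mono[OF add_mono])
    show "4800 / 2 ^ J m * (real (n + 1) + 1) \<le> 4800 / 2 ^ J m * (real m + 2)"
      using nm by (intro mult_left_mono) auto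
    have "2 ^ (8 * J m) * 2 ^ J m = (2::real) ^ (9 * J m)" by (simp flip: power_add)
    also have "\<dots> \<le> 2 ^ (12 * J m)" by (intro power_increasing) auto
    finally show "120000 / 2 ^ (12 * J m) * 2 ^ (8 * J m) \<le> 120000 / (2::real) ^ J m" by (simp add: field_simps)
  qed (use nm in auto)
  also have "\<dots> \<le> 6000000 * (a n * a m) + 10^6 * (real m + 2) / 2 ^ J m"
  proof -
    have "120000 / 2 ^ J m + 4800 / 2 ^ J m * (real m + 2) = (120000 + 4800 * (real m + 2)) / 2 ^ J m"
      by (simp add: add_divide_distrib)
    also have "\<dots> \<le> 10^6 * (real m + 2) / 2 ^ J m" by (intro divide_right_mono) auto
    finally show ?thesis by simp
  qed
  finally have bad: "(\<Sum>q\<in>Q n j. \<Sum>q'\<in>Q m l. if q = q' then 0 else 6 * real (gcd q q') * ?\<mu> *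
      of_bool ((int q' - int q) div int (gcd q q') \<in> shifts q (gcd q q') m l (?D / gcd q q')))
    \<le> 6000000 * (a n * a m) + 10^6 * (real m + 2) / 2 ^ J m" .
  have "(\<Sum>q\<in>Q n j. \<Sum>q'\<in>Q m l. if q = q' then 0 else measure lebesgue (hit \<gamma> q (rad n j) \<inter> hit \<gamma> q' (rad m l)))
    \<le> (\<Sum>q\<in>Q n j. \<Sum>q'\<in>Q m l. 48 * rad n j * rad m l + (if q = q' then 0 else 6 * real (gcd q q') * ?\<mu> *
      of_bool ((int q' - int q) div int (gcd q q') \<in> shifts q (gcd q q') m l (?D / gcd q q'))))"
  proof (intro sum_mono)
    fix q q' assume q: "q \<in> Q n j" "q' \<in> Q m l"
    show "(if q = q' then 0 else measure lebesgue (hit \<gamma> q (rad n j) \<inter> hit \<gamma> q' (rad m l)))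
      \<le> 48 * rad n j * rad m l + (if q = q' then 0 else 6 * real (gcd q q') * ?\<mu> *
      of_bool ((int q' - int q) div int (gcd q q') \<in> shifts q (gcd q q') m l (?D / gcd q q')))"
      using overlap_le[OF nm(1) m jl q] rad_pos[of n j] rad_pos[of m l] by (auto intro: less_imp_le)
  qed
  also have "\<dots> = (\<Sum>q\<in>Q n j. \<Sum>q'\<in>Q m l. 48 * rad n j * rad m l) + (\<Sum>q\<in>Q n j. \<Sum>q'\<in>Q m l. if q = q' then 0 else 6 * real (gcd q q') * ?\<mu> *
      of_bool ((int q' - int q) div int (gcd q q') \<in> shifts q (gcd q q') m l (?D / gcd q q')))"
    by (simp only: sum.distrib)
  also have "\<dots> \<le> 519168 * (a n * a m) + (6000000 * (a n * a m) + 10^6 * (real m + 2) / 2 ^ J m)"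
    by (intro add_mono main bad)
  also have "\<dots> \<le> 10^7 * (a n * a m) + 10^6 * (real m + 2) / 2 ^ J m"
    using a_pos[of n] a_pos[of m] by simp
  finally show ?thesis .
qed

end


section \<open>First moment and the measure of the limsup set\<close>

lemma measure_hit_le:
  assumes "q \<ge> 1" "0 < \<Delta>" "\<Delta> \<le> 1/2"
  shows "measure lebesgue (hit \<gamma> q \<Delta>) \<le> 30 * \<Delta>"
proof -
  \<comment> \<open>The case q' = q of the overlap bound: the gcd is q, 48 \<Delta>^2 is at most 24
    \<Delta>, and the extra term is 6 \<Delta>.\<close>
  have "measure lebesgue (hit \<gamma> q \<Delta> \<inter> hit \<gamma> q \<Delta>) \<le> 48 * \<Delta> * \<Delta> +
     6 * real q * (\<Delta> / q) * of_bool (nd (\<gamma> * ((real q - real q) / real q)) < (q * \<Delta> + q * \<Delta>) / real q)"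
    using measure_hit_Int_le[of q q \<Delta> \<Delta> \<gamma>] assms by simp
  also have "\<dots> \<le> 48 * \<Delta> * (1/2) + 6 * real q * (\<Delta> / q) * 1"
    using assms by (intro add_mono mult_left_mono) auto
  also have "\<dots> = 30 * \<Delta>" using assms by simp
  finally show ?thesis by simp
qed

text \<open>At least q - 2 of the disjoint open intervals of length 2 \<Delta> / q lie entirely in
  [0, 1]. The ones cut by the endpoints are discarded, and q >= 4 turns q - 2 into q/2.\<close>

lemma measure_hit_ge:
  assumes q: "q \<ge> 4" and \<Delta>: "0 < \<Delta>" "\<Delta> \<le> 1/2"
  shows "\<Delta> \<le> measure lebesgue (hit \<gamma> q \<Delta>)"
proof -
  define P where "P = {\<lceil>\<Delta> - \<gamma>\<rceil>..\<lfloor>q - \<gamma> - \<Delta>\<rfloor>}"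
  define I where "I p = {(\<gamma> + of_int p - \<Delta>) / real q<..<(\<gamma> + of_int p + \<Delta>) / real q}" for p
  have I: "measure lebesgue (I p) = 2 * (\<Delta> / q)" "I p \<in> lmeasurable" for p
    using assms by (auto simp: I_def field_simps divide_right_mono)
  have mem: "\<bar>real q * x - \<gamma> - of_int p\<bar> < \<Delta>" if "x \<in> I p" for x p
    using that q by (auto simp: I_def field_simps abs_less_iff)
  have disj: "disjnt (I p) (I p')" if "p \<noteq> p'" for p p'
  proof -
    have False if x: "x \<in> I p" "x \<in> I p'" for x
    proof -
      have "\<bar>real_of_int (p - p')\<bar> < 1" using mem[OF x(1)] mem[OF x(2)] \<Delta> by simp
      then show False using \<open>p \<noteq> p'\<close> by linarith
    qed
    then show ?thesis by (auto simp: disjnt_iff)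
  qed
  have sub: "(\<Union>p\<in>P. I p) \<subseteq> hit \<gamma> q \<Delta>"
  proof
    fix x assume "x \<in> (\<Union>p\<in>P. I p)"
    then obtain p where p: "p \<in> P" "x \<in> I p" by blast
    note m = mem[OF p(2)]
    have pp: "\<Delta> - \<gamma> \<le> p" "p \<le> q - \<gamma> - \<Delta>" using p(1) by (auto simp: P_def ceiling_le_iff le_floor_iff)
    have qx: "0 \<le> real q * x" "real q * x \<le> real q * 1"
      using m pp unfolding abs_less_iff mult_1_right by linarith+
    have "0 \<le> x" using qx(1) q by (simp add: zero_le_mult_iff)
    moreover have "x \<le> 1" by (rule mult_left_le_imp_le[OF qx(2)]) (use q in simp)
    moreover have "nd (real q * x - \<gamma>) < \<Delta>" using nd_le[of "real q * x - \<gamma>" p] m by simp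
    ultimately show "x \<in> hit \<gamma> q \<Delta>" by (simp add: hit_def)
  qed
  have "real q / 2 \<le> real (card P)"
  proof -
    have "real (card P) = real (nat (\<lfloor>q - \<gamma> - \<Delta>\<rfloor> + 1 - \<lceil>\<Delta> - \<gamma>\<rceil>))" by (simp add: P_def)
    moreover have "real 4 \<le> real q" using q by (simp only: of_nat_le_iff)
    ultimately show ?thesis using \<Delta> by linarith
  qed
  then have "real q / 2 * (2 * (\<Delta> / q)) \<le> card P * (2 * (\<Delta> / q))" using \<Delta> by (intro mult_right_mono) auto
  then have "\<Delta> \<le> card P * (2 * (\<Delta> / q))" using q by simp
  also have "\<dots> = (\<Sum>p\<in>P. measure lebesgue (I p))" using I by simp
  also have "\<dots> = measure lebesgue (\<Union>p\<in>P. I p)"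
    using I disj by (intro measure_UNION'[symmetric]) (auto simp: P_def pairwise_def)
  also have "\<dots> \<le> measure lebesgue (hit \<gamma> q \<Delta>)"
    using I by (intro measure_mono_fmeasurable sub hit_lmeasurable fmeasurableD fmeasurable.finite_UN) (auto simp: P_def)
  finally show ?thesis .
qed

context bohr_blocks begin

lemma a_nonneg [simp]: "0 \<le> a n" using a_pos by (rule less_imp_le)

lemma Q_unique:
  assumes "q \<in> Q n j" "q \<in> Q m l"
  shows "n = m" "j = l"
proof -
  have le: "n \<le> m" if "q \<in> Q n j" "q \<in> Q m l" for n j m l
  proof -
    have "2 ^ n < (2::nat) ^ (m + 1)" using that unfolding Q_def by (auto intro: le_less_trans)
    then have "n < m + 1" by (simp only: power_strict_increasing_iff one_less_numeral_iff semiring_norm)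
    then show ?thesis by simp
  qed
  show "n = m" using le[OF assms] le[OF assms(2,1)] by simp
  have le: "j \<le> l" if "q \<in> Q n j" "q \<in> Q m l" for n j m l
  proof -
    have "1 / 2 ^ (l + 1) < 1 / (2::real) ^ j" using that unfolding Q_def by (auto intro: less_le_trans)
    then have "(2::real) ^ j < 2 ^ (l + 1)" by (simp add: field_simps)
    then have "j < l + 1" by (simp only: power_strict_increasing_iff one_less_numeral_iff semiring_norm)
    then show ?thesis by simp
  qed
  show "j = l" using le[OF assms] le[OF assms(2,1)] by simp
qed

definition pair_sum :: "nat \<Rightarrow> nat \<Rightarrow> nat \<Rightarrow> nat \<Rightarrow> real" where
  "pair_sum n j m l =
    (\<Sum>q\<in>Q n j. \<Sum>q'\<in>Q m l. if q = q' then 0 else measure lebesgue (hit \<gamma> q (rad n j) \<inter> hit \<gamma> q' (rad m l)))"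

lemma pair_sum_commute: "pair_sum n j m l = pair_sum m l n j"
  unfolding pair_sum_def by (subst sum.swap) (intro sum.cong refl, auto simp: Int_commute)

lemma J_le_self: "J n \<le> n" using J_le[of n] by simp

text \<open>The exponent 7 is spent here: J n * J m <= m^2 and m + 2 <= 2m leave m^3 / m^7 = m^(-4)
  <= n^(-2) m^(-2), which is summable over all pairs of blocks.\<close>

lemma error_le:
  assumes "n0 \<le> n" "n \<le> m"
  shows "real (J n) * real (J m) * (10^6 * (real m + 2) / 2 ^ J m) \<le> 2 * 10^6 * (1 / (real n)\<^sup>2) * (1 / (real m)\<^sup>2)"
proof -
  have n: "n \<ge> 2" "m \<ge> 2" using assms n0 by auto
  have "real (m ^ 7) \<le> real (2 ^ J m)" using J_ge[of m] assms by (simp only: of_nat_le_iff)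
  then have J: "real m ^ 7 \<le> 2 ^ J m" by simp
  have "real (J n) * real (J m) * (10^6 * (real m + 2) / 2 ^ J m) \<le> real m * real m * (10^6 * (2 * real m) / real m ^ 7)"
    using n J J_le_self[of n] J_le_self[of m] assms by (intro mult_mono frac_le) auto
  also have "\<dots> = 2 * 10^6 * (1 / (real m)\<^sup>2) * (1 / (real m)\<^sup>2)"
    using n by (simp add: field_simps power_numeral_reduce)
  also have "\<dots> \<le> 2 * 10^6 * (1 / (real n)\<^sup>2) * (1 / (real m)\<^sup>2)"
    using n assms by (intro mult_right_mono mult_left_mono frac_le power_mono) auto
  finally show ?thesis .
qed

lemma pair_sum_total_le:
  assumes "n0 \<le> n" "n0 \<le> m"
  shows "(\<Sum>j=1..J n. \<Sum>l=1..J m. pair_sum n j m l)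
    \<le> 10^7 * (a n * J n) * (a m * J m) + 2 * 10^6 * (1 / (real n)\<^sup>2) * (1 / (real m)\<^sup>2)"
proof -
  have *: "(\<Sum>j=1..J n. \<Sum>l=1..J m. pair_sum n j m l)
    \<le> 10^7 * (a n * J n) * (a m * J m) + 2 * 10^6 * (1 / (real n)\<^sup>2) * (1 / (real m)\<^sup>2)"
    if nm: "n0 \<le> n" "n \<le> m" for n m
  proof -
    have "(\<Sum>j=1..J n. \<Sum>l=1..J m. pair_sum n j m l)
       \<le> (\<Sum>j=1..J n. \<Sum>l=1..J m. 10^7 * (a n * a m) + 10^6 * (real m + 2) / 2 ^ J m)"
      unfolding pair_sum_def using nm by (intro sum_mono pair_sum_le) auto
    also have "\<dots> = 10^7 * (a n * J n) * (a m * J m) + real (J n) * real (J m) * (10^6 * (real m + 2) / 2 ^ J m)"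
      by (simp add: algebra_simps)
    also have "\<dots> \<le> 10^7 * (a n * J n) * (a m * J m) + 2 * 10^6 * (1 / (real n)\<^sup>2) * (1 / (real m)\<^sup>2)"
      by (intro add_left_mono error_le nm)
    finally show ?thesis .
  qed
  show ?thesis
  proof (cases "n \<le> m")
    case True
    then show ?thesis using * assms by simp
  next
    case False
    have "(\<Sum>j=1..J n. \<Sum>l=1..J m. pair_sum n j m l) = (\<Sum>l=1..J m. \<Sum>j=1..J n. pair_sum m l n j)"
      by (subst sum.swap) (simp only: pair_sum_commute[of n])
    then show ?thesis using *[of m n] assms False by (simp add: mult.commute mult.left_commute)
  qed
qed

definition block_union :: "nat \<Rightarrow> nat \<Rightarrow> real set" where
  "block_union k N = (\<Union>n\<in>{k..N}. \<Union>j\<in>{1..J n}. \<Union>q\<in>Q n j. hit \<gamma> q (rad n j))"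

lemma block_union_lmeasurable: "block_union k N \<in> lmeasurable"
  unfolding block_union_def by (intro fmeasurable.finite_UN hit_lmeasurable) auto

lemma sum_inverse_squares_from_le: "(\<Sum>n=k..N. 1 / (real n)\<^sup>2) \<le> 2"
proof -
  have "(\<Sum>n=k..N. 1 / (real n)\<^sup>2) \<le> (\<Sum>n=0..N. 1 / (real n)\<^sup>2)" by (rule sum_mono2) auto
  also have "\<dots> = (\<Sum>n=1..N. 1 / (real n)\<^sup>2)" by (rule sum.mono_neutral_right) auto
  finally show ?thesis using sum_inverse_squares_le[of N] by simp
qed

text \<open>Chung-Erdos with first moment between T/8 and 3120 T and second moment at most S + 10^7
  T^2 + 8 * 10^6. The assumption T >= 1 lets the diagonal and the constant be absorbed in 2 * 10^7
  T^2, and 1 / (64 * 2 * 10^7) exceeds 10^(-10).\<close>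

lemma measure_block_union_ge:
  assumes k: "n0 \<le> k" and T1: "1 \<le> (\<Sum>n=k..N. a n * J n)"
  shows "1 / 10^10 \<le> measure lebesgue (block_union k N)"
proof -
  define T where "T = (\<Sum>n=k..N. a n * J n)"
  define X where "X = Sigma {k..N} (\<lambda>n. Sigma {1..J n} (\<lambda>j. Q n j))"
  define A where "A = (\<lambda>(n, j, q). hit \<gamma> q (rad n j))"
  have X: "finite X" unfolding X_def by (intro finite_SigmaI) auto
  have A_app: "A (n, j, q) = hit \<gamma> q (rad n j)" for n j q by (simp add: A_def)
  have A: "A x \<in> lmeasurable" for x by (cases x) (simp add: A_def)
  have sumX: "(\<Sum>x\<in>X. f x) = (\<Sum>n=k..N. \<Sum>j=1..J n. \<Sum>q\<in>Q n j. f (n, j, q))" for f :: "nat \<times> nat \<times> nat \<Rightarrow> real"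
    unfolding X_def by (simp add: sum.Sigma split_def)
  define S where "S = (\<Sum>x\<in>X. measure lebesgue (A x))"
  define V where "V = (\<Sum>x\<in>X. \<Sum>y\<in>X. measure lebesgue (A x \<inter> A y))"
  have UX: "(\<Union>x\<in>X. A x) = block_union k N" by (auto simp: X_def A_def block_union_def)
  have ce: "S\<^sup>2 \<le> measure lebesgue (block_union k N) * V"
    using chung_erdos[OF X A, of "\<lambda>x. x"] unfolding S_def V_def UX by simp
  have q4: "q \<ge> 4" if "n \<ge> n0" "q \<in> Q n j" for q n j
  proof -
    have "(2::nat) ^ 2 \<le> 2 ^ n" using that(1) n0 by (intro power_increasing) auto
    also have "\<dots> \<le> q" using that(2) by (simp add: Q_def)
    finally show ?thesis by simp
  qed
  have hitm: "rad n j \<le> measure lebesgue (hit \<gamma> q (rad n j))" "measure lebesgue (hit \<gamma> q (rad n j)) \<le> 30 * rad n j"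
    if "k \<le> n" "j \<le> J n" "q \<in> Q n j" for n j q
    using measure_hit_ge[OF _ rad_pos rad_le_half] measure_hit_le[OF _ rad_pos rad_le_half] q4[of n q j] that k by auto
  have Tj: "T = (\<Sum>n=k..N. \<Sum>j=1..J n. a n)" by (simp add: T_def mult.commute)
  have S_ge: "T / 8 \<le> S"
  proof -
    have "T / 8 = (\<Sum>n=k..N. \<Sum>j=1..J n. a n / 8)" unfolding Tj by (simp add: sum_divide_distrib)
    also have "\<dots> \<le> (\<Sum>n=k..N. \<Sum>j=1..J n. \<Sum>q\<in>Q n j. rad n j)"
    proof (intro sum_mono)
      fix n j assume nj: "n \<in> {k..N}" "j \<in> {1..J n}"
      have "a n / 8 = 2 ^ n / 2 ^ j / 8 * rad n j" by (simp add: rad_def)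
      also have "\<dots> \<le> card (Q n j) * rad n j" using nj k by (intro mult_right_mono card_Q_ge) auto
      finally show "a n / 8 \<le> (\<Sum>q\<in>Q n j. rad n j)" by simp
    qed
    also have "\<dots> \<le> (\<Sum>n=k..N. \<Sum>j=1..J n. \<Sum>q\<in>Q n j. measure lebesgue (A (n, j, q)))"
      unfolding A_def by (intro sum_mono) (auto intro: hitm)
    finally show ?thesis by (simp add: S_def sumX)
  qed
  have S_le: "S \<le> 3120 * T"
  proof -
    have "S \<le> (\<Sum>n=k..N. \<Sum>j=1..J n. \<Sum>q\<in>Q n j. 30 * rad n j)"
      unfolding S_def sumX A_def by (intro sum_mono) (auto intro: hitm)
    also have "\<dots> \<le> (\<Sum>n=k..N. \<Sum>j=1..J n. 3120 * a n)"
    proof (intro sum_mono)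
      fix n j assume nj: "n \<in> {k..N}" "j \<in> {1..J n}"
      have "card (Q n j) * (30 * rad n j) \<le> 104 * (2 ^ n / 2 ^ j) * (30 * rad n j)"
        using nj k by (intro mult_right_mono card_Q_le) auto
      also have "\<dots> = 3120 * a n" by (simp add: rad_def)
      finally show "(\<Sum>q\<in>Q n j. 30 * rad n j) \<le> 3120 * a n" by simp
    qed
    also have "\<dots> = 3120 * T" unfolding T_def sum_distrib_left by (intro sum.cong) simp_all
    finally show ?thesis .
  qed
  have V_le: "V \<le> S + 10^7 * T\<^sup>2 + 8 * 10^6"
  proof -
    \<comment> \<open>The diagonal is recognised by q alone: by \<open>Q_unique\<close> a given q
      belongs to one block and one class only, so each x meets exactly one y with the same
      q.\<close>
    let ?off = "\<lambda>x y. if snd (snd x) = snd (snd y) then 0 else measure lebesgue (A x \<inter> A y)"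
    have "V \<le> (\<Sum>x\<in>X. measure lebesgue (A x) + (\<Sum>y\<in>X. ?off x y))"
      unfolding V_def
    proof (rule sum_mono)
      fix x assume x: "x \<in> X"
      have eq: "x = y" if "y \<in> X" "snd (snd x) = snd (snd y)" for y
        using that x Q_unique by (auto simp: X_def)
      have "(\<Sum>y\<in>X. measure lebesgue (A x \<inter> A y)) = measure lebesgue (A x) + (\<Sum>y\<in>X - {x}. measure lebesgue (A x \<inter> A y))"
        using X x by (subst sum.remove[of X x]) auto
      also have "(\<Sum>y\<in>X - {x}. measure lebesgue (A x \<inter> A y)) = (\<Sum>y\<in>X - {x}. ?off x y)"
        using eq by (intro sum.cong) auto
      also have "\<dots> \<le> (\<Sum>y\<in>X. ?off x y)" using X by (intro sum_mono2) auto
      finally show "(\<Sum>y\<in>X. measure lebesgue (A x \<inter> A y)) \<le> measure lebesgue (A x) + (\<Sum>y\<in>X. ?off x y)" by simp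
    qed
    also have "\<dots> = S + (\<Sum>x\<in>X. \<Sum>y\<in>X. ?off x y)" by (simp add: sum.distrib S_def)
    also have "(\<Sum>x\<in>X. \<Sum>y\<in>X. ?off x y) = (\<Sum>n=k..N. \<Sum>m=k..N. \<Sum>j=1..J n. \<Sum>l=1..J m. pair_sum n j m l)"
    proof -
      have "(\<Sum>x\<in>X. \<Sum>y\<in>X. ?off x y) = (\<Sum>n=k..N. \<Sum>j=1..J n. \<Sum>q\<in>Q n j. \<Sum>m=k..N. \<Sum>l=1..J m. \<Sum>q'\<in>Q m l. ?off (n, j, q) (m, l, q'))"
        by (simp only: sumX)
      also have "\<dots> = (\<Sum>n=k..N. \<Sum>j=1..J n. \<Sum>m=k..N. \<Sum>q\<in>Q n j. \<Sum>l=1..J m. \<Sum>q'\<in>Q m l. ?off (n, j, q) (m, l, q'))"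
        by (intro sum.cong refl sum.swap)
      also have "\<dots> = (\<Sum>n=k..N. \<Sum>m=k..N. \<Sum>j=1..J n. \<Sum>q\<in>Q n j. \<Sum>l=1..J m. \<Sum>q'\<in>Q m l. ?off (n, j, q) (m, l, q'))"
        by (intro sum.cong refl sum.swap)
      also have "\<dots> = (\<Sum>n=k..N. \<Sum>m=k..N. \<Sum>j=1..J n. \<Sum>l=1..J m. \<Sum>q\<in>Q n j. \<Sum>q'\<in>Q m l. ?off (n, j, q) (m, l, q'))"
        by (intro sum.cong refl sum.swap)
      finally show ?thesis by (simp only: pair_sum_def A_app snd_conv)
    qed
    also have "\<dots> \<le> (\<Sum>n=k..N. \<Sum>m=k..N. 10^7 * (a n * J n) * (a m * J m) + 2 * 10^6 * (1 / (real n)\<^sup>2) * (1 / (real m)\<^sup>2))"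
      using k by (intro sum_mono pair_sum_total_le) auto
    also have "\<dots> = 10^7 * (T * T) + 2 * 10^6 * ((\<Sum>n=k..N. 1 / (real n)\<^sup>2) * (\<Sum>n=k..N. 1 / (real n)\<^sup>2))"
      unfolding T_def sum_product by (simp only: sum.distrib sum_distrib_left mult.assoc)
    also have "\<dots> \<le> 10^7 * (T * T) + 2 * 10^6 * (2 * 2)"
      by (intro add_left_mono mult_left_mono mult_mono sum_inverse_squares_from_le sum_nonneg) auto
    finally show ?thesis by (simp add: power2_eq_square)
  qed
  have T: "1 \<le> T" using T1 by (simp add: T_def)
  have "T * 1 \<le> T * T" using T by (intro mult_left_mono) auto
  then have TT: "T \<le> T\<^sup>2" "1 \<le> T\<^sup>2" using T unfolding power2_eq_square by linarith+
  have "(T / 8)\<^sup>2 \<le> S\<^sup>2" using S_ge T by (intro power_mono) auto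
  also have "\<dots> \<le> measure lebesgue (block_union k N) * V" by (rule ce)
  also have "\<dots> \<le> measure lebesgue (block_union k N) * (2 * 10^7 * T\<^sup>2)"
    using V_le S_le TT by (intro mult_left_mono) auto
  finally have "T\<^sup>2 * (1 / 64) \<le> T\<^sup>2 * (measure lebesgue (block_union k N) * (2 * 10^7))"
    by (simp add: power2_eq_square mult_ac)
  then have "1 / 64 \<le> measure lebesgue (block_union k N) * (2 * 10^7)"
    using T by (subst (asm) mult_le_cancel_left_pos) auto
  then show ?thesis by simp
qed

text \<open>Every tail of the divergent series has a partial sum of at least 1, so every tail union
  has measure at least 10^(-10), and continuity from above carries this to their intersection. Since
  q >= 2^n, hits in arbitrarily late blocks give infinitely many q.\<close>

lemma measure_limsup_ge:
  assumes "\<not> summable (\<lambda>n. a n * J n)"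
  obtains L where "L \<in> lmeasurable" "L \<subseteq> {0..1}" "1 / 10^10 \<le> measure lebesgue L"
    "\<And>x. x \<in> L \<Longrightarrow> infinite {q. \<exists>n j. q \<in> Q n j \<and> nd (real q * x - \<gamma>) < rad n j}"
proof -
  define B where "B i = (\<Union>N. block_union (n0 + i) N)" for i
  have sub01: "block_union k N \<subseteq> {0..1}" for k N by (auto simp: block_union_def hit_def)
  have Bs: "B i \<in> sets lebesgue" for i unfolding B_def using block_union_lmeasurable by (auto intro: fmeasurableD)
  have Bl: "B i \<in> lmeasurable" for i
    by (rule fmeasurableI2[of "{0..1}"]) (use Bs sub01 in \<open>auto simp: B_def\<close>)
  have B_ge: "1 / 10^10 \<le> measure lebesgue (B i)" for i
  proof -
    have "\<exists>N. 1 \<le> (\<Sum>n=n0 + i..N. a n * J n)"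
    proof (rule ccontr)
      assume "\<not> ?thesis"
      then have c: "(\<Sum>n=n0 + i..N. a n * J n) \<le> 1" for N by (meson not_le less_imp_le)
      have "summable (\<lambda>n. a (n + (n0 + i)) * J (n + (n0 + i)))"
      proof (rule summableI_nonneg_bounded)
        fix M
        have "(\<Sum>n<M. a (n + (n0 + i)) * J (n + (n0 + i))) = (\<Sum>n=n0 + i..<M + (n0 + i). a n * J n)"
          using sum.shift_bounds_nat_ivl[of "\<lambda>n. a n * J n" 0 "n0 + i" M] by (simp add: atLeast0LessThan)
        also have "\<dots> \<le> (\<Sum>n=n0 + i..M + (n0 + i). a n * J n)"
          by (intro sum_mono2) auto
        finally show "(\<Sum>n<M. a (n + (n0 + i)) * J (n + (n0 + i))) \<le> 1" using c by (rule order_trans)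
      qed simp
      then show False using assms summable_iff_shift[of "\<lambda>n. a n * J n" "n0 + i"] by simp
    qed
    then obtain N where N: "1 \<le> (\<Sum>n=n0 + i..N. a n * J n)" by blast
    have "1 / 10^10 \<le> measure lebesgue (block_union (n0 + i) N)" by (rule measure_block_union_ge[OF _ N]) simp
    also have "\<dots> \<le> measure lebesgue (B i)"
      using Bl block_union_lmeasurable by (intro measure_mono_fmeasurable) (auto simp: B_def intro: fmeasurableD)
    finally show ?thesis .
  qed
  have dec: "decseq B"
  proof (rule antimonoI)
    fix i i' :: nat assume "i \<le> i'"
    then show "B i' \<subseteq> B i" unfolding B_def block_union_def by (intro UN_mono) auto
  qed
  define L where "L = (\<Inter>i. B i)"
  have lim: "(\<lambda>i. measure lebesgue (B i)) \<longlonglongrightarrow> measure lebesgue L" unfolding L_def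
    using Bs by (intro Lim_measure_decseq dec fmeasurableD2[OF Bl, unfolded infinity_ennreal_def[symmetric]]) auto
  show thesis
  proof (rule that)
    show L01: "L \<subseteq> {0..1}" using sub01 unfolding L_def B_def by blast
    show "L \<in> lmeasurable" by (rule fmeasurableI2[of "{0..1}", OF _ L01]) (use Bs in \<open>auto simp: L_def\<close>)
    show "1 / 10^10 \<le> measure lebesgue L" by (rule LIMSEQ_le_const[OF lim]) (use B_ge in blast)
    fix x assume x: "x \<in> L"
    show "infinite {q. \<exists>n j. q \<in> Q n j \<and> nd (real q * x - \<gamma>) < rad n j}"
      unfolding infinite_nat_iff_unbounded
    proof
      fix i
      from x have "x \<in> B i" by (auto simp: L_def)
      then obtain n j q where q: "n \<ge> n0 + i" "q \<in> Q n j" "x \<in> hit \<gamma> q (rad n j)"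
        by (auto simp: B_def block_union_def)
      have "i \<le> n" using q by simp
      also have "n < 2 ^ n" by (rule less_exp)
      also have "\<dots> \<le> q" using q by (simp add: Q_def)
      finally show "\<exists>q>i. q \<in> {q. \<exists>n j. q \<in> Q n j \<and> nd (real q * x - \<gamma>) < rad n j}"
        using q by (auto simp: hit_def)
    qed
  qed
qed

end

section \<open>From the exponent hypothesis to the blocks\<close>


text \<open>The infimum need not be attained, so an admissible exponent is picked strictly below (C
  + 1) sqrt (log log N). There is room between C and C + 1 because log log N > 0 for N >= 3.\<close>

lemma sigma_exponent_lower_bound:
  assumes sig: "sigma_exponent \<gamma> \<beta> N \<le> ennreal (C * sqrt (log 2 (log 2 (real N))))" and C: "C > 0" and N: "N \<ge> 3"
    and k: "2 \<le> max \<bar>k1\<bar> \<bar>k2\<bar>" "max \<bar>k1\<bar> \<bar>k2\<bar> \<le> int N"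
  shows "of_int (max \<bar>k1\<bar> \<bar>k2\<bar>) powr (- ((C + 1) * sqrt (log 2 (log 2 (real N))))) \<le> nd (of_int k1 * \<gamma> + of_int k2 * \<beta>)"
proof -
  let ?s = "sqrt (log 2 (log 2 (real N)))"
  have "1 < log 2 (real N)" using N by simp
  then have s: "?s > 0" by simp
  have "C * ?s < (C + 1) * ?s" using s by simp
  then have "sigma_exponent \<gamma> \<beta> N < ennreal ((C + 1) * ?s)"
    using sig C s by (intro le_less_trans[OF sig] ennreal_lessI) auto
  then obtain \<sigma> where \<sigma>: "\<sigma> > 0" "ennreal \<sigma> < ennreal ((C + 1) * ?s)"
     "\<forall>k1 k2 :: int. 2 \<le> max \<bar>k1\<bar> \<bar>k2\<bar> \<and> max \<bar>k1\<bar> \<bar>k2\<bar> \<le> int N \<longrightarrow>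
         nd (of_int k1 * \<gamma> + of_int k2 * \<beta>) \<ge> of_int (max \<bar>k1\<bar> \<bar>k2\<bar>) powr (- \<sigma>)"
    unfolding sigma_exponent_def Inf_less_iff by auto
  then have "\<sigma> < (C + 1) * ?s" by (simp add: ennreal_less_iff)
  then have "of_int (max \<bar>k1\<bar> \<bar>k2\<bar>) powr (- ((C + 1) * ?s)) \<le> of_int (max \<bar>k1\<bar> \<bar>k2\<bar>) powr (- \<sigma>)"
    using k(1) by (intro powr_mono) auto
  also have "\<dots> \<le> nd (of_int k1 * \<gamma> + of_int k2 * \<beta>)" using \<sigma>(3) k by blast
  finally show ?thesis .
qed

definition independent_at :: "real \<Rightarrow> real \<Rightarrow> nat \<Rightarrow> nat \<Rightarrow> bool" where
  "independent_at \<gamma> \<beta> n i \<longleftrightarrow> (\<forall>k1 k2 :: int. (k1, k2) \<noteq> (0, 0) \<longrightarrow> \<bar>k1\<bar> \<le> 2 ^ (20 * i) \<longrightarrow> \<bar>k2\<bar> \<le> 2 ^ (20 * i) \<longrightarrow>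
     1 / 2 ^ (n div 10) \<le> nd (of_int k1 * \<gamma> + of_int k2 * \<beta>))"

lemma independent_at_mono: "independent_at \<gamma> \<beta> n i \<Longrightarrow> n \<le> n' \<Longrightarrow> independent_at \<gamma> \<beta> n' i"
proof -
  assume ind: "independent_at \<gamma> \<beta> n i" and n: "n \<le> n'"
  have "1 / 2 ^ (n' div 10) \<le> (1 / 2 ^ (n div 10) :: real)"
    using n by (intro divide_left_mono power_increasing div_le_mono) auto
  then show ?thesis using ind unfolding independent_at_def by (meson order_trans)
qed

lemma independent_at_antimono: "independent_at \<gamma> \<beta> n i \<Longrightarrow> i' \<le> i \<Longrightarrow> independent_at \<gamma> \<beta> n i'"
proof -
  assume ind: "independent_at \<gamma> \<beta> n i" and i: "i' \<le> i"
  have "(2::int) ^ (20 * i') \<le> 2 ^ (20 * i)" using i by (intro power_increasing) auto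
  then show ?thesis using ind unfolding independent_at_def by (meson order_trans)
qed

text \<open>The admissible i form an initial segment, so their number is the largest of them, and 0
  if there is none. Counting makes monotonicity in n immediate, and the cut at n div 1000 builds in
  1000 J n <= n.\<close>

definition range_size :: "real \<Rightarrow> real \<Rightarrow> nat \<Rightarrow> nat" where
  "range_size \<gamma> \<beta> n = card {i \<in> {1..n div 1000}. independent_at \<gamma> \<beta> n i}"

lemma range_size_mono: "mono (range_size \<gamma> \<beta>)"
proof (rule monoI)
  fix n n' :: nat assume "n \<le> n'"
  then show "range_size \<gamma> \<beta> n \<le> range_size \<gamma> \<beta> n'" unfolding range_size_def
    using div_le_mono[of n n' 1000] by (intro card_mono) (auto intro: independent_at_mono)
qed

lemma range_size_le: "1000 * range_size \<gamma> \<beta> n \<le> n"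
proof -
  have "range_size \<gamma> \<beta> n \<le> card {1..n div 1000}" unfolding range_size_def by (intro card_mono) auto
  then show ?thesis by simp
qed

lemma range_size_ge:
  assumes "independent_at \<gamma> \<beta> n i" "i \<le> n div 1000"
  shows "i \<le> range_size \<gamma> \<beta> n"
proof -
  have "card {1..i} \<le> range_size \<gamma> \<beta> n" unfolding range_size_def
    using assms by (intro card_mono) (auto intro: independent_at_antimono)
  then show ?thesis by simp
qed

text \<open>Were the number itself inadmissible, downward closure would place all admissible i
  strictly below it, leaving too few of them.\<close>

lemma independent_at_range_size:
  assumes "range_size \<gamma> \<beta> n \<ge> 1"
  shows "independent_at \<gamma> \<beta> n (range_size \<gamma> \<beta> n)"
proof (rule ccontr)
  assume neg: "\<not> ?thesis"
  let ?A = "{i \<in> {1..n div 1000}. independent_at \<gamma> \<beta> n i}"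
  have "?A \<subseteq> {1..<range_size \<gamma> \<beta> n}"
  proof
    fix i assume "i \<in> ?A"
    then show "i \<in> {1..<range_size \<gamma> \<beta> n}" using neg independent_at_antimono[of \<gamma> \<beta> n i "range_size \<gamma> \<beta> n"]
      by (auto simp: not_le[symmetric])
  qed
  then have "card ?A \<le> card {1..<range_size \<gamma> \<beta> n}" by (intro card_mono) auto
  then show False using assms by (simp add: range_size_def)
qed

text \<open>The condition defining sigma starts at height 2, so the coefficients are doubled; nd
  (2y) <= 2 nd y loses only a factor 2. Passing to M\<beta> multiplies k2 by M <= 2^M and raises the
  height to 2^(20 i + M + 1). In the second assumption on n, the + 1 pays for the factor 2 and the -
  1 for rounding n/10.\<close>

lemma independent_multiple:
  fixes M :: nat and C \<beta> \<gamma> :: real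
  assumes sig: "\<And>q::nat. q \<ge> 3 \<Longrightarrow> sigma_exponent \<gamma> \<beta> q \<le> ennreal (C * sqrt (log 2 (log 2 (real q))))"
    and C: "C > 0" and M: "M \<ge> 1"
    and n: "real (20 * i + M + 1) \<le> real n"
      "(C + 1) * real (20 * i + M + 1) * sqrt (log 2 (real n)) + 1 \<le> real n / 10 - 1"
  shows "independent_at \<gamma> (M * \<beta>) n i"
  unfolding independent_at_def
proof (intro allI impI)
  fix k1 k2 :: int
  assume k: "(k1, k2) \<noteq> (0, 0)" "\<bar>k1\<bar> \<le> 2 ^ (20 * i)" "\<bar>k2\<bar> \<le> 2 ^ (20 * i)"
  define X where "X = 20 * i + M"
  define y where "y = of_int k1 * \<gamma> + of_int k2 * (M * \<beta>)"
  have X: "X \<ge> 1" using M by (simp add: X_def)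
  have M2: "int M \<le> 2 ^ M" using less_exp[of M] by (metis less_imp_le of_nat_le_iff of_nat_numeral of_nat_power)
  have b1: "\<bar>2 * k1\<bar> \<le> 2 ^ (X + 1)"
  proof -
    have "\<bar>2 * k1\<bar> \<le> 2 * 2 ^ (20 * i)" using k by simp
    also have "\<dots> \<le> 2 * 2 ^ X" unfolding X_def by (intro mult_left_mono power_increasing) auto
    finally show ?thesis by simp
  qed
  have b2: "\<bar>2 * (k2 * int M)\<bar> \<le> 2 ^ (X + 1)"
  proof -
    have "\<bar>2 * (k2 * int M)\<bar> = 2 * (\<bar>k2\<bar> * int M)" by (simp add: abs_mult)
    also have "\<dots> \<le> 2 * (2 ^ (20 * i) * 2 ^ M)" using k M2 by (intro mult_left_mono mult_mono) auto
    finally show ?thesis by (simp add: X_def power_add)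
  qed
  let ?K = "max \<bar>2 * k1\<bar> \<bar>2 * (k2 * int M)\<bar>"
  let ?N = "2 ^ (X + 1) :: nat"
  have K2: "2 \<le> ?K"
  proof (cases "k1 = 0")
    case True
    then have "k2 * int M \<noteq> 0" using k(1) M by simp
    then have "1 \<le> \<bar>k2 * int M\<bar>" by linarith
    then show ?thesis by linarith
  next
    case False
    then have "1 \<le> \<bar>k1\<bar>" by linarith
    then show ?thesis by linarith
  qed
  have KN: "?K \<le> int ?N" using b1 b2 by simp
  have N3: "?N \<ge> 3"
  proof -
    have "(2::nat) ^ 2 \<le> ?N" using X by (intro power_increasing) auto
    then show ?thesis by simp
  qed
  let ?s = "sqrt (log 2 (real (X + 1)))"
  have logN: "log 2 (real ?N) = real (X + 1)" unfolding of_nat_power of_nat_numeral by (rule log_pow_cancel) auto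
  have lower: "of_int ?K powr (- ((C + 1) * ?s)) \<le> nd (of_int (2 * k1) * \<gamma> + of_int (2 * (k2 * int M)) * \<beta>)"
    using sigma_exponent_lower_bound[OF sig[OF N3] C N3 K2 KN] unfolding logN by simp
  have s0: "?s \<ge> 0" by simp
  have "2 powr (- ((C + 1) * (X + 1) * ?s)) = real ?N powr (- ((C + 1) * ?s))"
    by (simp add: powr_realpow[symmetric] powr_powr algebra_simps del: power_Suc)
  also have "\<dots> \<le> of_int ?K powr (- ((C + 1) * ?s))"
  proof (rule powr_mono2')
    have "real_of_int ?K \<le> real_of_int (int ?N)" using KN by (simp only: of_int_le_iff)
    then show "real_of_int ?K \<le> real ?N" by simp
    show "0 < real_of_int ?K" using K2 by simp
    show "- ((C + 1) * ?s) \<le> 0" using C s0 by simp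
  qed
  also have "\<dots> \<le> nd (of_int 2 * y)" using lower by (simp add: y_def algebra_simps)
  also have "\<dots> \<le> 2 * nd y" using nd_mult_int_le[of 2 y] by simp
  finally have low: "2 powr (- ((C + 1) * (X + 1) * ?s)) / 2 \<le> nd y" by simp
  have "1 / 2 ^ (n div 10) = 2 powr (- real (n div 10))" by (simp add: powr_minus powr_realpow field_simps)
  also have "\<dots> \<le> 2 powr (- ((C + 1) * (X + 1) * ?s) - 1)"
  proof (rule powr_mono)
    have "log 2 (real (X + 1)) \<le> log 2 (real n)" using n(1) by (simp add: X_def)
    then have "?s \<le> sqrt (log 2 (real n))" by simp
    then have "(C + 1) * (X + 1) * ?s \<le> (C + 1) * (X + 1) * sqrt (log 2 (real n))"
      using C by (intro mult_left_mono) auto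
    also have "\<dots> = (C + 1) * real (20 * i + M + 1) * sqrt (log 2 (real n))" by (simp add: X_def)
    finally have "(C + 1) * (X + 1) * ?s + 1 \<le> real n / 10 - 1" using n(2) by linarith
    moreover have "real n / 10 - 1 \<le> real (n div 10)" by linarith
    ultimately show "- real (n div 10) \<le> - ((C + 1) * (X + 1) * ?s) - 1" by linarith
  qed simp
  also have "\<dots> = 2 powr (- ((C + 1) * (X + 1) * ?s)) / 2" by (simp add: powr_diff)
  also have "\<dots> \<le> nd y" by (rule low)
  finally show "1 / 2 ^ (n div 10) \<le> nd (of_int k1 * \<gamma> + of_int k2 * (real M * \<beta>))" by (simp add: y_def)
qed

lemma eventually_range_size_ge:
  fixes M :: nat and C \<beta> \<gamma> :: real
  assumes sig: "\<And>q::nat. q \<ge> 3 \<Longrightarrow> sigma_exponent \<gamma> \<beta> q \<le> ennreal (C * sqrt (log 2 (log 2 (real q))))"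
    and C: "C > 0" and M: "M \<ge> 1"
  obtains \<epsilon> where "\<epsilon> > 0" "\<forall>\<^sub>F n in sequentially. \<epsilon> * (real n / sqrt (log 2 (real n))) \<le> range_size \<gamma> (M * \<beta>) n"
proof -
  \<comment> \<open>For i about e n / sqrt (log n) the main cost (C + 1) 20 i sqrt (log n) is at
    most n/50, which leaves room below n/10; e <= 1/1000 serves the cut i <= n div 1000.\<close>
  define e where "e = 1 / (1000 * (C + 1))"
  have e: "e > 0" "e * (C + 1) = 1 / 1000" "e \<le> 1 / 1000" using C by (simp_all add: e_def field_simps)
  define i where "i n = nat \<lfloor>e * (real n / sqrt (log 2 (real n)))\<rfloor>" for n :: nat
  have "\<forall>\<^sub>F n in sequentially. 20 * (1 / 1000 * (real n / sqrt (log 2 (real n)))) + real M + 1 \<le> real n" by real_asymp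
  moreover have "\<forall>\<^sub>F n in sequentially. (C + 1) * (real M + 1) * sqrt (log 2 (real n)) + 20 / 1000 * real n + 1 \<le> real n / 10 - 1"
    using C by real_asymp
  moreover have "\<forall>\<^sub>F n in sequentially. 1 / 1000 * (real n / sqrt (log 2 (real n))) \<le> real n / 1000 - 1" by real_asymp
  moreover have "\<forall>\<^sub>F n in sequentially. e / 2 * (real n / sqrt (log 2 (real n))) \<le> e * (real n / sqrt (log 2 (real n))) - 1"
    using e(1) by real_asymp
  moreover have "\<forall>\<^sub>F n in sequentially. 0 < sqrt (log 2 (real n))" by real_asymp
  ultimately have "\<forall>\<^sub>F n in sequentially. e / 2 * (real n / sqrt (log 2 (real n))) \<le> range_size \<gamma> (M * \<beta>) n"
  proof eventually_elim
    case (elim n)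
    let ?s = "sqrt (log 2 (real n))"
    let ?r = "real n / ?s"
    have r0: "0 \<le> ?r" using elim(5) by simp
    have er: "e * ?r \<le> 1 / 1000 * ?r" using e(3) r0 by (intro mult_right_mono) auto
    have "0 \<le> e * ?r" using e(1) r0 by (intro mult_nonneg_nonneg) auto
    then have i: "real (i n) \<le> e * ?r" "e * ?r - 1 \<le> real (i n)" unfolding i_def by linarith+
    have "independent_at \<gamma> (M * \<beta>) n (i n)"
    proof (rule independent_multiple[OF sig C M])
      show "real (20 * i n + M + 1) \<le> real n" using elim(1) i(1) er by simp
      have "(C + 1) * (20 * real (i n)) * ?s \<le> (C + 1) * (20 * (e * ?r)) * ?s"
        using C i(1) elim(5) by (intro mult_right_mono mult_left_mono) auto
      also have "\<dots> = 20 * (e * (C + 1)) * (?r * ?s)" by simp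
      also have "\<dots> = 20 / 1000 * real n" using elim(5) by (simp add: e(2))
      finally have "(C + 1) * (20 * real (i n)) * ?s \<le> 20 / 1000 * real n" .
      then show "(C + 1) * real (20 * i n + M + 1) * ?s + 1 \<le> real n / 10 - 1"
        using elim(2) by (simp add: algebra_simps)
    qed
    moreover have "i n \<le> n div 1000"
    proof -
      have "real (i n) \<le> real n / 1000 - 1" using i(1) er elim(3) by linarith
      then show ?thesis by linarith
    qed
    ultimately have "i n \<le> range_size \<gamma> (M * \<beta>) n" by (rule range_size_ge)
    then have "real (i n) \<le> real (range_size \<gamma> (M * \<beta>) n)" by simp
    then show ?case using elim(4) i(2) by linarith
  qed
  then show thesis using e(1) by (intro that[of "e / 2"]) auto
qed


section \<open>Dyadic condensation and localisation at scale 1/M\<close>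

lemma W_lmeasurable: "W \<psi> \<beta> \<gamma> \<gamma>' \<in> lmeasurable"
proof -
  let ?P = "\<lambda>q x. nd (real q * x - \<gamma>) * nd (real q * \<beta> - \<gamma>') < \<psi> q"
  have "W \<psi> \<beta> \<gamma> \<gamma>' = {0..1} \<inter> (\<Inter>m. \<Union>q\<in>{q. m < q \<and> 1 \<le> q}. {x. ?P q x})"
    unfolding W_def infinite_nat_iff_unbounded by auto
  moreover have "{x. ?P q x} \<in> sets lebesgue" for q
  proof -
    have "open {x. ?P q x}" by (intro open_Collect_less continuous_intros)
    then show ?thesis by auto
  qed
  then have "(\<Inter>m. \<Union>q\<in>{q. m < q \<and> 1 \<le> q}. {x. ?P q x}) \<in> sets lebesgue" by auto
  ultimately show ?thesis using fmeasurable_Int_fmeasurable[of "{0..1}" lebesgue] by auto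
qed

lemma W_subset: "W \<psi> \<beta> \<gamma> \<gamma>' \<subseteq> {0..1}"
  by (auto simp: W_def)

text \<open>Cauchy condensation along the points M 2^n; for n >= M + 2 the logarithm of q lies
  between n and 2n in the block, so the weight is at most twice its model in n. The truncation at 1
  is harmless: terms of a summable series are eventually below 1, whereas J n >= 1 would make a
  truncated term at least 1.\<close>

lemma not_summable_blocks:
  fixes \<psi> :: "nat \<Rightarrow> real" and J :: "nat \<Rightarrow> nat" and M :: nat
  assumes pos: "\<And>q. 1 \<le> q \<Longrightarrow> \<psi> q > 0" and anti: "antimono_on {1..} \<psi>"
    and div: "filterlim (\<lambda>N. \<Sum>q=3..N. \<psi> q * (log 2 (real q) / sqrt (log 2 (log 2 (real q))))) at_top sequentially"
    and M: "M \<ge> 1" and \<epsilon>: "\<epsilon> > 0" and J: "\<forall>\<^sub>F n in sequentially. \<epsilon> * (real n / sqrt (log 2 (real n))) \<le> J n"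
  shows "\<not> summable (\<lambda>n. min 1 (2 ^ n * \<psi> (M * 2 ^ (n + 1))) * real (J n))"
proof
  assume sum: "summable (\<lambda>n. min 1 (2 ^ n * \<psi> (M * 2 ^ (n + 1))) * real (J n))"
  let ?f = "\<lambda>q. \<psi> q * (log 2 (real q) / sqrt (log 2 (log 2 (real q))))"
  let ?R = "\<lambda>n. real n / sqrt (log 2 (real n))"
  define d where "d n = 2 ^ n * \<psi> (M * 2 ^ (n + 1)) * ?R n" for n
  have \<psi>0: "0 < \<psi> (M * 2 ^ n)" for n using M by (intro pos) simp
  have "\<forall>\<^sub>F n in sequentially. 1 \<le> \<epsilon> * ?R n" using \<epsilon> by real_asymp
  moreover have "\<forall>\<^sub>F n in sequentially. real M + 2 \<le> real n" by real_asymp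
  moreover have "\<forall>\<^sub>F n in sequentially. 2 < real n" by real_asymp
  moreover have "\<forall>\<^sub>F n in sequentially. min 1 (2 ^ n * \<psi> (M * 2 ^ (n + 1))) * real (J n) < 1"
    using summable_LIMSEQ_zero[OF sum] by (rule order_tendstoD) simp
  ultimately have "\<forall>\<^sub>F n in sequentially. real M + 2 \<le> real n \<and> 2 < real n \<and>
      d n \<le> 1 / \<epsilon> * (min 1 (2 ^ n * \<psi> (M * 2 ^ (n + 1))) * real (J n))"
    using J
  proof eventually_elim
    case (elim n)
    have J1: "1 \<le> real (J n)" using elim by linarith
    have "min 1 (2 ^ n * \<psi> (M * 2 ^ (n + 1))) < 1"
    proof (rule ccontr)
      assume "\<not> ?thesis"
      then have "1 * 1 \<le> min 1 (2 ^ n * \<psi> (M * 2 ^ (n + 1))) * real (J n)" using J1 by (intro mult_mono) auto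
      then show False using elim by simp
    qed
    then have m: "min 1 (2 ^ n * \<psi> (M * 2 ^ (n + 1))) = 2 ^ n * \<psi> (M * 2 ^ (n + 1))" by linarith
    have "\<epsilon> * d n = 2 ^ n * \<psi> (M * 2 ^ (n + 1)) * (\<epsilon> * ?R n)" by (simp add: d_def)
    also have "\<dots> \<le> 2 ^ n * \<psi> (M * 2 ^ (n + 1)) * real (J n)"
      using \<psi>0[of "n + 1"] elim by (intro mult_left_mono) auto
    finally show ?case using elim \<epsilon> m by (simp add: field_simps)
  qed
  then obtain n1 where n1: "\<And>n. n \<ge> n1 \<Longrightarrow> real M + 2 \<le> real n \<and> 2 < real n \<and>
      d n \<le> 1 / \<epsilon> * (min 1 (2 ^ n * \<psi> (M * 2 ^ (n + 1))) * real (J n))"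
    unfolding eventually_sequentially by blast
  have d0: "0 \<le> d n" if "n \<ge> n1" for n
    using \<psi>0[of "n + 1"] n1[OF that] by (auto simp: d_def intro!: mult_nonneg_nonneg divide_nonneg_nonneg)
  have "summable (\<lambda>n. 1 / \<epsilon> * (min 1 (2 ^ n * \<psi> (M * 2 ^ (n + 1))) * real (J n)))" by (rule summable_mult[OF sum])
  then have sumd: "summable d"
    by (rule summable_comparison_test'[where N = n1]) (use n1 d0 in \<open>auto simp: abs_of_nonneg\<close>)
  have block: "(\<Sum>q\<in>{M * 2 ^ (n + 1)..<M * 2 ^ (n + 2)}. ?f q) \<le> 4 * M * d n" if n: "n \<ge> n1" for n
  proof -
    have n': "real M + 2 \<le> real n" "2 < real n" using n1[OF n] by auto
    have "?f q \<le> \<psi> (M * 2 ^ (n + 1)) * (2 * ?R n)" if q: "q \<in> {M * 2 ^ (n + 1)..<M * 2 ^ (n + 2)}" for q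
    proof -
      have Mn: "M * 2 ^ (n + 1) \<ge> 1" using M by simp
      have q1: "1 \<le> q" using q Mn by (meson atLeastLessThan_iff order_trans)
      have "\<psi> q \<le> \<psi> (M * 2 ^ (n + 1))" using q Mn q1 by (intro monotone_onD[OF anti]) auto
      have "2 ^ (n + 1) \<le> M * 2 ^ (n + 1)" using M by simp
      also have "\<dots> \<le> q" using q by (simp only: atLeastLessThan_iff)
      finally have "2 ^ (n + 1) \<le> q" .
      then have "real (2 ^ (n + 1)) \<le> real q" by (simp only: of_nat_le_iff)
      then have "log 2 (2 ^ (n + 1)) \<le> log 2 (real q)" using q1 by (subst log_le_cancel_iff) auto
      moreover have "log 2 (2 ^ (n + 1)) = real (n + 1)" by (rule log_pow_cancel) auto
      ultimately have lower: "real n \<le> log 2 (real q)" by simp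
      have "q \<le> M * 2 ^ (n + 2)" using q by (simp only: atLeastLessThan_iff less_imp_le)
      also have "\<dots> \<le> 2 ^ M * 2 ^ (n + 2)" using less_exp[of M] by (intro mult_right_mono) auto
      also have "\<dots> = 2 ^ (M + n + 2)" by (simp add: power_add)
      finally have "q \<le> 2 ^ (M + n + 2)" .
      then have "real q \<le> real (2 ^ (M + n + 2))" by (simp only: of_nat_le_iff)
      then have "log 2 (real q) \<le> log 2 (2 ^ (M + n + 2))" using q1 by (subst log_le_cancel_iff) auto
      also have "\<dots> = real (M + n + 2)" by (rule log_pow_cancel) auto
      finally have upper: "log 2 (real q) \<le> 2 * real n" using n' by simp
      have l: "log 2 (real n) \<le> log 2 (log 2 (real q))" using lower n' by simp
      have "0 < log 2 (real n)" using n' by simp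
      then have "log 2 (real q) / sqrt (log 2 (log 2 (real q))) \<le> 2 * real n / sqrt (log 2 (real n))"
        using l upper n' by (intro frac_le) auto
      then have "?f q \<le> \<psi> (M * 2 ^ (n + 1)) * (2 * real n / sqrt (log 2 (real n)))"
        using \<open>\<psi> q \<le> _\<close> \<psi>0[of "n + 1"] lower n' l \<open>0 < log 2 (real n)\<close>
        by (intro mult_mono) (auto intro!: divide_nonneg_nonneg)
      then show ?thesis by simp
    qed
    then have "(\<Sum>q\<in>{M * 2 ^ (n + 1)..<M * 2 ^ (n + 2)}. ?f q) \<le> (\<Sum>q\<in>{M * 2 ^ (n + 1)..<M * 2 ^ (n + 2)}. \<psi> (M * 2 ^ (n + 1)) * (2 * ?R n))"
      by (rule sum_mono)
    also have "\<dots> = 4 * M * d n" by (simp add: d_def)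
    finally show ?thesis .
  qed
  have partial: "(\<Sum>q\<in>{M * 2 ^ (n1 + 1)..<M * 2 ^ (n1 + K + 1)}. ?f q) \<le> 4 * M * (\<Sum>n\<in>{n1..<n1 + K}. d n)" for K
  proof (induction K)
    case (Suc K)
    have "{M * 2 ^ (n1 + 1)..<M * 2 ^ (n1 + Suc K + 1)} =
       {M * 2 ^ (n1 + 1)..<M * 2 ^ (n1 + K + 1)} \<union> {M * 2 ^ (n1 + K + 1)..<M * 2 ^ (n1 + K + 2)}"
      by (subst ivl_disj_un_two(3)) (auto intro!: power_increasing)
    then have "(\<Sum>q\<in>{M * 2 ^ (n1 + 1)..<M * 2 ^ (n1 + Suc K + 1)}. ?f q) =
       (\<Sum>q\<in>{M * 2 ^ (n1 + 1)..<M * 2 ^ (n1 + K + 1)}. ?f q) + (\<Sum>q\<in>{M * 2 ^ (n1 + K + 1)..<M * 2 ^ (n1 + K + 2)}. ?f q)"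
      by (simp add: sum.union_disjoint ivl_disj_int_two(3) del: power_Suc)
    also have "\<dots> \<le> 4 * M * (\<Sum>n\<in>{n1..<n1 + K}. d n) + 4 * M * d (n1 + K)"
      using Suc block[of "n1 + K"] by (intro add_mono) auto
    also have "\<dots> = 4 * M * (\<Sum>n\<in>{n1..<n1 + Suc K}. d n)" by (simp add: distrib_left)
    finally show ?case .
  qed simp
  define B0 where "B0 = (\<Sum>q\<in>{3..<M * 2 ^ (n1 + 1)}. ?f q)"
  define B1 where "B1 = 4 * M * (suminf (\<lambda>n. d (n + n1)))"
  have f0: "0 \<le> ?f q" if "q \<ge> 3" for q
  proof -
    have "1 < log 2 (real q)" using that by simp
    then show ?thesis using pos[of q] that by (intro mult_nonneg_nonneg divide_nonneg_nonneg) auto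
  qed
  have bound: "(\<Sum>q=3..N. ?f q) \<le> B0 + B1" for N
  proof -
    have "N < 2 ^ N" by (rule less_exp)
    also have "\<dots> \<le> 2 ^ (n1 + N + 1)" by (intro power_increasing) auto
    also have "\<dots> \<le> M * 2 ^ (n1 + N + 1)" using M by simp
    finally have N: "N < M * 2 ^ (n1 + N + 1)" .
    have "(\<Sum>q=3..N. ?f q) \<le> (\<Sum>q\<in>{3..<M * 2 ^ (n1 + 1)} \<union> {M * 2 ^ (n1 + 1)..<M * 2 ^ (n1 + N + 1)}. ?f q)"
    proof (rule sum_mono2)
      show "{3..N} \<subseteq> {3..<M * 2 ^ (n1 + 1)} \<union> {M * 2 ^ (n1 + 1)..<M * 2 ^ (n1 + N + 1)}" using N by auto
      fix q assume q: "q \<in> {3..<M * 2 ^ (n1 + 1)} \<union> {M * 2 ^ (n1 + 1)..<M * 2 ^ (n1 + N + 1)} - {3..N}"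
      have "2 ^ 2 \<le> (2::nat) ^ (n1 + 1)" using n1[of n1] by (intro power_increasing) auto
      also have "\<dots> \<le> M * 2 ^ (n1 + 1)" using M by simp
      finally show "0 \<le> ?f q" using q by (intro f0) auto
    qed auto
    also have "\<dots> = B0 + (\<Sum>q\<in>{M * 2 ^ (n1 + 1)..<M * 2 ^ (n1 + N + 1)}. ?f q)"
      unfolding B0_def by (rule sum.union_disjoint) auto
    also have "\<dots> \<le> B0 + 4 * M * (\<Sum>n\<in>{n1..<n1 + N}. d n)" by (intro add_left_mono partial)
    also have "(\<Sum>n\<in>{n1..<n1 + N}. d n) = (\<Sum>n<N. d (n + n1))"
      using sum.shift_bounds_nat_ivl[of d 0 n1 N] by (simp add: atLeast0LessThan add.commute)
    also have "\<dots> \<le> suminf (\<lambda>n. d (n + n1))"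
      using d0 sumd by (intro sum_le_suminf) (auto simp: summable_iff_shift)
    finally show ?thesis by (simp add: B1_def mult_left_mono)
  qed
  have "\<forall>\<^sub>F N in sequentially. B0 + B1 < (\<Sum>q=3..N. ?f q)" using div by (simp add: filterlim_at_top_dense)
  then obtain N where "B0 + B1 < (\<Sum>q=3..N. ?f q)" by (meson eventually_sequentially le_refl)
  with bound[of N] show False by simp
qed

text \<open>The same 10^(-10) for every M is the point: replacing \<beta> by M\<beta> and \<psi> by
  \<psi>(M q) affects the size of J, the radii and the starting block, but not the constant.\<close>

lemma exists_large_multiple_limsup:
  fixes \<psi> :: "nat \<Rightarrow> real" and M :: nat and \<beta> \<gamma> \<gamma>' C :: real
  assumes pos: "\<And>q. 1 \<le> q \<Longrightarrow> \<psi> q > 0" and anti: "antimono_on {1..} \<psi>"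
    and div: "filterlim (\<lambda>N. \<Sum>q=3..N. \<psi> q * (log 2 (real q) / sqrt (log 2 (log 2 (real q))))) at_top sequentially"
    and sig: "\<And>q::nat. q \<ge> 3 \<Longrightarrow> sigma_exponent \<gamma> \<beta> q \<le> ennreal (C * sqrt (log 2 (log 2 (real q))))"
    and C: "C > 0" and M: "M \<ge> 1"
  obtains L where "L \<in> lmeasurable" "L \<subseteq> {0..1}" "1 / 10^10 \<le> measure lebesgue L"
    "\<And>x. x \<in> L \<Longrightarrow> infinite {q::nat. 1 \<le> q \<and> nd (real q * x - \<gamma>) * nd (real q * (real M * \<beta>) - \<gamma>') < \<psi> (M * q)}"
proof -
  obtain \<epsilon> where \<epsilon>: "\<epsilon> > 0" "\<forall>\<^sub>F n in sequentially. \<epsilon> * (real n / sqrt (log 2 (real n))) \<le> range_size \<gamma> (M * \<beta>) n"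
    by (rule eventually_range_size_ge[OF sig C M])
  define J where "J = range_size \<gamma> (M * \<beta>)"
  define a where "a n = min 1 (2 ^ n * \<psi> (M * 2 ^ (n + 1)))" for n
  have \<psi>0: "0 < \<psi> (M * 2 ^ n)" for n using M by (intro pos) simp
  \<comment> \<open>The term 7 log n yields n^7 <= 2^(J n); the + 1 gives J n >= 1, the hypothesis
    of \<open>independent_at_range_size\<close>.\<close>
  have "\<forall>\<^sub>F n in sequentially. 7 * log 2 (real n) + 1 \<le> \<epsilon> * (real n / sqrt (log 2 (real n)))"
    using \<epsilon>(1) by real_asymp
  moreover have "\<forall>\<^sub>F n in sequentially. 1 \<le> real n" by real_asymp
  ultimately have "\<forall>\<^sub>F n in sequentially. 1 \<le> J n \<and> n ^ 7 \<le> 2 ^ J n"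
    using \<epsilon>(2)
  proof eventually_elim
    case (elim n)
    have l0: "0 \<le> log 2 (real n)" using elim(2) by simp
    have J: "7 * log 2 (real n) + 1 \<le> real (J n)" using elim by (simp add: J_def)
    have "real n ^ 7 = 2 powr (7 * log 2 (real n))"
      using elim(2) by (simp add: powr_powr[symmetric] mult.commute[of 7] powr_numeral)
    also have "\<dots> \<le> 2 powr (real (J n))" using J by (intro powr_mono) auto
    also have "\<dots> = 2 ^ J n" by (simp add: powr_realpow)
    finally have "real (n ^ 7) \<le> real (2 ^ J n)" by simp
    then have "n ^ 7 \<le> 2 ^ J n" by (simp only: of_nat_le_iff)
    moreover have "1 \<le> J n" using J l0 by linarith
    ultimately show ?case by simp
  qed
  then obtain n1 where n1: "\<And>n. n \<ge> n1 \<Longrightarrow> 1 \<le> J n \<and> n ^ 7 \<le> 2 ^ J n" unfolding eventually_sequentially by blast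
  interpret bohr_blocks "M * \<beta>" \<gamma> \<gamma>' J a "max 2 n1"
  proof
    show "mono J" unfolding J_def by (rule range_size_mono)
    show "1000 * J n \<le> n" for n unfolding J_def by (rule range_size_le)
    show "0 < a n" "a n \<le> 1" for n using \<psi>0[of "n + 1"] by (auto simp: a_def)
    show "2 \<le> max 2 n1" by simp
    show "n ^ 7 \<le> 2 ^ J n" if "max 2 n1 \<le> n" for n using n1[of n] that by simp
    fix n and k1 k2 :: int
    assume n: "max 2 n1 \<le> n" and k: "(k1, k2) \<noteq> (0, 0)" "\<bar>k1\<bar> \<le> 2 ^ (20 * J n)" "\<bar>k2\<bar> \<le> 2 ^ (20 * J n)"
    have "independent_at \<gamma> (M * \<beta>) n (J n)"
      unfolding J_def by (rule independent_at_range_size) (use n1[of n] n in \<open>simp add: J_def\<close>)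
    then show "1 / 2 ^ (n div 10) \<le> nd (of_int k1 * \<gamma> + of_int k2 * (M * \<beta>))"
      using k by (simp add: independent_at_def)
  qed
  have "\<not> summable (\<lambda>n. a n * real (J n))"
    unfolding a_def by (rule not_summable_blocks[OF pos anti div M \<epsilon>(1)]) (use \<epsilon>(2) in \<open>simp_all add: J_def\<close>)
  then obtain L where L: "L \<in> lmeasurable" "L \<subseteq> {0..1}" "1 / 10^10 \<le> measure lebesgue L"
    "\<And>x. x \<in> L \<Longrightarrow> infinite {q. \<exists>n j. q \<in> Q n j \<and> nd (real q * x - \<gamma>) < rad n j}"
    by (rule measure_limsup_ge) blast
  show thesis
  proof (rule that[OF L(1-3)])
    fix x assume x: "x \<in> L"
    have "{q. \<exists>n j. q \<in> Q n j \<and> nd (real q * x - \<gamma>) < rad n j}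
      \<subseteq> {q. 1 \<le> q \<and> nd (real q * x - \<gamma>) * nd (real q * (real M * \<beta>) - \<gamma>') < \<psi> (M * q)}"
    proof
      fix q assume "q \<in> {q. \<exists>n j. q \<in> Q n j \<and> nd (real q * x - \<gamma>) < rad n j}"
      then obtain n j where q: "q \<in> Q n j" "nd (real q * x - \<gamma>) < rad n j" by blast
      let ?y = "nd (real q * (real M * \<beta>) - \<gamma>')"
      have y: "1 / 2 ^ (j + 1) < ?y" "?y \<le> 1 / 2 ^ j" using q(1) by (simp_all add: Q_def)
      have "0 < (1::real) / 2 ^ (j + 1)" by simp
      then have y0: "0 < ?y" using y(1) by linarith
      have qn: "2 ^ n \<le> q" "q \<le> 2 ^ (n + 1)" using q(1) by (simp_all add: Q_def)
      have q1: "1 \<le> q" using qn(1) by (meson one_le_numeral one_le_power order_trans)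
      \<comment> \<open>The factor 2^j in \<open>rad\<close> cancels the class bound ?y <= 2^(-j).
        The remaining a n / 2^n is at most \<psi> at M 2^(n+1), the right end of the block scaled by
        M, where the antimonotone \<psi> is smallest.\<close>
      have "nd (real q * x - \<gamma>) * ?y < rad n j * ?y" using q(2) y0 by (rule mult_strict_right_mono)
      also have "\<dots> \<le> rad n j * (1 / 2 ^ j)" using y(2) by (intro mult_left_mono) auto
      also have "\<dots> = a n / 2 ^ n" by (simp add: rad_def)
      also have "\<dots> \<le> (2 ^ n * \<psi> (M * 2 ^ (n + 1))) / 2 ^ n" by (intro divide_right_mono) (auto simp: a_def)
      also have "\<dots> = \<psi> (M * 2 ^ (n + 1))" by simp
      also have "\<dots> \<le> \<psi> (M * q)"
        using M q1 qn(2) by (intro monotone_onD[OF anti]) (auto simp: Suc_le_eq simp del: power_Suc)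
      finally show "q \<in> {q. 1 \<le> q \<and> nd (real q * x - \<gamma>) * nd (real q * (real M * \<beta>) - \<gamma>') < \<psi> (M * q)}"
        using q1 by simp
    qed
    then show "infinite {q. 1 \<le> q \<and> nd (real q * x - \<gamma>) * nd (real q * (real M * \<beta>) - \<gamma>') < \<psi> (M * q)}"
      using L(4)[OF x] finite_subset by blast
  qed
qed

lemma full_measure_antimono:
  fixes \<psi> :: "nat \<Rightarrow> real" and \<beta> \<gamma> \<gamma>' C :: real
  assumes pos: "\<And>q. 1 \<le> q \<Longrightarrow> \<psi> q > 0" and anti: "antimono_on {1..} \<psi>"
    and div: "filterlim (\<lambda>N. \<Sum>q=3..N. \<psi> q * (log 2 (real q) / sqrt (log 2 (log 2 (real q))))) at_top sequentially"
    and sig: "\<And>q::nat. q \<ge> 3 \<Longrightarrow> sigma_exponent \<gamma> \<beta> q \<le> ennreal (C * sqrt (log 2 (log 2 (real q))))"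
    and C: "C > 0"
  shows "measure lebesgue (W \<psi> \<beta> \<gamma> \<gamma>') = 1"
proof -
  let ?W = "W \<psi> \<beta> \<gamma> \<gamma>'"
  define F where "F = {0..1} - ?W"
  have Fs: "F \<in> sets lebesgue" unfolding F_def using W_lmeasurable by (auto intro: fmeasurableD)
  have "measure lebesgue F = 0"
  proof (rule measure_zero_if_uniformly_sparse[OF Fs])
    show "F \<subseteq> {0..1}" by (auto simp: F_def)
    show "0 \<le> 1 - 1 / (10 ^ 10 :: real)" "1 - 1 / 10 ^ 10 < (1::real)" by simp_all
    fix M v :: nat assume M: "1 \<le> M" and v: "v < M"
    obtain L where L: "L \<in> lmeasurable" "L \<subseteq> {0..1}" "1 / 10^10 \<le> measure lebesgue L"
      "\<And>x. x \<in> L \<Longrightarrow> infinite {q::nat. 1 \<le> q \<and> nd (real q * x - \<gamma>) * nd (real q * (real M * \<beta>) - \<gamma>') < \<psi> (M * q)}"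
      by (rule exists_large_multiple_limsup[OF pos anti div sig C M, where \<gamma>' = \<gamma>']) auto
    define E where "E = F \<inter> {real v / real M..(real v + 1) / real M}"
    have El: "E \<in> lmeasurable" unfolding E_def using fmeasurable_Int_fmeasurable[of "{real v / real M..(real v + 1) / real M}" lebesgue F] Fs
      by (simp add: Int_commute)
    \<comment> \<open>The map y = M x - v blows the cell up to [0, 1]. For q' = M q the shift q v is
      an integer, so y in L would put x into W, against x in F.\<close>
    have sub: "(\<lambda>x. real M *\<^sub>R x + (- real v)) ` E \<subseteq> {0..1} - L"
    proof
      fix y assume "y \<in> (\<lambda>x. real M *\<^sub>R x + (- real v)) ` E"
      then obtain x where "x \<in> E" "y = real M * x - real v" by auto
      then have x: "x \<in> F" "real v / M \<le> x" "x \<le> (real v + 1) / M" "y = real M * x - real v"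
        by (auto simp: E_def)
      have y: "0 \<le> y" "y \<le> 1" using x(2-4) M by (simp_all add: field_simps)
      have "y \<notin> L"
      proof
        assume "y \<in> L"
        let ?S = "{q::nat. 1 \<le> q \<and> nd (real q * y - \<gamma>) * nd (real q * (real M * \<beta>) - \<gamma>') < \<psi> (M * q)}"
        have "(\<lambda>q. M * q) ` ?S \<subseteq> {q. 1 \<le> q \<and> nd (real q * x - \<gamma>) * nd (real q * \<beta> - \<gamma>') < \<psi> q}"
        proof
          fix q' assume "q' \<in> (\<lambda>q. M * q) ` ?S"
          then obtain q where q: "q' = M * q" "1 \<le> q" "nd (real q * y - \<gamma>) * nd (real q * (real M * \<beta>) - \<gamma>') < \<psi> (M * q)" by auto
          have "real q' * x - \<gamma> = (q * y - \<gamma>) + of_int (int (q * v))" by (simp add: q(1) x(4) algebra_simps)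
          then have 1: "nd (real q' * x - \<gamma>) = nd (real q * y - \<gamma>)" by (simp only: nd_add_int)
          have 2: "real q' * \<beta> - \<gamma>' = q * (M * \<beta>) - \<gamma>'" by (simp add: q(1))
          have "nd (real q' * x - \<gamma>) * nd (real q' * \<beta> - \<gamma>') < \<psi> q'"
            unfolding 1 2 using q(3) by (simp only: q(1))
          moreover have "1 \<le> q'" using q M by simp
          ultimately show "q' \<in> {q. 1 \<le> q \<and> nd (real q * x - \<gamma>) * nd (real q * \<beta> - \<gamma>') < \<psi> q}"
            by blast
        qed
        moreover have "infinite ((\<lambda>q. M * q) ` ?S)"
          using L(4)[OF \<open>y \<in> L\<close>] M by (subst finite_image_iff) (auto simp: inj_on_def)
        ultimately have "infinite {q. 1 \<le> q \<and> nd (real q * x - \<gamma>) * nd (real q * \<beta> - \<gamma>') < \<psi> q}"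
          using finite_subset by blast
        then show False using x(1) by (auto simp: F_def W_def)
      qed
      then show "y \<in> {0..1} - L" using y by simp
    qed
    have "emeasure lebesgue ((\<lambda>x. real M *\<^sub>R x + (- real v)) ` E) \<le> emeasure lebesgue ({0..1} - L)"
      using sub L(1) by (intro emeasure_mono) (auto intro: fmeasurableD)
    also have "\<dots> = ennreal (measure lebesgue ({0..1} - L))"
      using L(1) by (intro emeasure_eq_measure2 fmeasurable.Diff) auto
    also have "measure lebesgue ({0..1} - L) = 1 - measure lebesgue L"
      using L(1,2) by (subst measurable_measure_Diff) (auto intro: fmeasurableD)
    finally have "ennreal (real M * measure lebesgue E) \<le> ennreal (1 - measure lebesgue L)"
      unfolding emeasure_lebesgue_affine using El by (simp add: emeasure_eq_measure2 ennreal_mult'')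
    moreover have "measure lebesgue L \<le> measure lebesgue {0..1::real}"
      using L(1,2) by (intro measure_mono_fmeasurable) (auto intro: fmeasurableD)
    ultimately have "real M * measure lebesgue E \<le> 1 - measure lebesgue L" by (subst (asm) ennreal_le_iff) auto
    also have "\<dots> \<le> 1 - 1 / 10 ^ 10" using L(3) by simp
    finally have "measure lebesgue E * real M \<le> 1 - 1 / 10 ^ 10" by (simp only: mult.commute)
    then show "measure lebesgue (F \<inter> {real v / real M..(real v + 1) / real M}) \<le> (1 - 1 / 10 ^ 10) / M"
      unfolding E_def[symmetric] using M by (subst pos_le_divide_eq) auto
  qed
  moreover have "measure lebesgue F = measure lebesgue {0..1::real} - measure lebesgue ?W"
    unfolding F_def using W_subset W_lmeasurable by (intro measurable_measure_Diff) (auto intro: fmeasurableD)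
  ultimately show ?thesis by simp
qed

theorem theorem1p11:
  fixes \<psi> :: "nat \<Rightarrow> real" and \<beta> \<gamma> \<gamma>' :: real
  assumes "\<And>q. 1 \<le> q \<Longrightarrow> \<psi> q > 0"
    and "mono_on {1..} \<psi> \<or> antimono_on {1..} \<psi>"
    and "filterlim (\<lambda>N. \<Sum>q=3..N. \<psi> q * (log 2 (real q) / sqrt (log 2 (log 2 (real q)))))
           at_top sequentially"
    and "\<gamma> \<notin> \<rat>" and "\<beta> \<notin> \<rat>"
    and "\<exists>C::real. C > 0 \<and>
           (\<forall>q::nat. q \<ge> 3 \<longrightarrow> sigma_exponent \<gamma> \<beta> q \<le> ennreal (C * sqrt (log 2 (log 2 (real q)))))"
  shows "emeasure lebesgue (W \<psi> \<beta> \<gamma> \<gamma>') = 1"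
proof -
  obtain C where C: "C > 0" "\<And>q::nat. q \<ge> 3 \<Longrightarrow> sigma_exponent \<gamma> \<beta> q \<le> ennreal (C * sqrt (log 2 (log 2 (real q))))"
    using assms(6) by blast
  have "measure lebesgue (W \<psi> \<beta> \<gamma> \<gamma>') = 1"
    using assms(2)
  proof
    assume "antimono_on {1..} \<psi>"
    then show ?thesis using full_measure_antimono[OF assms(1) _ assms(3) C(2,1)] by blast
  next
    assume mono: "mono_on {1..} \<psi>"
    \<comment> \<open>A nondecreasing \<psi> dominates the constant \<psi> 1 > 0, which is
      antimonotone. Its series diverges because every weight is at least 1.\<close>
    let ?\<psi> = "\<lambda>q::nat. \<psi> 1"
    let ?w = "\<lambda>q. log 2 (real q) / sqrt (log 2 (log 2 (real q)))"
    have p1: "\<psi> 1 > 0" using assms(1) by simp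
    have w: "1 \<le> ?w q" if "q \<ge> 3" for q :: nat
    proof -
      define x where "x = log 2 (real q)"
      have x: "1 < x" using that by (simp add: x_def)
      \<comment> \<open>From ln 2 >= 2/3 the logarithm is at most 3 (x - 1)/2, and x^2 - 3 (x - 1)/2
        exceeds the square of x - 3/4.\<close>
      have "log 2 x \<le> (x - 1) / (2 / 3)"
        unfolding log_def using x ln_le_minus_one[of x] ln2_ge_two_thirds by (intro frac_le) auto
      also have "\<dots> \<le> x\<^sup>2" using zero_le_power2[of "x - 3 / 4"] by (simp add: power2_eq_square algebra_simps)
      finally have "sqrt (log 2 x) \<le> sqrt (x\<^sup>2)" by (simp only: real_sqrt_le_iff)
      then show ?thesis using x by (simp add: x_def)
    qed
    have "filterlim (\<lambda>N. \<Sum>q=3..N. ?\<psi> q * ?w q) at_top sequentially"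
    proof (rule filterlim_at_top_mono)
      show "filterlim (\<lambda>N. \<psi> 1 * (real N - 2)) at_top sequentially" using p1 by real_asymp
      show "\<forall>\<^sub>F N in sequentially. \<psi> 1 * (real N - 2) \<le> (\<Sum>q=3..N. ?\<psi> q * ?w q)"
        using eventually_ge_at_top[of 3]
      proof eventually_elim
        case (elim N)
        have "\<psi> 1 * (real N - 2) = (\<Sum>q=3..N. \<psi> 1 * 1)" using elim by (simp add: of_nat_diff algebra_simps)
        also have "\<dots> \<le> (\<Sum>q=3..N. ?\<psi> q * ?w q)" using p1 w by (intro sum_mono mult_left_mono) auto
        finally show ?case .
      qed
    qed
    then have W1: "measure lebesgue (W ?\<psi> \<beta> \<gamma> \<gamma>') = 1"
      using p1 by (intro full_measure_antimono[OF _ _ _ C(2,1)]) (auto intro: monotone_onI)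
    have sub: "W ?\<psi> \<beta> \<gamma> \<gamma>' \<subseteq> W \<psi> \<beta> \<gamma> \<gamma>'"
    proof -
      have "\<psi> 1 \<le> \<psi> q" if "1 \<le> q" for q using mono_onD[OF mono, of 1 q] that by simp
      then have "{q. 1 \<le> q \<and> f q < \<psi> 1} \<subseteq> {q. 1 \<le> q \<and> f q < \<psi> q}" for f by force
      from infinite_super[OF this] show ?thesis unfolding W_def by (intro Collect_mono conj_mono) auto
    qed
    have "measure lebesgue (W ?\<psi> \<beta> \<gamma> \<gamma>') \<le> measure lebesgue (W \<psi> \<beta> \<gamma> \<gamma>')"
      by (intro measure_mono_fmeasurable sub fmeasurableD W_lmeasurable)
    moreover have "measure lebesgue (W \<psi> \<beta> \<gamma> \<gamma>') \<le> measure lebesgue {0..1::real}"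
      by (intro measure_mono_fmeasurable W_subset fmeasurableD W_lmeasurable) simp
    ultimately show ?thesis using W1 by simp
  qed
  then show ?thesis using emeasure_eq_measure2[OF W_lmeasurable] by simp
qed

end
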